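(* Let $k$ be a non-zero commutative unitary ring, $r\ge n\ge 1$ integers, $m_1,\dots,m_n$ and $d_1,\dots,d_r$ positive integers, $C=k[X_1,\dots,X_n]$ graded by $\deg X_i=m_i$, and let $f_i\in C_{d_i}$ for $i=1,\dots,r$. Put $I=(f_1,\dots,f_r)$, $B=C/I$, $\mathfrak m=(X_1,\dots,X_n)$ and $\delta=\sum_{i=1}^r d_i-\sum_{i=1}^n m_i$. Let $$\hat\tau,\ \omega:\ \bigoplus_{\nu\in\mathbb Z}\mathrm{Hom}_k(B_{\delta-\nu},k)\longrightarrow H^0_{\mathfrak m}\big(H_{r-n}(f_1,\dots,f_r;C)\big)$$ be respectively the map induced by the transgression map of the Koszul complex and the map defined by the generalized Morley forms, $u\in \mathrm{Hom}_k(B_{\delta-\nu},k)\mapsto \nabla^{(u)}_{\nu,\delta-\nu}$ (both defined in the context). If $\mathrm{depth}_I(C)=n$, then $\hat\tau=\omega$.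
   Context: Setting. $C_0=k$ has degree $0$. For a sequence $\underline f=(f_1,\dots,f_r)$ and a $C$-module $M$, $K_\bullet(\underline f;M)$ is the Koszul complex and $H_p(\underline f;M)$ its homology. For $M=C$ it is graded: $K_1=\bigoplus_{i=1}^r C(-d_i)$ has canonical basis $e_1,\dots,e_r$ with $\deg e_i=d_i$, the differential sends $e_i$ to $f_i$, and $K_p=\bigwedge^p K_1$. Put $K^{-p}=K_p$, $H^{-p}(K^\bullet)=H_p(K_\bullet)$. $H^i_{\mathfrak m}$ is local cohomology with support in $(X_1,\dots,X_n)$ (computed by the Čech complex on $X_1,\dots,X_n$); in particular $H^0_{\mathfrak m}(M)=\{x\in M:\mathfrak m^p x=0\text{ for some }p\}$. Also $H^0(\underline f;M)=\{x\in M: f_1x=\dots=f_rx=0\}$. $\mathrm{depth}_I(C)$ is the depth (grade) of $I$ on $C$; without noetherian hypothesis it is understood in the Koszul sense, $\mathrm{depth}_I(C)=r-\max\{i:H_i(\underline f;C)\ne0\}$. The transgression map $\tau$. There are two spectral sequences ${}'E_1^{pq}=H^q_{\mathfrak m}(K^p)\Rightarrow H^{p+q}_{\mathfrak m}(K^\bullet)$ and ${}''E_2^{pq}=H^p_{\mathfrak m}(H^q(K^\bullet))\Rightarrow H^{p+q}_{\mathfrak m}(K^\bullet)$. Since $H^i_{\mathfrak m}(C)=0$ for $i\ne n$, the first identifies $H^{p}_{\mathfrak m}(K^\bullet)$ with $H^{p-n}(H^n_{\mathfrak m}(K^\bullet))$. The edge morphism $H^{-(r-n)}_{\mathfrak m}(K^\bullet)\to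 H^0_{\mathfrak m}(H^{-(r-n)}(K^\bullet))$ of the second, together with $H^{-r}(H^n_{\mathfrak m}(K^\bullet))\simeq H^0(\underline f;H^n_{\mathfrak m}(C))(-\sum_{i=1}^r d_i)$ (using the basis $e_1\wedge\dots\wedge e_r$ of $K_r$), gives the graded map $$\tau: H^0(\underline f;H^n_{\mathfrak m}(C))\Big(-\sum_{i=1}^r d_i\Big)\to H^0_{\mathfrak m}(H_{r-n}(\underline f;C)).$$ The map $\hat\tau$. For all $\nu$ there is a canonical perfect pairing of finite free $k$-modules $C_\nu\otimes_k H^n_{\mathfrak m}(C)_{-\nu-\sum_{i=1}^n m_i}\to H^n_{\mathfrak m}(C)_{-\sum_{i=1}^n m_i}\simeq k$ (multiplication; the last isomorphism sends the class of $1/(X_1\cdots X_n)$ to $1$). It yields $H^0(\underline f;H^n_{\mathfrak m}(C))(-\sum_{i=1}^r d_i)_\nu\simeq \mathrm{Hom}_k(B_{\delta-\nu},k)$, and $\hat\tau=\bigoplus_\nu\hat\tau_\nu$ is $\tau$ read through these isomorphisms. Sign convention: the sign (depending only on $n$ and $r$) implicit in the transgression and identifications is normalized so that for the sequence $(X_1,\dots,X_n,0,\dots,0)$ (with $r-n$ zeros, of arbitrary positive assigned degrees) $\hat\tau_\delta$ sends $1\in k=\mathrm{Hom}_k(B_0,k)$ to the class of $e_{n+1}\wedge\dots\wedge e_r$; for $r=n$ this means that $\hat\tau_0$ for the sequence $(X_1,\dots,X_n)$ is the identity of $k$. The generalized Morley forms. Identify $C\otimes_kC$ with $k[\underline X,\underline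 Y]$, $\deg X_i=\deg Y_i=m_i$. Choose (homogeneous) decompositions $f_i(\underline X)-f_i(\underline Y)=\sum_{j=1}^n (X_j-Y_j)g_{i,j}(\underline X,\underline Y)$ and set $$\Delta=\sum_{\sigma}\epsilon(\sigma)\,\det\big(g_{\sigma(a),b}\big)_{1\le a,b\le n}\;e_{\sigma(n+1)}\wedge\cdots\wedge e_{\sigma(r)},$$ the sum being over permutations $\sigma\in\mathfrak S_r$ with $\sigma(1)<\dots<\sigma(n)$ and $\sigma(n+1)<\dots<\sigma(r)$, with $\epsilon(\sigma)$ the signature. $\Delta$ is a cycle of the Koszul complex of $(f_i\otimes1-1\otimes f_i)_{i=1}^r$ over $C\otimes_kC$; its class $\Delta^\flat$ in $H_{r-n}$ of this complex has degree $\delta$ and does not depend on the choice of decompositions. Let $\nabla\in H_{r-n}(f_1\otimes1,\dots,f_r\otimes1;C\otimes_kB)$ be the image of $\Delta^\flat$ under the map induced by the projection $C\otimes_kC\to C\otimes_kB$. This homology is bigraded by $H_{r-n}(\ldots;C\otimes_kB)_{p,q}=H_{r-n}(\ldots;C\otimes_kB_q)_p$ (grading in $p$ via that of $C$ and of the $e_i$); write $\nabla=\sum_{p,q}\nabla_{p,q}$. The map $\omega$. For $u\in\mathrm{Hom}_k(B_{\delta-\nu},k)$, $\nabla^{(u)}_{\nu,\delta-\nu}\in H_{r-n}(\underline f;C)_\nu$ is the image of $\nabla_{\nu,\delta-\nu}$ under the map $H_{r-n}(\underline f;C\otimes_kB_{\delta-\nu})_\nu\to H_{r-n}(\underline f;C)_\nu$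 induced by $\mathrm{id}_C\otimes u:C\otimes_kB_{\delta-\nu}\to C\otimes_k k\simeq C$. It lies in $H^0_{\mathfrak m}(H_{r-n}(\underline f;C))$, and $\omega$ is $u\mapsto\nabla^{(u)}_{\nu,\delta-\nu}$ on the component of degree $\nu$. *)

theory Defs
  imports
    "HOL-Library.Function_Algebras"
    "HOL-Library.Set_Algebras"
    "HOL-Library.FuncSet"
    "HOL-Combinatorics.Permutations"
    "Jordan_Normal_Form.Determinant"
    "HOL-Library.Poly_Mapping"
begin

text \<open>
  Indices start at 0: the variables are \<open>X\<^sub>0, \<dots>, X\<^sub>n\<^sub>-\<^sub>1\<close>, the sequence is \<open>f\<^sub>0, \<dots>, f\<^sub>r\<^sub>-\<^sub>1\<close> and
  the basis of \<open>K\<^sub>1\<close> is \<open>e\<^sub>0, \<dots>, e\<^sub>r\<^sub>-\<^sub>1\<close>.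

  The polynomial ring \<open>C\<close> and its localizations at products of variables are all realized as
  subrings of one ring of Laurent polynomials. The ring \<open>C \<otimes>\<^sub>k C = k[X,Y]\<close> is realized as
  \<open>k[X][Y]\<close>: the outer exponents are those of \<open>Y\<close>, the coefficients are polynomials in \<open>X\<close>.
\<close>

type_synonym 'k laurent = "(nat \<Rightarrow>\<^sub>0 int) \<Rightarrow>\<^sub>0 'k"
type_synonym 'k laurent2 = "(nat \<Rightarrow>\<^sub>0 int) \<Rightarrow>\<^sub>0 'k laurent"

section \<open>Subquotients of abelian groups\<close>

text \<open>
  An element of a quotient \<open>M/N\<close> is a coset \<open>x +o N\<close>, and the sum of two cosets is their
  elementwise sum. If \<open>F\<close> is additive and maps \<open>N\<close> into the subgroup \<open>N'\<close>, then the map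
  induced on cosets sends \<open>x +o N\<close> to \<open>F x +o N' = F ` (x +o N) + N'\<close>.
\<close>

definition quot :: "'v::plus set \<Rightarrow> 'v set \<Rightarrow> 'v set set" where
  "quot M N = (\<lambda>x. x +o N) ` M"

definition induced :: "('v \<Rightarrow> 'w::plus) \<Rightarrow> 'w set \<Rightarrow> 'v set \<Rightarrow> 'w set" where
  "induced F N' A = F ` A + N'"

definition alt :: "nat \<Rightarrow> 'v::ab_group_add \<Rightarrow> 'v" where
  "alt s x = (if even s then x else - x)"

section \<open>The polynomial ring, its localizations and its grading\<close>

definition const :: "'k::zero \<Rightarrow> 'k laurent" where
  "const c = Poly_Mapping.single 0 c"

definition Xvar :: "nat \<Rightarrow> 'k::zero_neq_one laurent" where
  "Xvar j = Poly_Mapping.single (Poly_Mapping.single j 1) 1"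

text \<open>\<open>loc n S\<close> is the localization of \<open>k[X\<^sub>0,\<dots>,X\<^sub>n\<^sub>-\<^sub>1]\<close> at \<open>\<Prod>j\<in>S. X\<^sub>j\<close>, for \<open>S \<subseteq> {..<n}\<close>.\<close>

definition loc :: "nat \<Rightarrow> nat set \<Rightarrow> 'k::zero laurent set" where
  "loc n S = {p. \<forall>a\<in>Poly_Mapping.keys p.
     Poly_Mapping.keys a \<subseteq> {..<n} \<and> (\<forall>j. j \<notin> S \<longrightarrow> 0 \<le> Poly_Mapping.lookup a j)}"

abbreviation polys :: "nat \<Rightarrow> 'k::zero laurent set" where
  "polys n \<equiv> loc n {}"

definition wdeg :: "nat \<Rightarrow> (nat \<Rightarrow> nat) \<Rightarrow> (nat \<Rightarrow>\<^sub>0 int) \<Rightarrow> int" where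
  "wdeg n m a = (\<Sum>j<n. int (m j) * Poly_Mapping.lookup a j)"

definition homog :: "nat \<Rightarrow> (nat \<Rightarrow> nat) \<Rightarrow> int \<Rightarrow> 'k::zero laurent set" where
  "homog n m q = {p. \<forall>a\<in>Poly_Mapping.keys p. wdeg n m a = q}"

definition hpart :: "nat \<Rightarrow> (nat \<Rightarrow> nat) \<Rightarrow> int \<Rightarrow> 'k::comm_monoid_add laurent \<Rightarrow> 'k laurent" where
  "hpart n m q p = (\<Sum>a\<in>{a \<in> Poly_Mapping.keys p. wdeg n m a = q}.
     Poly_Mapping.single a (Poly_Mapping.lookup p a))"

text \<open>The ideal generated by \<open>G\<close> in the subring \<open>A\<close> of an ambient ring.\<close>

definition ideal_gen :: "'a::comm_ring_1 set \<Rightarrow> 'a set \<Rightarrow> 'a set" where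
  "ideal_gen A G = {(\<Sum>g\<in>F. c g * g) | c F. finite F \<and> F \<subseteq> G \<and> (\<forall>g\<in>F. c g \<in> A)}"

section \<open>Koszul homology\<close>

text \<open>
  For subgroups \<open>N \<subseteq> M\<close> of a commutative ring that are stable under multiplication by the \<open>f\<^sub>i\<close>,
  the homology of the complex \<open>K(f; M/N) = K(f; M)/K(f; N)\<close>. The chain \<open>z\<close> stands for
  \<open>\<Sum>T. z T e\<^sub>T\<close>, where \<open>e\<^sub>T\<close> is the exterior product of the \<open>e\<^sub>i\<close>, \<open>i \<in> T\<close>, in increasing
  order. The subtraction \<open>p - 1\<close> is harmless for \<open>p = 0\<close>, as the differential vanishes on \<open>K\<^sub>0\<close>.
\<close>

definition koszul :: "nat \<Rightarrow> nat \<Rightarrow> 'a::zero set \<Rightarrow> (nat set \<Rightarrow> 'a) set" where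
  "koszul r p M = {z. \<forall>T. if T \<subseteq> {..<r} \<and> card T = p then z T \<in> M else z T = 0}"

definition kbasis :: "nat set \<Rightarrow> nat set \<Rightarrow> 'a::zero_neq_one" where
  "kbasis T = (\<lambda>T'. if T' = T then 1 else 0)"

definition kdiff :: "nat \<Rightarrow> (nat \<Rightarrow> 'a::comm_ring_1) \<Rightarrow> (nat set \<Rightarrow> 'a) \<Rightarrow> nat set \<Rightarrow> 'a" where
  "kdiff r f z T = (\<Sum>i\<in>{..<r} - T. alt (card {j \<in> T. j < i}) (f i * z (insert i T)))"

definition kcycles ::
  "nat \<Rightarrow> (nat \<Rightarrow> 'a::comm_ring_1) \<Rightarrow> 'a set \<Rightarrow> 'a set \<Rightarrow> nat \<Rightarrow> (nat set \<Rightarrow> 'a) set" where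
  "kcycles r f M N p = {z \<in> koszul r p M. kdiff r f z \<in> koszul r (p - 1) N}"

definition kbounds ::
  "nat \<Rightarrow> (nat \<Rightarrow> 'a::comm_ring_1) \<Rightarrow> 'a set \<Rightarrow> 'a set \<Rightarrow> nat \<Rightarrow> (nat set \<Rightarrow> 'a) set" where
  "kbounds r f M N p = kdiff r f ` koszul r (p + 1) M + koszul r p N"

definition khom ::
  "nat \<Rightarrow> (nat \<Rightarrow> 'a::comm_ring_1) \<Rightarrow> 'a set \<Rightarrow> 'a set \<Rightarrow> nat \<Rightarrow> (nat set \<Rightarrow> 'a) set set" where
  "khom r f M N p = quot (kcycles r f M N p) (kbounds r f M N p)"

abbreviation kboundsC ::
  "nat \<Rightarrow> nat \<Rightarrow> (nat \<Rightarrow> 'k::comm_ring_1 laurent) \<Rightarrow> nat \<Rightarrow> (nat set \<Rightarrow> 'k laurent) set" where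
  "kboundsC n r f p \<equiv> kbounds r f (polys n) {0} p"

definition khomC ::
  "nat \<Rightarrow> nat \<Rightarrow> (nat \<Rightarrow> 'k::comm_ring_1 laurent) \<Rightarrow> nat \<Rightarrow> (nat set \<Rightarrow> 'k laurent) set set" where
  "khomC n r f p = khom r f (polys n) {0} p"

definition koszul_depth :: "nat \<Rightarrow> nat \<Rightarrow> (nat \<Rightarrow> 'k::comm_ring_1 laurent) \<Rightarrow> nat" where
  "koszul_depth n r f = r - Max {p. khomC n r f p \<noteq> {kboundsC n r f p}}"

text \<open>
  \<open>H0m n r f p\<close> is \<open>H\<^sup>0\<^sub>\<mm>(H\<^sub>p(f; C))\<close>. Here \<open>^ e\<close> is the power of a set, that is the set of
  products of \<open>e\<close> elements, so that the inner \<open>ideal_gen\<close> is \<open>\<mm>\<^sup>e\<close>.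
\<close>

definition max_ideal :: "nat \<Rightarrow> 'k::comm_ring_1 laurent set" where
  "max_ideal n = ideal_gen (polys n) (Xvar ` {..<n})"

definition H0m ::
  "nat \<Rightarrow> nat \<Rightarrow> (nat \<Rightarrow> 'k::comm_ring_1 laurent) \<Rightarrow> nat \<Rightarrow> (nat set \<Rightarrow> 'k laurent) set set" where
  "H0m n r f p = {A \<in> khomC n r f p.
     \<exists>e. \<forall>a \<in> ideal_gen (polys n) (max_ideal n ^ e).
       induced (\<lambda>z T. a * z T) (kboundsC n r f p) A = kboundsC n r f p}"

section \<open>Cech cohomology\<close>

text \<open>
  \<open>MS S\<close> is the localization at \<open>\<Prod>j\<in>S. X\<^sub>j\<close> of the module considered, and \<open>MS {}\<close> sits in
  degree 0. In degree \<open>n\<close> (with \<open>n \<ge> 1\<close>) every cochain is a cocycle.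
\<close>

definition cech :: "nat \<Rightarrow> nat \<Rightarrow> (nat set \<Rightarrow> 'v::zero set) \<Rightarrow> (nat set \<Rightarrow> 'v) set" where
  "cech n q MS = {w. \<forall>S. if S \<subseteq> {..<n} \<and> card S = q then w S \<in> MS S else w S = 0}"

definition cdiff :: "nat \<Rightarrow> (nat set \<Rightarrow> 'v::ab_group_add) \<Rightarrow> nat set \<Rightarrow> 'v" where
  "cdiff n w S =
     (if S \<subseteq> {..<n} then (\<Sum>j\<in>S. alt (card {i \<in> S. i < j}) (w (S - {j}))) else 0)"

definition cech_bounds :: "nat \<Rightarrow> (nat set \<Rightarrow> 'v::ab_group_add set) \<Rightarrow> (nat set \<Rightarrow> 'v) set" where
  "cech_bounds n MS = cdiff n ` cech n (n - 1) MS"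

text \<open>\<open>Hn n\<close> is \<open>H\<^sup>n\<^sub>\<mm>(C)\<close>, and \<open>Hn_deg n m \<mu>\<close> is its component of degree \<open>\<mu>\<close>.\<close>

abbreviation Hn_zero :: "nat \<Rightarrow> (nat set \<Rightarrow> 'k::comm_ring_1 laurent) set" where
  "Hn_zero n \<equiv> cech_bounds n (loc n)"

definition Hn :: "nat \<Rightarrow> (nat set \<Rightarrow> 'k::comm_ring_1 laurent) set set" where
  "Hn n = quot (cech n n (loc n)) (Hn_zero n)"

definition Hn_deg ::
  "nat \<Rightarrow> (nat \<Rightarrow> nat) \<Rightarrow> int \<Rightarrow> (nat set \<Rightarrow> 'k::comm_ring_1 laurent) set set" where
  "Hn_deg n m \<mu> = quot (cech n n (\<lambda>S. loc n S \<inter> homog n m \<mu>)) (Hn_zero n)"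

definition Hn_class :: "nat \<Rightarrow> 'k::comm_ring_1 laurent \<Rightarrow> (nat set \<Rightarrow> 'k laurent) set" where
  "Hn_class n p = (\<lambda>S. if S = {..<n} then p else 0) +o Hn_zero n"

definition Hn_mult ::
  "nat \<Rightarrow> 'k::comm_ring_1 laurent \<Rightarrow> (nat set \<Rightarrow> 'k laurent) set \<Rightarrow> (nat set \<Rightarrow> 'k laurent) set" where
  "Hn_mult n b = induced (\<lambda>w S. b * w S) (Hn_zero n)"

definition H0f ::
  "nat \<Rightarrow> nat \<Rightarrow> (nat \<Rightarrow> 'k::comm_ring_1 laurent) \<Rightarrow> (nat set \<Rightarrow> 'k laurent) set set" where
  "H0f n r f = {A \<in> Hn n. \<forall>i<r. Hn_mult n (f i) A = Hn_zero n}"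

text \<open>
  \<open>inv_X n\<close> is \<open>1/(X\<^sub>0 \<cdots> X\<^sub>n\<^sub>-\<^sub>1)\<close>, and \<open>residue n\<close> is the isomorphism from the component of
  degree \<open>-\<Sum>j<n. m j\<close> of \<open>H\<^sup>n\<^sub>\<mm>(C)\<close> to \<open>k\<close> that sends its class to 1.
\<close>

definition inv_X :: "nat \<Rightarrow> 'k::zero_neq_one laurent" where
  "inv_X n = Poly_Mapping.single (\<Sum>j<n. Poly_Mapping.single j (-1)) 1"

definition residue :: "nat \<Rightarrow> (nat set \<Rightarrow> 'k::comm_ring_1 laurent) set \<Rightarrow> 'k" where
  "residue n A = (THE c. A = Hn_mult n (const c) (Hn_class n (inv_X n)))"

section \<open>Hypercohomology of the Koszul complex and transgression\<close>

text \<open>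
  \<open>total n r s\<close> is the component of cohomological degree \<open>-s\<close> of the total complex of the Cech
  complex with values in \<open>K\<^sup>\<bullet>\<close>: the component in Cech degree \<open>card S\<close> lies in \<open>K\<^sub>p\<close> with
  \<open>p = card S + s\<close>. The Koszul differential gets the sign \<open>(-1)^card S\<close>.
\<close>

definition total :: "nat \<Rightarrow> nat \<Rightarrow> nat \<Rightarrow> (nat set \<Rightarrow> nat set \<Rightarrow> 'k::comm_ring_1 laurent) set" where
  "total n r s = {w. \<forall>S. if S \<subseteq> {..<n} then w S \<in> koszul r (card S + s) (loc n S) else w S = 0}"

definition tdiff ::
  "nat \<Rightarrow> nat \<Rightarrow> (nat \<Rightarrow> 'k::comm_ring_1 laurent)
    \<Rightarrow> (nat set \<Rightarrow> nat set \<Rightarrow> 'k laurent) \<Rightarrow> nat set \<Rightarrow> nat set \<Rightarrow> 'k laurent" where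
  "tdiff n r f w = (\<lambda>S. cdiff n w S + alt (card S) (kdiff r f (w S)))"

text \<open>\<open>hyper n r f s\<close> is \<open>H\<^sup>-\<^sup>s\<^sub>\<mm>(K\<^sup>\<bullet>)\<close>.\<close>

definition hyper ::
  "nat \<Rightarrow> nat \<Rightarrow> (nat \<Rightarrow> 'k::comm_ring_1 laurent) \<Rightarrow> nat
    \<Rightarrow> (nat set \<Rightarrow> nat set \<Rightarrow> 'k laurent) set set" where
  "hyper n r f s = quot {w \<in> total n r s. tdiff n r f w = 0} (tdiff n r f ` total n r (s + 1))"

text \<open>
  The zero element of \<open>H\<^sup>n\<^sub>\<mm>(K\<^sub>r)\<close>. As \<open>K\<^sub>r\<^sub>+\<^sub>1 = 0\<close>, the module \<open>H\<^sup>-\<^sup>r(H\<^sup>n\<^sub>\<mm>(K\<^sup>\<bullet>))\<close> is a submodule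
  of \<open>H\<^sup>n\<^sub>\<mm>(K\<^sub>r)\<close>.
\<close>

abbreviation HnK_zero :: "nat \<Rightarrow> nat \<Rightarrow> (nat set \<Rightarrow> nat set \<Rightarrow> 'k::comm_ring_1 laurent) set" where
  "HnK_zero n r \<equiv> cech_bounds n (\<lambda>S. koszul r r (loc n S))"

text \<open>The isomorphism \<open>x \<mapsto> x e\<^sub>0 \<and> \<dots> \<and> e\<^sub>r\<^sub>-\<^sub>1\<close> from \<open>H\<^sup>0(f; H\<^sup>n\<^sub>\<mm>(C))\<close> to \<open>H\<^sup>-\<^sup>r(H\<^sup>n\<^sub>\<mm>(K\<^sup>\<bullet>))\<close>.\<close>

definition wedge_top ::
  "nat \<Rightarrow> nat \<Rightarrow> (nat set \<Rightarrow> 'k::comm_ring_1 laurent) set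
    \<Rightarrow> (nat set \<Rightarrow> nat set \<Rightarrow> 'k laurent) set" where
  "wedge_top n r = induced (\<lambda>w S T. w S * kbasis {..<r} T) (HnK_zero n r)"

text \<open>
  The identification \<open>H\<^sup>-\<^sup>(\<^sup>r\<^sup>-\<^sup>n\<^sup>)\<^sub>\<mm>(K\<^sup>\<bullet>) \<simeq> H\<^sup>-\<^sup>r(H\<^sup>n\<^sub>\<mm>(K\<^sup>\<bullet>))\<close> given by the first spectral sequence:
  the class of a total cocycle goes to the class of its component of Cech degree \<open>n\<close>.
\<close>

definition first_iso ::
  "nat \<Rightarrow> nat \<Rightarrow> (nat set \<Rightarrow> nat set \<Rightarrow> 'k::comm_ring_1 laurent) set
    \<Rightarrow> (nat set \<Rightarrow> nat set \<Rightarrow> 'k laurent) set" where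
  "first_iso n r = induced (\<lambda>w S. if S = {..<n} then w S else 0) (HnK_zero n r)"

text \<open>
  The edge morphism \<open>H\<^sup>-\<^sup>(\<^sup>r\<^sup>-\<^sup>n\<^sup>)\<^sub>\<mm>(K\<^sup>\<bullet>) \<rightarrow> H\<^sup>0\<^sub>\<mm>(H\<^sub>r\<^sub>-\<^sub>n(f; C))\<close> of the second spectral sequence:
  the class of a total cocycle goes to the class of its component of Cech degree 0.
\<close>

definition edge ::
  "nat \<Rightarrow> nat \<Rightarrow> (nat \<Rightarrow> 'k::comm_ring_1 laurent)
    \<Rightarrow> (nat set \<Rightarrow> nat set \<Rightarrow> 'k laurent) set \<Rightarrow> (nat set \<Rightarrow> 'k laurent) set" where
  "edge n r f = induced (\<lambda>w. w {}) (kboundsC n r f (r - n))"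

text \<open>The transgression, before normalization of the sign.\<close>

definition tau0 ::
  "nat \<Rightarrow> nat \<Rightarrow> (nat \<Rightarrow> 'k::comm_ring_1 laurent)
    \<Rightarrow> (nat set \<Rightarrow> 'k laurent) set \<Rightarrow> (nat set \<Rightarrow> 'k laurent) set" where
  "tau0 n r f A = edge n r f (inv_into (hyper n r f (r - n)) (first_iso n r) (wedge_top n r A))"

definition khom_scale ::
  "nat \<Rightarrow> nat \<Rightarrow> (nat \<Rightarrow> 'k::comm_ring_1 laurent) \<Rightarrow> 'k
    \<Rightarrow> (nat set \<Rightarrow> 'k laurent) set \<Rightarrow> (nat set \<Rightarrow> 'k laurent) set" where
  "khom_scale n r f c = induced (\<lambda>z T. const c * z T) (kboundsC n r f (r - n))"

text \<open>
  The sign, as an element of \<open>k\<close>, is fixed by its effect for \<open>(X\<^sub>0, \<dots>, X\<^sub>n\<^sub>-\<^sub>1, 0, \<dots>, 0)\<close>: the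
  class of \<open>1/(X\<^sub>0 \<cdots> X\<^sub>n\<^sub>-\<^sub>1)\<close>, which corresponds to \<open>1 \<in> k = Hom\<^sub>k(B\<^sub>0,k)\<close>, has to go to the
  class of \<open>e\<^sub>n \<and> \<dots> \<and> e\<^sub>r\<^sub>-\<^sub>1\<close>. The map \<open>tau0\<close> makes no use of the assigned degrees.
\<close>

definition std_seq :: "nat \<Rightarrow> nat \<Rightarrow> 'k::comm_ring_1 laurent" where
  "std_seq n i = (if i < n then Xvar i else 0)"

definition tau_sign :: "nat \<Rightarrow> nat \<Rightarrow> 'k::comm_ring_1" where
  "tau_sign n r = (THE s. s \<in> {1, -1} \<and>
     khom_scale n r (std_seq n) s (tau0 n r (std_seq n) (Hn_class n (inv_X n)))
       = kbasis {n..<r} +o kboundsC n r (std_seq n) (r - n))"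

definition tau ::
  "nat \<Rightarrow> nat \<Rightarrow> (nat \<Rightarrow> 'k::comm_ring_1 laurent)
    \<Rightarrow> (nat set \<Rightarrow> 'k laurent) set \<Rightarrow> (nat set \<Rightarrow> 'k laurent) set" where
  "tau n r f A = khom_scale n r f (tau_sign n r) (tau0 n r f A)"

section \<open>The graded dual of \<open>B\<close> and the map \<open>\<tau>\<close> read on it\<close>

definition delta :: "nat \<Rightarrow> (nat \<Rightarrow> nat) \<Rightarrow> nat \<Rightarrow> (nat \<Rightarrow> nat) \<Rightarrow> int" where
  "delta n m r d = (\<Sum>i<r. int (d i)) - (\<Sum>j<n. int (m j))"

definition idl :: "nat \<Rightarrow> nat \<Rightarrow> (nat \<Rightarrow> 'k::comm_ring_1 laurent) \<Rightarrow> 'k laurent set" where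
  "idl n r f = ideal_gen (polys n) (f ` {..<r})"

definition Bdeg ::
  "nat \<Rightarrow> (nat \<Rightarrow> nat) \<Rightarrow> nat \<Rightarrow> (nat \<Rightarrow> 'k::comm_ring_1 laurent) \<Rightarrow> int \<Rightarrow> 'k laurent set set" where
  "Bdeg n m r f q = quot (polys n \<inter> homog n m q) (idl n r f)"

text \<open>\<open>Hom\<^sub>k(B\<^sub>q,k)\<close>; its elements are extended by 0 outside \<open>B\<^sub>q\<close>.\<close>

definition Bdual ::
  "nat \<Rightarrow> (nat \<Rightarrow> nat) \<Rightarrow> nat \<Rightarrow> (nat \<Rightarrow> 'k::comm_ring_1 laurent) \<Rightarrow> int \<Rightarrow> ('k laurent set \<Rightarrow> 'k) set" where
  "Bdual n m r f q = {u.
     (\<forall>A\<in>Bdeg n m r f q. \<forall>B\<in>Bdeg n m r f q. u (A + B) = u A + u B) \<and>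
     (\<forall>c. \<forall>A\<in>Bdeg n m r f q. u (induced ((*) (const c)) (idl n r f) A) = c * u A) \<and>
     (\<forall>A. A \<notin> Bdeg n m r f q \<longrightarrow> u A = 0)}"

text \<open>The direct sum over \<open>\<nu>\<close> of the modules \<open>Hom\<^sub>k(B\<^sub>\<delta>\<^sub>-\<^sub>\<nu>,k)\<close>.\<close>

definition dual_sum ::
  "nat \<Rightarrow> (nat \<Rightarrow> nat) \<Rightarrow> nat \<Rightarrow> (nat \<Rightarrow> nat) \<Rightarrow> (nat \<Rightarrow> 'k::comm_ring_1 laurent)
    \<Rightarrow> (int \<Rightarrow> 'k laurent set \<Rightarrow> 'k) set" where
  "dual_sum n m r d f =
     {u. (\<forall>\<nu>. u \<nu> \<in> Bdual n m r f (delta n m r d - \<nu>)) \<and> finite {\<nu>. u \<nu> \<noteq> 0}}"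

text \<open>
  The element of \<open>H\<^sup>0(f; H\<^sup>n\<^sub>\<mm>(C))\<close> of degree \<open>\<nu> - \<Sum>i<r. d i\<close> that represents the form \<open>u\<close> on
  \<open>B\<^sub>\<delta>\<^sub>-\<^sub>\<nu>\<close> under the perfect pairing.
\<close>

definition dual_elt ::
  "nat \<Rightarrow> (nat \<Rightarrow> nat) \<Rightarrow> nat \<Rightarrow> (nat \<Rightarrow> nat) \<Rightarrow> (nat \<Rightarrow> 'k::comm_ring_1 laurent)
    \<Rightarrow> int \<Rightarrow> ('k laurent set \<Rightarrow> 'k) \<Rightarrow> (nat set \<Rightarrow> 'k laurent) set" where
  "dual_elt n m r d f \<nu> u = (THE A. A \<in> H0f n r f \<and> A \<in> Hn_deg n m (\<nu> - (\<Sum>i<r. int (d i))) \<and>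
     (\<forall>b \<in> polys n \<inter> homog n m (delta n m r d - \<nu>).
        residue n (Hn_mult n b A) = u (b +o idl n r f)))"

definition tau_hat ::
  "nat \<Rightarrow> (nat \<Rightarrow> nat) \<Rightarrow> nat \<Rightarrow> (nat \<Rightarrow> nat) \<Rightarrow> (nat \<Rightarrow> 'k::comm_ring_1 laurent)
    \<Rightarrow> (int \<Rightarrow> 'k laurent set \<Rightarrow> 'k) \<Rightarrow> (nat set \<Rightarrow> 'k laurent) set" where
  "tau_hat n m r d f u =
     (\<Sum>\<nu> | u \<nu> \<noteq> 0. tau n r f (dual_elt n m r d f \<nu> (u \<nu>))) + kboundsC n r f (r - n)"

section \<open>Generalized Morley forms\<close>

definition polys2 :: "nat \<Rightarrow> 'k::zero laurent2 set" where
  "polys2 n = {P. \<forall>b\<in>Poly_Mapping.keys P.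
     Poly_Mapping.keys b \<subseteq> {..<n} \<and> (\<forall>j. 0 \<le> Poly_Mapping.lookup b j) \<and>
     Poly_Mapping.lookup P b \<in> polys n}"

definition homog2 :: "nat \<Rightarrow> (nat \<Rightarrow> nat) \<Rightarrow> int \<Rightarrow> 'k::zero laurent2 set" where
  "homog2 n m q = {P. \<forall>b\<in>Poly_Mapping.keys P.
     \<forall>a\<in>Poly_Mapping.keys (Poly_Mapping.lookup P b). wdeg n m a + wdeg n m b = q}"

text \<open>\<open>in_X p = p \<otimes> 1 = p(X)\<close> and \<open>in_Y p = 1 \<otimes> p = p(Y)\<close>.\<close>

definition in_X :: "'k::zero laurent \<Rightarrow> 'k laurent2" where
  "in_X p = Poly_Mapping.single 0 p"

definition in_Y :: "'k::zero laurent \<Rightarrow> 'k laurent2" where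
  "in_Y p = Poly_Mapping.map const p"

definition morley_decomp ::
  "nat \<Rightarrow> (nat \<Rightarrow> nat) \<Rightarrow> nat \<Rightarrow> (nat \<Rightarrow> nat) \<Rightarrow> (nat \<Rightarrow> 'k::comm_ring_1 laurent)
    \<Rightarrow> (nat \<Rightarrow> nat \<Rightarrow> 'k laurent2) \<Rightarrow> bool" where
  "morley_decomp n m r d f g \<longleftrightarrow>
     (\<forall>i<r. \<forall>j<n. g i j \<in> polys2 n \<inter> homog2 n m (int (d i) - int (m j))) \<and>
     (\<forall>i<r. in_X (f i) - in_Y (f i) = (\<Sum>j<n. (in_X (Xvar j) - in_Y (Xvar j)) * g i j))"

definition shuffle_perms :: "nat \<Rightarrow> nat \<Rightarrow> (nat \<Rightarrow> nat) set" where
  "shuffle_perms n r =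
     {\<sigma>. \<sigma> permutes {..<r} \<and> strict_mono_on {..<n} \<sigma> \<and> strict_mono_on {n..<r} \<sigma>}"

definition Delta ::
  "nat \<Rightarrow> nat \<Rightarrow> (nat \<Rightarrow> nat \<Rightarrow> 'k::comm_ring_1 laurent2) \<Rightarrow> nat set \<Rightarrow> 'k laurent2" where
  "Delta n r g T = (\<Sum>\<sigma>\<in>shuffle_perms n r.
     of_int (sign \<sigma>) * det (mat n n (\<lambda>(a, b). g (\<sigma> a) b)) * kbasis (\<sigma> ` {n..<r}) T)"

definition Delta_class ::
  "nat \<Rightarrow> nat \<Rightarrow> (nat \<Rightarrow> 'k::comm_ring_1 laurent) \<Rightarrow> (nat \<Rightarrow> nat \<Rightarrow> 'k laurent2)
    \<Rightarrow> (nat set \<Rightarrow> 'k laurent2) set" where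
  "Delta_class n r f g =
     Delta n r g +o kbounds r (\<lambda>i. in_X (f i) - in_Y (f i)) (polys2 n) {0} (r - n)"

text \<open>
  \<open>C \<otimes>\<^sub>k B\<close> is \<open>polys2 n\<close> modulo \<open>idlY n r f\<close>, the ideal generated by the \<open>1 \<otimes> f\<^sub>i\<close>. The
  sequences \<open>f\<^sub>i \<otimes> 1 - 1 \<otimes> f\<^sub>i\<close> and \<open>f\<^sub>i \<otimes> 1\<close> agree on it, so the identity of chains induces the
  map from the homology over \<open>C \<otimes>\<^sub>k C\<close> to the homology over \<open>C \<otimes>\<^sub>k B\<close>.
\<close>

definition idlY :: "nat \<Rightarrow> nat \<Rightarrow> (nat \<Rightarrow> 'k::comm_ring_1 laurent) \<Rightarrow> 'k laurent2 set" where
  "idlY n r f = ideal_gen (polys2 n) ((\<lambda>i. in_Y (f i)) ` {..<r})"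

definition Nabla ::
  "nat \<Rightarrow> nat \<Rightarrow> (nat \<Rightarrow> 'k::comm_ring_1 laurent) \<Rightarrow> (nat \<Rightarrow> nat \<Rightarrow> 'k laurent2)
    \<Rightarrow> (nat set \<Rightarrow> 'k laurent2) set" where
  "Nabla n r f g =
     induced (\<lambda>z. z) (kbounds r (\<lambda>i. in_X (f i)) (polys2 n) (idlY n r f) (r - n))
       (Delta_class n r f g)"

text \<open>
  \<open>C \<otimes>\<^sub>k B\<^sub>q\<close> is \<open>polys2_Y n m q\<close> modulo its intersection with \<open>idlY n r f\<close>. On chains, the
  component of bidegree \<open>(p,q)\<close> takes into account that \<open>e\<^sub>T\<close> has degree \<open>\<Sum>i\<in>T. d i\<close>.
\<close>

definition polys2_Y :: "nat \<Rightarrow> (nat \<Rightarrow> nat) \<Rightarrow> int \<Rightarrow> 'k::zero laurent2 set" where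
  "polys2_Y n m q = {P \<in> polys2 n. \<forall>b\<in>Poly_Mapping.keys P. wdeg n m b = q}"

definition bipart ::
  "nat \<Rightarrow> (nat \<Rightarrow> nat) \<Rightarrow> (nat \<Rightarrow> nat) \<Rightarrow> int \<Rightarrow> int
    \<Rightarrow> (nat set \<Rightarrow> 'k::comm_ring_1 laurent2) \<Rightarrow> nat set \<Rightarrow> 'k laurent2" where
  "bipart n m d p q z T = (\<Sum>b\<in>{b \<in> Poly_Mapping.keys (z T). wdeg n m b = q}.
     Poly_Mapping.single b (hpart n m (p - (\<Sum>i\<in>T. int (d i))) (Poly_Mapping.lookup (z T) b)))"

definition Nabla_part ::
  "nat \<Rightarrow> (nat \<Rightarrow> nat) \<Rightarrow> nat \<Rightarrow> (nat \<Rightarrow> nat) \<Rightarrow> (nat \<Rightarrow> 'k::comm_ring_1 laurent)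
    \<Rightarrow> (nat \<Rightarrow> nat \<Rightarrow> 'k laurent2) \<Rightarrow> int \<Rightarrow> int \<Rightarrow> (nat set \<Rightarrow> 'k laurent2) set" where
  "Nabla_part n m r d f g p q =
     induced (bipart n m d p q)
       (kbounds r (\<lambda>i. in_X (f i)) (polys2_Y n m q) (polys2_Y n m q \<inter> idlY n r f) (r - n))
       (Nabla n r f g)"

text \<open>The map \<open>id\<^sub>C \<otimes> u\<close>, for \<open>u \<in> Hom\<^sub>k(B\<^sub>q,k)\<close>, on representatives in \<open>C \<otimes>\<^sub>k C\<^sub>q\<close>.\<close>

definition id_tensor ::
  "nat \<Rightarrow> nat \<Rightarrow> (nat \<Rightarrow> 'k::comm_ring_1 laurent) \<Rightarrow> ('k laurent set \<Rightarrow> 'k)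
    \<Rightarrow> 'k laurent2 \<Rightarrow> 'k laurent" where
  "id_tensor n r f u P =
     (\<Sum>b\<in>Poly_Mapping.keys P.
        const (u (Poly_Mapping.single b 1 +o idl n r f)) * Poly_Mapping.lookup P b)"

definition omega_part ::
  "nat \<Rightarrow> (nat \<Rightarrow> nat) \<Rightarrow> nat \<Rightarrow> (nat \<Rightarrow> nat) \<Rightarrow> (nat \<Rightarrow> 'k::comm_ring_1 laurent)
    \<Rightarrow> (nat \<Rightarrow> nat \<Rightarrow> 'k laurent2) \<Rightarrow> int \<Rightarrow> ('k laurent set \<Rightarrow> 'k) \<Rightarrow> (nat set \<Rightarrow> 'k laurent) set" where
  "omega_part n m r d f g \<nu> u =
     induced (\<lambda>z T. id_tensor n r f u (z T)) (kboundsC n r f (r - n))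
       (Nabla_part n m r d f g \<nu> (delta n m r d - \<nu>))"

definition omega ::
  "nat \<Rightarrow> (nat \<Rightarrow> nat) \<Rightarrow> nat \<Rightarrow> (nat \<Rightarrow> nat) \<Rightarrow> (nat \<Rightarrow> 'k::comm_ring_1 laurent)
    \<Rightarrow> (nat \<Rightarrow> nat \<Rightarrow> 'k laurent2) \<Rightarrow> (int \<Rightarrow> 'k laurent set \<Rightarrow> 'k) \<Rightarrow> (nat set \<Rightarrow> 'k laurent) set" where
  "omega n m r d f g u =
     (\<Sum>\<nu> | u \<nu> \<noteq> 0. omega_part n m r d f g \<nu> (u \<nu>)) + kboundsC n r f (r - n)"

end

theory Submission
  imports Defs
begin

text \<open>
  Both maps are computed by one explicit total cocycle. Let \<open>h \<in> H\<^sup>n\<^sub>\<mm>(C)\<close> be the class that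
  corresponds to a linear form \<open>u\<close> on \<open>B\<close>; it is represented by \<open>\<Sum>b. u(X\<^sup>b) X\<^sup>-\<^sup>1\<^sup>-\<^sup>b\<close>, which is the image
  under \<open>id \<otimes> u\<close> of the product of the series \<open>1/(X\<^sub>j - Y\<^sub>j) = \<Sum>a. Y\<^sub>j\<^sup>a X\<^sub>j\<^sup>-\<^sup>a\<^sup>-\<^sup>1\<close>. In the Koszul complex
  of the \<open>X\<^sub>j - Y\<^sub>j\<close>, with basis \<open>\<epsilon>\<^sub>0, \<dots>, \<epsilon>\<^sub>n\<^sub>-\<^sub>1\<close> in degree 1, the elements \<open>(\<Prod>j\<in>S. 1/(X\<^sub>j - Y\<^sub>j)) \<epsilon>\<^sub>S\<close>
  form, up to signs, a total cocycle for the Cech complex on the \<open>X\<^sub>j\<close>: the Koszul differential of the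
  component \<open>S\<close> is the alternating sum of the components \<open>S - {j}\<close>. This cocycle joins \<open>1\<close> in Cech degree 0
  to \<open>\<Prod>j<n. 1/(X\<^sub>j - Y\<^sub>j)\<close> in Cech degree \<open>n\<close>.

  The decompositions \<open>f\<^sub>i(X) - f\<^sub>i(Y) = \<Sum>\<^sub>j (X\<^sub>j - Y\<^sub>j) g\<^sub>i\<^sub>j\<close> give a morphism from the Koszul complex of the
  \<open>X\<^sub>j - Y\<^sub>j\<close> to that of the \<open>f\<^sub>i(X) - f\<^sub>i(Y)\<close>, of degree \<open>r - n\<close>, which sends \<open>1\<close> to the Morley form \<open>\<Delta>\<close>
  and \<open>\<epsilon>\<^sub>0 \<and> \<dots> \<and> \<epsilon>\<^sub>n\<^sub>-\<^sub>1\<close> to \<open>e\<^sub>0 \<and> \<dots> \<and> e\<^sub>r\<^sub>-\<^sub>1\<close>. As \<open>u\<close> vanishes on the ideal of the \<open>f\<^sub>i\<close>, the map \<open>id \<otimes> u\<close> is a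
  morphism from the latter complex to the Koszul complex of \<open>f\<close> on \<open>C\<close>. The composite sends the cocycle
  above to a total cocycle with top component \<open>h e\<^sub>0 \<and> \<dots> \<and> e\<^sub>r\<^sub>-\<^sub>1\<close> and with bottom component
  \<open>(id \<otimes> u)(\<Delta>)\<close>, both up to sign. Thus the transgression sends \<open>h\<close> to the class of
  \<open>(id \<otimes> u)(\<Delta>)\<close>, which is \<open>\<omega>(u)\<close> (\<open>tau0_dual_poly\<close>, \<open>dual_elt_eq\<close>, \<open>omega_part_eq\<close>). The form \<open>u\<close> is
  supported in one degree and sees finitely many monomials, so that the series may be truncated.

  Three points complete the argument. The result does not depend on the choice of the total cocycle,
  because the Cech complex of \<open>C\<close> is exact in degrees less than \<open>n\<close> (\<open>cech_exact\<close>, \<open>tau0_eqI\<close>). The sign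
  that relates top and bottom component depends on \<open>n\<close> only, hence it is the same for the
  sequence \<open>(X\<^sub>0, \<dots>, X\<^sub>n\<^sub>-\<^sub>1, 0, \<dots>, 0)\<close> that normalizes the transgression, and cancels (\<open>tau_sign_eq\<close>).
  Finally, the component of the cocycle in Cech degree 1 shows that a power of each \<open>X\<^sub>j\<close> annihilates
  the class of the bottom component, which is therefore a class in \<open>H\<^sup>0\<^sub>\<mm>\<close> (\<open>pair_Y_kcontract_torsion\<close>).

  The morphism of Koszul complexes is never written with minors. Its values are iterated
  contractions of \<open>e\<^sub>0 \<and> \<dots> \<and> e\<^sub>r\<^sub>-\<^sub>1\<close> by the columns of \<open>g\<close> (\<open>kcontract\<close>), and it is a morphism because such
  contractions anticommute. Only the identification of the contraction by all columns with
  \<open>\<Delta>\<close> (\<open>Delta_eq_kcontract\<close>) uses determinants.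
\<close>

abbreviation "lookup \<equiv> Poly_Mapping.lookup"
abbreviation "keys \<equiv> Poly_Mapping.keys"
abbreviation "single \<equiv> Poly_Mapping.single"

section \<open>Signs and cosets\<close>

lemma sum_fun_apply: "(\<Sum>i\<in>I. F i) x = (\<Sum>i\<in>I. F i x)"
  for F :: "'i \<Rightarrow> 'a \<Rightarrow> 'b::comm_monoid_add"
  by (induction I rule: infinite_finite_induct) auto

lemma alt_apply: "alt s F x = alt s (F x)"
  by (simp add: alt_def)

lemma alt_0_right [simp]: "alt s 0 = 0"
  by (simp add: alt_def)

lemma alt_0_left [simp]: "alt 0 x = x"
  by (simp add: alt_def)

lemma alt_Suc: "alt (Suc s) x = - alt s x"
  by (simp add: alt_def)

lemma alt_alt: "alt s (alt t x) = alt (s + t) x"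
  by (simp add: alt_def)

lemma alt_add: "alt s (x + y) = alt s x + alt s y"
  by (simp add: alt_def)

lemma alt_sum: "alt s (\<Sum>i\<in>I. F i) = (\<Sum>i\<in>I. alt s (F i))"
  by (simp add: alt_def sum_negf)

lemma alt_mult_right: "a * alt s b = alt s (a * b)" for a b :: "'a::ring"
  by (simp add: alt_def)

lemma alt_cong: "even s \<longleftrightarrow> even t \<Longrightarrow> alt s x = alt t x"
  by (simp add: alt_def)

lemma additive_alt: "additive F \<Longrightarrow> F (alt s x) = alt s (F x)"
  by (simp add: alt_def additive.minus)

text \<open>
  Swapping \<open>i\<close> and \<open>j\<close> cancels the terms in pairs. This is the reason why both the Koszul and
  the Cech differential have square zero, in every characteristic.
\<close>

lemma sum_off_diagonal_antisym:
  fixes t :: "nat \<Rightarrow> nat \<Rightarrow> 'a::ab_group_add"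
  assumes "finite R" and anti: "\<And>i j. i < j \<Longrightarrow> t j i = - t i j"
  shows "(\<Sum>i\<in>R. \<Sum>j\<in>R - {i}. t i j) = 0"
proof -
  define D where "D = {(i, j). i \<in> R \<and> j \<in> R \<and> i < j}"
  define t' where "t' = (\<lambda>(i, j). t i j)"
  have fin: "finite D"
    using assms(1) by (auto simp: D_def intro: finite_subset[of _ "R \<times> R"])
  have "(\<Sum>i\<in>R. \<Sum>j\<in>R - {i}. t i j) = (\<Sum>p\<in>(SIGMA i:R. R - {i}). t' p)"
    using assms(1) unfolding t'_def by (subst sum.Sigma) auto
  also have "(SIGMA i:R. R - {i}) = D \<union> prod.swap ` D"
    by (auto simp: D_def image_iff)
  also have "(\<Sum>p\<in>D \<union> prod.swap ` D. t' p) = (\<Sum>p\<in>D. t' p) + (\<Sum>p\<in>prod.swap ` D. t' p)"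
    using fin by (intro sum.union_disjoint) (auto simp: D_def)
  also have "(\<Sum>p\<in>prod.swap ` D. t' p) = (\<Sum>p\<in>D. t' (prod.swap p))"
    by (subst sum.reindex) (auto intro: inj_on_subset[OF inj_swap])
  also have "\<dots> = (\<Sum>p\<in>D. - t' p)"
    by (intro sum.cong) (auto simp: D_def t'_def anti)
  finally show ?thesis
    by (simp add: sum_negf)
qed

definition subgrp :: "'v::ab_group_add set \<Rightarrow> bool" where
  "subgrp A \<longleftrightarrow> 0 \<in> A \<and> (\<forall>x\<in>A. \<forall>y\<in>A. x - y \<in> A)"

lemma subgrpI:
  assumes "0 \<in> A" and "\<And>x y. x \<in> A \<Longrightarrow> y \<in> A \<Longrightarrow> x + y \<in> A" and "\<And>x. x \<in> A \<Longrightarrow> - x \<in> A"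
  shows "subgrp A"
  unfolding subgrp_def using assms by (metis add.commute diff_conv_add_uminus)

lemma subgrp_0: "subgrp A \<Longrightarrow> 0 \<in> A"
  by (simp add: subgrp_def)

lemma subgrp_diff: "subgrp A \<Longrightarrow> x \<in> A \<Longrightarrow> y \<in> A \<Longrightarrow> x - y \<in> A"
  by (simp add: subgrp_def)

lemma subgrp_minus: "subgrp A \<Longrightarrow> x \<in> A \<Longrightarrow> - x \<in> A"
  using subgrp_diff[of A 0 x] by (simp add: subgrp_def)

lemma subgrp_add: "subgrp A \<Longrightarrow> x \<in> A \<Longrightarrow> y \<in> A \<Longrightarrow> x + y \<in> A"
  using subgrp_diff[of A x "- y"] subgrp_minus[of A y] by simp

lemma subgrp_sum: "subgrp A \<Longrightarrow> (\<And>i. i \<in> I \<Longrightarrow> F i \<in> A) \<Longrightarrow> (\<Sum>i\<in>I. F i) \<in> A"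
  by (induction I rule: infinite_finite_induct) (auto simp: subgrp_0 subgrp_add)

lemma subgrp_alt: "subgrp A \<Longrightarrow> x \<in> A \<Longrightarrow> alt s x \<in> A"
  by (simp add: alt_def subgrp_minus)

lemma subgrp_zero: "subgrp {0}"
  by (simp add: subgrp_def)

lemma subgrp_image:
  assumes "additive F" and "subgrp A"
  shows "subgrp (F ` A)"
  unfolding subgrp_def
proof (intro conjI ballI)
  show "0 \<in> F ` A"
    using additive.zero[OF assms(1)] subgrp_0[OF assms(2)] by (metis imageI)
  fix x y assume "x \<in> F ` A" "y \<in> F ` A"
  then show "x - y \<in> F ` A"
    by (metis (no_types, lifting) additive.diff[OF assms(1)] image_iff subgrp_diff[OF assms(2)])
qed

lemma subgrp_plus:
  assumes "subgrp A" and "subgrp B"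
  shows "subgrp (A + B)"
proof (rule subgrpI)
  show "0 \<in> A + B"
    using set_plus_intro[OF subgrp_0[OF assms(1)] subgrp_0[OF assms(2)]] by simp
next
  fix x y assume "x \<in> A + B" "y \<in> A + B"
  then obtain a b c e where x: "x = a + b" "a \<in> A" "b \<in> B" and y: "y = c + e" "c \<in> A" "e \<in> B"
    by (auto elim!: set_plus_elim)
  have "(a + c) + (b + e) \<in> A + B"
    using x y assms by (intro set_plus_intro subgrp_add) auto
  then show "x + y \<in> A + B"
    by (simp add: x y algebra_simps)
next
  fix x assume "x \<in> A + B"
  then obtain a b where x: "x = a + b" "a \<in> A" "b \<in> B"
    by (auto elim!: set_plus_elim)
  have "- a + - b \<in> A + B"
    using x assms by (intro set_plus_intro subgrp_minus) auto
  then show "- x \<in> A + B"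
    by (simp add: x)
qed

lemma subgrp_Int: "subgrp A \<Longrightarrow> subgrp B \<Longrightarrow> subgrp (A \<inter> B)"
  by (simp add: subgrp_def)

lemma subgrp_vimage:
  assumes "additive F" and "subgrp A"
  shows "subgrp {x. F x \<in> A}"
  using assms by (simp add: subgrp_def additive.zero additive.diff)

lemma coset_eq_iff:
  assumes "subgrp N"
  shows "x +o N = y +o N \<longleftrightarrow> x - y \<in> N"
proof
  assume eq: "x +o N = y +o N"
  have "x + 0 \<in> x +o N"
    using subgrp_0[OF assms] by (rule set_plus_intro2)
  then show "x - y \<in> N"
    using eq set_plus_imp_minus by auto
next
  assume d: "x - y \<in> N"
  have "x + a \<in> y +o N" if "a \<in> N" for a
    using subgrp_add[OF assms d that] by (intro set_minus_imp_plus) (simp add: algebra_simps)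
  moreover have "y + a \<in> x +o N" if "a \<in> N" for a
    using subgrp_diff[OF assms that d] by (intro set_minus_imp_plus) (simp add: algebra_simps)
  ultimately show "x +o N = y +o N"
    by (auto simp: elt_set_plus_def)
qed

lemma coset_eq_self_iff:
  assumes "subgrp N"
  shows "x +o N = N \<longleftrightarrow> x \<in> N"
  using coset_eq_iff[OF assms, of x 0] by simp

lemma subgrp_plus_self:
  assumes "subgrp N"
  shows "N + N = N"
  using assms by (metis set_zero_plus2 subgrp_0 set_plus_elim subgrp_add subsetI subset_antisym)

lemma coset_plus_coset:
  assumes "subgrp N"
  shows "(x +o N) + (y +o N) = (x + y) +o N"
  by (simp add: set_plus_rearrange subgrp_plus_self[OF assms])

lemma sum_cosets:
  assumes "finite I" and N: "subgrp N"
  shows "(\<Sum>i\<in>I. z i +o N) + N = (\<Sum>i\<in>I. z i) +o N"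
  using assms(1)
proof (induction I rule: finite_induct)
  case (insert i I)
  have "(\<Sum>i\<in>insert i I. z i +o N) + N = (z i +o N) + ((\<Sum>i\<in>I. z i +o N) + N)"
    using insert by (simp add: add.assoc)
  then show ?case
    using insert by (simp add: coset_plus_coset[OF N])
qed simp

text \<open>
  Every map of the construction is an \<open>induced\<close> map between quotients. This lemma reduces each of
  them to a computation with one representative and an inclusion of denominators.
\<close>

lemma induced_coset:
  assumes F: "additive F" and FN: "F ` N \<subseteq> N'" and N: "subgrp N" and N': "subgrp N'"
  shows "induced F N' (x +o N) = F x +o N'"
proof -
  have "F (x + y) + z \<in> F x +o N'" if "y \<in> N" "z \<in> N'" for y z
    using subgrp_add[OF N', of "F y" z] that FN
    by (intro set_minus_imp_plus) (auto simp: additive.add[OF F] algebra_simps)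
  moreover have "F x + z \<in> F ` (x +o N) + N'" if "z \<in> N'" for z
    using that set_plus_intro2[OF subgrp_0[OF N], of x] by (intro set_plus_intro) auto
  ultimately show ?thesis
    unfolding induced_def by (force simp: elt_set_plus_def set_plus_def)
qed

section \<open>The Koszul differential and iterated contractions\<close>

lemma kdiff_add: "kdiff r f (z + z') = kdiff r f z + kdiff r f z'"
  by (rule ext) (simp add: kdiff_def distrib_left alt_add sum.distrib)

lemma additive_kdiff: "additive (kdiff r f)"
  by (simp add: additive_def kdiff_add)

lemma kdiff_0: "kdiff r f 0 = 0"
  by (rule additive.zero[OF additive_kdiff])

lemma kdiff_seq_add: "kdiff r (\<lambda>i. f i + g i) z = kdiff r f z + kdiff r g z"
  by (rule ext) (simp add: kdiff_def distrib_right alt_add sum.distrib)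

text \<open>
  The Koszul differential is linear in the sequence. A decomposition
  \<open>f\<^sub>i(X) - f\<^sub>i(Y) = \<Sum>\<^sub>j (X\<^sub>j - Y\<^sub>j) g\<^sub>i\<^sub>j\<close> thus writes the differential of the left hand sides in
  terms of the contractions by the columns of \<open>g\<close>.
\<close>

lemma kdiff_seq_sum:
  "kdiff r (\<lambda>i. \<Sum>j\<in>J. c j * g i j) z T = (\<Sum>j\<in>J. c j * kdiff r (\<lambda>i. g i j) z T)"
  unfolding kdiff_def sum_distrib_left sum_distrib_right alt_sum
  by (subst sum.swap) (simp add: alt_mult_right mult.assoc)

lemma kdiff_mult: "kdiff r f (\<lambda>T. c * z T) T = c * kdiff r f z T"
  unfolding kdiff_def sum_distrib_left by (simp add: alt_mult_right mult.left_commute)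

lemma kdiff_cong: "(\<And>i. i < r \<Longrightarrow> f i = f' i) \<Longrightarrow> kdiff r f z = kdiff r f' z"
  by (rule ext) (simp add: kdiff_def)

lemma kdiff_sum: "kdiff r f (\<Sum>i\<in>I. z i) = (\<Sum>i\<in>I. kdiff r f (z i))"
  by (rule additive.sum[OF additive_kdiff])

lemma kdiff_alt: "kdiff r f (alt s z) = alt s (kdiff r f z)"
  by (rule additive_alt[OF additive_kdiff])

lemma card_less_insert:
  fixes i j :: nat
  assumes "j \<notin> T"
  shows "card {l \<in> insert j T. l < i} = card {l \<in> T. l < i} + (if j < i then 1 else 0)"
proof -
  have "{l \<in> insert j T. l < i} = (if j < i then insert j {l \<in> T. l < i} else {l \<in> T. l < i})"
    by auto
  moreover have "finite {l \<in> T. l < i}"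
    by (rule finite_subset[of _ "{..<i}"]) auto
  ultimately show ?thesis
    using assms by simp
qed

lemma kdiff_kdiff: "kdiff r f (kdiff r f z) = 0"
proof
  fix T
  define R where "R = {..<r} - T"
  define t where "t i j = alt (card {l \<in> T. l < i} + card {l \<in> T. l < j}
      + (if i < j then 1 else 0)) (f i * f j * z (insert i (insert j T)))" for i j
  have anti: "t j i = - t i j" if "i < j" for i j
    using that by (simp add: t_def alt_Suc insert_commute mult.commute add.commute)
  have "kdiff r f (kdiff r f z) T = (\<Sum>i\<in>R. \<Sum>j\<in>R - {i}. t i j)"
    unfolding kdiff_def[of r f "kdiff r f z"] R_def[symmetric]
  proof (rule sum.cong[OF refl])
    fix i assume i: "i \<in> R"
    then have eq: "{..<r} - insert i T = R - {i}" and iT: "i \<notin> T"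
      by (auto simp: R_def)
    show "alt (card {j \<in> T. j < i}) (f i * kdiff r f z (insert i T)) = (\<Sum>j\<in>R - {i}. t i j)"
      unfolding kdiff_def eq sum_distrib_left alt_sum
    proof (rule sum.cong[OF refl])
      fix j
      have "insert j (insert i T) = insert i (insert j T)"
        by auto
      then show "alt (card {j \<in> T. j < i}) (f i *
          alt (card {l \<in> insert i T. l < j}) (f j * z (insert j (insert i T)))) = t i j"
        unfolding card_less_insert[OF iT] t_def by (simp add: alt_mult_right alt_alt mult.assoc add.assoc)
    qed
  qed
  also have "\<dots> = 0"
    using anti by (intro sum_off_diagonal_antisym) (auto simp: R_def)
  finally show "kdiff r f (kdiff r f z) T = 0 T"
    by simp
qed

text \<open>
  Polarization of the previous lemma: the square of the contraction by \<open>f + g\<close> vanishes.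
\<close>

lemma kdiff_anticommute: "kdiff r f (kdiff r g z) = - kdiff r g (kdiff r f z)"
proof -
  have "0 = kdiff r (\<lambda>i. f i + g i) (kdiff r (\<lambda>i. f i + g i) z)"
    by (simp add: kdiff_kdiff)
  also have "\<dots> = kdiff r f (kdiff r g z) + kdiff r g (kdiff r f z)"
    by (simp add: kdiff_seq_add kdiff_add kdiff_kdiff)
  finally show ?thesis
    by (simp add: eq_neg_iff_add_eq_0)
qed

lemma koszulD: "z \<in> koszul r p M \<Longrightarrow> T \<subseteq> {..<r} \<Longrightarrow> card T = p \<Longrightarrow> z T \<in> M"
  by (auto simp: koszul_def)

lemma koszul_zero: "z \<in> koszul r p M \<Longrightarrow> \<not> (T \<subseteq> {..<r} \<and> card T = p) \<Longrightarrow> z T = 0"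
  by (auto simp: koszul_def split: if_splits)

lemma koszulI:
  assumes "\<And>T. T \<subseteq> {..<r} \<Longrightarrow> card T = p \<Longrightarrow> z T \<in> M"
    and "\<And>T. \<not> (T \<subseteq> {..<r} \<and> card T = p) \<Longrightarrow> z T = 0"
  shows "z \<in> koszul r p M"
  using assms by (auto simp: koszul_def)

lemma koszul_in: "z \<in> koszul r p M \<Longrightarrow> 0 \<in> M \<Longrightarrow> z T \<in> M"
  by (metis koszulD koszul_zero)

lemma koszul_0: "koszul r p {0} = {0}"
  by (auto simp: koszul_def fun_eq_iff)

lemma koszul_mono: "M \<subseteq> M' \<Longrightarrow> koszul r p M \<subseteq> koszul r p M'"
  by (force simp: koszul_def)

lemma subgrp_koszul:
  assumes "subgrp M"
  shows "subgrp (koszul r p M)"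
  using assms by (auto simp: subgrp_def koszul_def)

lemma kdiff_koszul:
  assumes M: "subgrp M" and fM: "\<And>i x. i < r \<Longrightarrow> x \<in> M \<Longrightarrow> f i * x \<in> M"
    and z: "z \<in> koszul r (Suc p) M"
  shows "kdiff r f z \<in> koszul r p M"
proof (rule koszulI)
  fix T assume "T \<subseteq> {..<r}" "card T = p"
  show "kdiff r f z T \<in> M"
    unfolding kdiff_def
    by (intro subgrp_sum[OF M] subgrp_alt[OF M] fM) (auto intro: koszul_in[OF z subgrp_0[OF M]])
next
  fix T assume T: "\<not> (T \<subseteq> {..<r} \<and> card T = p)"
  have "z (insert i T) = 0" if "i \<in> {..<r} - T" for i
  proof (rule koszul_zero[OF z])
    show "\<not> (insert i T \<subseteq> {..<r} \<and> card (insert i T) = Suc p)"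
      using T that finite_subset[of T "{..<r}"] by auto
  qed
  then show "kdiff r f z T = 0"
    by (simp add: kdiff_def)
qed

lemma subgrp_kbounds:
  assumes "subgrp M" and "subgrp N"
  shows "subgrp (kbounds r f M N p)"
  unfolding kbounds_def
  by (intro subgrp_plus subgrp_image additive_kdiff subgrp_koszul assms)

lemma kboundsI:
  assumes "z = kdiff r f v + y" and "v \<in> koszul r (p + 1) M" and "y \<in> koszul r p N"
  shows "z \<in> kbounds r f M N p"
  using assms by (auto simp: kbounds_def)

lemma kboundsE:
  assumes "z \<in> kbounds r f M N p"
  obtains v y where "z = kdiff r f v + y" and "v \<in> koszul r (p + 1) M" and "y \<in> koszul r p N"
  using assms by (auto simp: kbounds_def elim!: set_plus_elim)

text \<open>
  The map may depend on \<open>T\<close>, because a component of given degree of a chain involves the degree of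
  \<open>e\<^sub>T\<close>.
\<close>

lemma kdiff_map:
  assumes \<phi>: "\<And>T. additive (\<phi> T)"
    and comm: "\<And>i x. i < r \<Longrightarrow> i \<notin> T \<Longrightarrow> x \<in> M \<Longrightarrow> \<phi> T (f i * x) = f' i * \<phi> (insert i T) x"
    and z: "\<And>T. z T \<in> M"
  shows "kdiff r f' (\<lambda>T. \<phi> T (z T)) T = \<phi> T (kdiff r f z T)"
  unfolding kdiff_def additive.sum[OF \<phi>]
  by (intro sum.cong refl) (simp add: additive_alt[OF \<phi>] comm z)

lemma kbounds_map:
  assumes \<phi>: "\<And>T. additive (\<phi> T)"
    and comm: "\<And>T i x. T \<subseteq> {..<r} \<Longrightarrow> i < r \<Longrightarrow> i \<notin> T \<Longrightarrow> x \<in> M \<Longrightarrow>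
      \<phi> T (f i * x) = f' i * \<phi> (insert i T) x"
    and M: "\<And>T x. x \<in> M \<Longrightarrow> \<phi> T x \<in> M'" and N: "\<And>T x. x \<in> N \<Longrightarrow> \<phi> T x \<in> N'"
    and "0 \<in> M"
  shows "(\<lambda>z T. \<phi> T (z T)) ` kbounds r f M N p \<subseteq> kbounds r f' M' N' p"
proof
  fix a assume "a \<in> (\<lambda>z T. \<phi> T (z T)) ` kbounds r f M N p"
  then obtain v y where a: "a = (\<lambda>T. \<phi> T ((kdiff r f v + y) T))"
    and v: "v \<in> koszul r (p + 1) M" and y: "y \<in> koszul r p N"
    by (auto elim!: kboundsE)
  show "a \<in> kbounds r f' M' N' p"
  proof (rule kboundsI)
    have vM: "v T \<in> M" for T
      using koszul_in[OF v \<open>0 \<in> M\<close>] .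
    have eq: "kdiff r f' (\<lambda>T. \<phi> T (v T)) T = \<phi> T (kdiff r f v T)" for T
    proof (cases "T \<subseteq> {..<r}")
      case True
      then show ?thesis
        by (intro kdiff_map[where M=M] \<phi> comm vM)
    next
      case False
      then have "v (insert i T) = 0" for i
        by (intro koszul_zero[OF v]) auto
      then show ?thesis
        by (simp add: kdiff_def additive.zero[OF \<phi>])
    qed
    show "a = kdiff r f' (\<lambda>T. \<phi> T (v T)) + (\<lambda>T. \<phi> T (y T))"
      by (rule ext) (simp add: a additive.add[OF \<phi>] eq)
    show "(\<lambda>T. \<phi> T (v T)) \<in> koszul r (p + 1) M'"
      using v by (intro koszulI) (auto intro: M koszulD simp: koszul_zero additive.zero[OF \<phi>])
    show "(\<lambda>T. \<phi> T (y T)) \<in> koszul r p N'"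
      using y by (intro koszulI) (auto intro: N koszulD simp: koszul_zero additive.zero[OF \<phi>])
  qed
qed

text \<open>
  The contraction of \<open>e\<^sub>0 \<and> \<dots> \<and> e\<^sub>r\<^sub>-\<^sub>1\<close> by the linear forms \<open>e\<^sub>i \<mapsto> g i j\<close> for the \<open>j < k\<close> outside \<open>S\<close>.
  As contractions by different forms anticommute and those by the same form square to zero, this
  encodes all minors of \<open>g\<close> and their Laplace expansions without determinants. For \<open>k = n\<close> the
  chain \<open>kcontract r g S n\<close> is, up to sign, the image of \<open>\<epsilon>\<^sub>S\<close> under the morphism from the Koszul
  complex of the \<open>X\<^sub>j - Y\<^sub>j\<close> to that of the \<open>f\<^sub>i(X) - f\<^sub>i(Y)\<close> that is dual to
  \<open>e\<^sub>i \<mapsto> \<Sum>\<^sub>j g\<^sub>i\<^sub>j \<epsilon>\<^sub>j\<close>.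
\<close>

primrec kcontract :: "nat \<Rightarrow> (nat \<Rightarrow> nat \<Rightarrow> 'a::comm_ring_1) \<Rightarrow> nat set \<Rightarrow> nat \<Rightarrow> nat set \<Rightarrow> 'a" where
  "kcontract r g S 0 = kbasis {..<r}"
| "kcontract r g S (Suc k) =
     (if k \<in> S then kcontract r g S k else kdiff r (\<lambda>i. g i k) (kcontract r g S k))"

lemma kcontract_cong:
  assumes "\<And>j. j < k \<Longrightarrow> j \<in> S \<longleftrightarrow> j \<in> S'"
  shows "kcontract r g S k = kcontract r g S' k"
  using assms by (induction k) auto

text \<open>
  One more contraction by the form \<open>j\<close> has to pass those by the forms \<open>i > j\<close> outside \<open>S\<close>, which
  gives the sign. It then meets a contraction by the same form and vanishes, unless \<open>j \<in> S\<close>.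
\<close>

lemma kdiff_kcontract:
  assumes "j < k"
  shows "kdiff r (\<lambda>i. g i j) (kcontract r g S k) =
    (if j \<in> S then alt (card {i. j < i \<and> i < k \<and> i \<notin> S}) (kcontract r g (S - {j}) k) else 0)"
  using assms
proof (induction k)
  case (Suc k)
  show ?case
  proof (cases "j = k")
    case True
    have [simp]: "kcontract r g (S - {k}) k = kcontract r g S k"
      by (rule kcontract_cong) auto
    have "{i. k < i \<and> i < Suc k \<and> i \<notin> S} = {}"
      by auto
    then have [simp]: "card {i. k < i \<and> i < Suc k \<and> i \<notin> S} = 0"
      by simp
    show ?thesis
      using True by (simp add: kdiff_kdiff)
  next
    case False
    then have jk: "j < k"
      using Suc.prems by simp
    have "{i. j < i \<and> i < Suc k \<and> i \<notin> S} =
      (if k \<in> S then {i. j < i \<and> i < k \<and> i \<notin> S} else insert k {i. j < i \<and> i < k \<and> i \<notin> S})"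
      using jk by (auto simp: less_Suc_eq)
    then have card: "card {i. j < i \<and> i < Suc k \<and> i \<notin> S} =
      card {i. j < i \<and> i < k \<and> i \<notin> S} + (if k \<in> S then 0 else 1)"
      by simp
    show ?thesis
    proof (cases "k \<in> S")
      case True
      then show ?thesis
        using Suc.IH[OF jk] False card by simp
    next
      case kS: False
      then have "kdiff r (\<lambda>i. g i j) (kcontract r g S (Suc k)) =
          - kdiff r (\<lambda>i. g i k) (kdiff r (\<lambda>i. g i j) (kcontract r g S k))"
        by (simp add: kdiff_anticommute[of r "\<lambda>i. g i j"])
      then show ?thesis
        using Suc.IH[OF jk] False kS card by (simp add: kdiff_alt kdiff_0 alt_Suc)
    qed
  qed
qed simp

lemma kcontract_koszul:
  assumes R: "subgrp R" and 1: "1 \<in> R" and g: "\<And>i j x. i < r \<Longrightarrow> j < k \<Longrightarrow> x \<in> R \<Longrightarrow> g i j * x \<in> R"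
    and "k \<le> r"
  shows "kcontract r g S k \<in> koszul r (r - k + card (S \<inter> {..<k})) R"
  using g \<open>k \<le> r\<close>
proof (induction k)
  case 0
  have "T = {..<r}" if "T \<subseteq> {..<r}" "card T = r" for T
    using that by (simp add: card_subset_eq)
  then show ?case
    using 1 subgrp_0[OF R] by (auto simp: koszul_def kbasis_def)
next
  case (Suc k)
  have IH: "kcontract r g S k \<in> koszul r (r - k + card (S \<inter> {..<k})) R"
    using Suc by auto
  show ?case
  proof (cases "k \<in> S")
    case True
    then have "S \<inter> {..<Suc k} = insert k (S \<inter> {..<k})"
      by auto
    then have "r - Suc k + card (S \<inter> {..<Suc k}) = r - k + card (S \<inter> {..<k})"
      using Suc.prems by simp
    then show ?thesis
      using True IH by simp
  next
    case False
    then have "S \<inter> {..<Suc k} = S \<inter> {..<k}"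
      by (auto simp: less_Suc_eq)
    then have "Suc (r - Suc k + card (S \<inter> {..<Suc k})) = r - k + card (S \<inter> {..<k})"
      using Suc.prems by simp
    then have "kcontract r g S k \<in> koszul r (Suc (r - Suc k + card (S \<inter> {..<Suc k}))) R"
      using IH by simp
    then have "kdiff r (\<lambda>i. g i k) (kcontract r g S k)
        \<in> koszul r (r - Suc k + card (S \<inter> {..<Suc k})) R"
      by (rule kdiff_koszul[OF R, rotated]) (use Suc.prems in auto)
    then show ?thesis
      using False by simp
  qed
qed

section \<open>Exactness of the Cech complex below degree \<open>n\<close>\<close>

lemma lookup_alt: "lookup (alt s p) a = alt s (lookup p a)"
  by (simp add: alt_def)

definition restr :: "'a set \<Rightarrow> ('a \<Rightarrow>\<^sub>0 'b::zero) \<Rightarrow> 'a \<Rightarrow>\<^sub>0 'b" where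
  "restr A p = Poly_Mapping.mapp (\<lambda>a c. if a \<in> A then c else 0) p"

lemma lookup_restr: "lookup (restr A p) a = (if a \<in> A then lookup p a else 0)"
  by (auto simp: restr_def lookup_mapp when_def in_keys_iff)

lemma loc_iff: "p \<in> loc n S \<longleftrightarrow> (\<forall>a. lookup p a \<noteq> 0 \<longrightarrow>
    keys a \<subseteq> {..<n} \<and> (\<forall>j. j \<notin> S \<longrightarrow> 0 \<le> lookup a j))"
  by (auto simp: loc_def in_keys_iff)

lemma loc_mono: "S \<subseteq> S' \<Longrightarrow> loc n S \<subseteq> loc n S'"
  by (auto simp: loc_def)

lemma subgrp_support: "subgrp {p :: 'a \<Rightarrow>\<^sub>0 'b::ab_group_add. \<forall>a\<in>keys p. Q a}"
proof (rule subgrpI)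
  fix p p' :: "'a \<Rightarrow>\<^sub>0 'b" assume "p \<in> {p. \<forall>a\<in>keys p. Q a}" "p' \<in> {p. \<forall>a\<in>keys p. Q a}"
  then show "p + p' \<in> {p. \<forall>a\<in>keys p. Q a}"
    using keys_add[of p p'] by blast
qed (auto simp: in_keys_iff)

lemma subgrp_loc: "subgrp (loc n S)"
  unfolding loc_def by (rule subgrp_support)

lemma loc_mult: "p \<in> loc n S \<Longrightarrow> q \<in> loc n S \<Longrightarrow> p * q \<in> loc n S"
proof -
  assume p: "p \<in> loc n S" and q: "q \<in> loc n S"
  have "keys a \<subseteq> {..<n} \<and> (\<forall>j. j \<notin> S \<longrightarrow> 0 \<le> lookup a j)"
    if a_in: "a \<in> keys (p * q)" for a
  proof -
    obtain b c where a: "a = b + c" and b: "b \<in> keys p" and c: "c \<in> keys q"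
      using keys_mult[of p q] a_in by blast
    have "keys a \<subseteq> keys b \<union> keys c"
      unfolding a by (rule keys_add)
    moreover have "keys b \<subseteq> {..<n} \<and> (\<forall>j. j \<notin> S \<longrightarrow> 0 \<le> lookup b j)"
      using p b by (simp add: loc_def)
    moreover have "keys c \<subseteq> {..<n} \<and> (\<forall>j. j \<notin> S \<longrightarrow> 0 \<le> lookup c j)"
      using q c by (simp add: loc_def)
    ultimately show ?thesis
      by (auto simp: a lookup_add)
  qed
  then show "p * q \<in> loc n S"
    by (simp add: loc_def)
qed

lemma cdiff_add: "cdiff n (w + w') = cdiff n w + cdiff n w'"
  by (rule ext) (simp add: cdiff_def alt_add sum.distrib)

lemma additive_cdiff: "additive (cdiff n)"
  by (simp add: additive_def cdiff_add)

lemma cdiff_map: "additive F \<Longrightarrow> cdiff n (\<lambda>S. F (w S)) S = F (cdiff n w S)"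
  by (simp add: cdiff_def additive.sum additive_alt additive.zero)

lemma cdiff_apply: "cdiff n w S T = cdiff n (\<lambda>S. w S T) S"
  by (simp add: cdiff_def sum_fun_apply alt_apply)

lemma cdiff_cdiff: "cdiff n (cdiff n w) S = 0"
proof (cases "S \<subseteq> {..<n}")
  case True
  then have finS: "finite S"
    using finite_subset by blast
  define t where "t i j = alt (card {l \<in> S. l < i} + card {l \<in> S. l < j}
      + (if i < j then 1 else 0)) (w (S - {i, j}))" for i j
  have anti: "t j i = - t i j" if "i < j" for i j
    using that by (simp add: t_def alt_Suc insert_commute add.commute)
  have "cdiff n (cdiff n w) S = (\<Sum>i\<in>S. \<Sum>j\<in>S - {i}. t i j)"
    unfolding cdiff_def[of n "cdiff n w"] if_P[OF True]
  proof (rule sum.cong[OF refl])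
    fix i assume i: "i \<in> S"
    have "cdiff n w (S - {i}) = (\<Sum>j\<in>S - {i}. alt (card {l \<in> S - {i}. l < j}) (w (S - {i} - {j})))"
      using True by (auto simp: cdiff_def)
    also have "alt (card {l \<in> S. l < i}) \<dots> = (\<Sum>j\<in>S - {i}. t i j)"
      unfolding alt_sum
    proof (rule sum.cong[OF refl])
      fix j
      have c: "card {l \<in> S. l < j} = card {l \<in> S - {i}. l < j} + (if i < j then 1 else 0)"
        using card_less_insert[of i "S - {i}" j] i by (simp only: insert_Diff) simp
      have S: "S - {i} - {j} = S - {i, j}"
        by auto
      show "alt (card {l \<in> S. l < i}) (alt (card {l \<in> S - {i}. l < j}) (w (S - {i} - {j})))
        = t i j"
        unfolding t_def alt_alt c S by (rule alt_cong) simp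
    qed
    finally show "alt (card {l \<in> S. l < i}) (cdiff n w (S - {i})) = (\<Sum>j\<in>S - {i}. t i j)" .
  qed
  also have "\<dots> = 0"
    using finS anti by (rule sum_off_diagonal_antisym)
  finally show ?thesis .
qed (simp add: cdiff_def)

lemma cech_zero: "w \<in> cech n q MS \<Longrightarrow> \<not> (S \<subseteq> {..<n} \<and> card S = q) \<Longrightarrow> w S = 0"
  by (auto simp: cech_def split: if_splits)

lemma cechD: "w \<in> cech n q MS \<Longrightarrow> S \<subseteq> {..<n} \<Longrightarrow> card S = q \<Longrightarrow> w S \<in> MS S"
  by (auto simp: cech_def)

lemma cechI:
  assumes "\<And>S. S \<subseteq> {..<n} \<Longrightarrow> card S = q \<Longrightarrow> w S \<in> MS S"
    and "\<And>S. \<not> (S \<subseteq> {..<n} \<and> card S = q) \<Longrightarrow> w S = 0"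
  shows "w \<in> cech n q MS"
  using assms by (auto simp: cech_def)

lemma subgrp_cech: "(\<And>S. subgrp (MS S)) \<Longrightarrow> subgrp (cech n q MS)"
  by (auto simp: subgrp_def cech_def)

lemma subgrp_cech_bounds: "(\<And>S. subgrp (MS S)) \<Longrightarrow> subgrp (cech_bounds n MS)"
  unfolding cech_bounds_def by (intro subgrp_image additive_cdiff subgrp_cech)

lemma cdiff_cech_zero:
  assumes w: "w \<in> cech n q MS" and "\<not> (S \<subseteq> {..<n} \<and> card S = Suc q)"
  shows "cdiff n w S = 0"
proof (cases "S \<subseteq> {..<n}")
  case True
  then have "card S \<noteq> Suc q" "finite S"
    using assms finite_subset by blast+
  then have "w (S - {j}) = 0" if "j \<in> S" for j
    using that card_Suc_Diff1[OF \<open>finite S\<close> that] by (intro cech_zero[OF w]) auto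
  then show ?thesis
    by (simp add: cdiff_def)
qed (simp add: cdiff_def)

text \<open>
  The Cech complex splits into the parts of the single monomials \<open>X\<^sup>a\<close>. If some \<open>j < n\<close> has
  \<open>a\<^sub>j \<ge> 0\<close>, then \<open>X\<^sup>a\<close> lies in the localization at \<open>S\<close> if and only if it lies in that at
  \<open>insert j S\<close>, so that adjoining the least such \<open>j\<close>, called \<open>J a\<close>, to \<open>S\<close> is a contracting homotopy
  of the part of \<open>X\<^sup>a\<close>.
\<close>

lemma cech_exact_nonneg:
  fixes w :: "nat set \<Rightarrow> 'k::comm_ring_1 laurent"
  assumes w: "w \<in> cech n (Suc q) (loc n)" and cocycle: "cdiff n w = 0"
    and nonneg: "\<And>S a. lookup (w S) a \<noteq> 0 \<Longrightarrow> \<exists>j<n. 0 \<le> lookup a j"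
  shows "\<exists>v\<in>cech n q (loc n). cdiff n v = w"
proof -
  define J where "J a = (LEAST j. j < n \<and> 0 \<le> lookup a j)" for a :: "nat \<Rightarrow>\<^sub>0 int"
  define good where "good a \<longleftrightarrow> (\<exists>j<n. 0 \<le> lookup a j)" for a :: "nat \<Rightarrow>\<^sub>0 int"
  have J: "J a < n" "0 \<le> lookup a (J a)" if "good a" for a
    using that LeastI[of "\<lambda>j. j < n \<and> 0 \<le> lookup a j"] unfolding J_def good_def by blast+
  have wgood: "good a" if "lookup (w S) a \<noteq> 0" for S a
    using nonneg[OF that] by (simp add: good_def)
  define v where "v S = (if S \<subseteq> {..<n} \<and> card S = q then
      (\<Sum>j\<in>{..<n} - S. alt (card {i \<in> S. i < j}) (restr {a. J a = j} (w (insert j S)))) else 0)" for S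
  have lookup_v: "lookup (v S) a = (if S \<subseteq> {..<n} \<and> card S = q \<and> J a < n \<and> J a \<notin> S
      then alt (card {i \<in> S. i < J a}) (lookup (w (insert (J a) S)) a) else 0)" for S a
  proof (cases "S \<subseteq> {..<n} \<and> card S = q")
    case True
    have "lookup (v S) a = (\<Sum>j\<in>{..<n} - S.
        alt (card {i \<in> S. i < j}) (if J a = j then lookup (w (insert j S)) a else 0))"
      using True by (simp add: v_def lookup_sum lookup_alt lookup_restr)
    also have "\<dots> = (\<Sum>j\<in>{..<n} - S.
        if J a = j then alt (card {i \<in> S. i < j}) (lookup (w (insert j S)) a) else 0)"
      by (intro sum.cong) auto
    finally show ?thesis
      using True by simp
  qed (auto simp: v_def)
  have "v \<in> cech n q (loc n)"
  proof (rule cechI)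
    fix S assume S: "S \<subseteq> {..<n}" "card S = q"
    show "v S \<in> loc n S"
      unfolding loc_iff
    proof (intro allI impI)
      fix a assume "lookup (v S) a \<noteq> 0"
      then have Ja: "J a < n" "J a \<notin> S" and nz: "lookup (w (insert (J a) S)) a \<noteq> 0"
        by (auto simp: lookup_v split: if_splits)
      have "finite S"
        using S finite_subset by blast
      then have "w (insert (J a) S) \<in> loc n (insert (J a) S)"
        using S Ja by (intro cechD[OF w]) auto
      then have "keys a \<subseteq> {..<n}" "\<forall>j. j \<notin> insert (J a) S \<longrightarrow> 0 \<le> lookup a j"
        using nz unfolding loc_iff by auto
      moreover have "0 \<le> lookup a (J a)"
        using J wgood[OF nz] by blast
      ultimately show "keys a \<subseteq> {..<n} \<and> (\<forall>j. j \<notin> S \<longrightarrow> 0 \<le> lookup a j)"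
        by (metis insertE)
    qed
  qed (auto simp: v_def)
  moreover have "cdiff n v S = w S" for S
  proof (cases "S \<subseteq> {..<n} \<and> card S = Suc q")
    case False
    then show ?thesis
      using cdiff_cech_zero[OF \<open>v \<in> cech n q (loc n)\<close> False] cech_zero[OF w False] by simp
  next
    case True
    then have S: "S \<subseteq> {..<n}" "card S = Suc q" and finS: "finite S"
      using finite_subset by blast+
    have cS: "S - {j} \<subseteq> {..<n} \<and> card (S - {j}) = q" if "j \<in> S" for j
      using S finS that by auto
    show ?thesis
    proof (rule poly_mapping_eqI)
      fix a
      have lhs: "lookup (cdiff n v S) a =
          (\<Sum>j\<in>S. alt (card {i \<in> S. i < j}) (lookup (v (S - {j})) a))"
        using S by (simp add: cdiff_def lookup_sum lookup_alt)
      show "lookup (cdiff n v S) a = lookup (w S) a"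
      proof (cases "good a")
        case False
        then have w0: "lookup (w S') a = 0" for S'
          using wgood by blast
        have "lookup (v S') a = 0" for S'
          unfolding lookup_v w0 by simp
        then show ?thesis
          unfolding lhs w0 by simp
      next
        case True
        note Ja = J[OF True]
        show ?thesis
        proof (cases "J a \<in> S")
          case True
          have "lookup (cdiff n v S) a =
              (\<Sum>j\<in>S. if j = J a then lookup (w S) a else 0)"
            unfolding lhs
          proof (rule sum.cong[OF refl])
            fix j assume j: "j \<in> S"
            have "{i \<in> S - {J a}. i < J a} = {i \<in> S. i < J a}"
              by auto
            then show "alt (card {i \<in> S. i < j}) (lookup (v (S - {j})) a) =
                (if j = J a then lookup (w S) a else 0)"
              using True j cS[OF j] Ja unfolding lookup_v
              by (auto simp: insert_absorb alt_alt alt_def)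
          qed
          then show ?thesis
            using True finS by (simp add: sum.delta)
        next
          case False
          have "0 = lookup (cdiff n w (insert (J a) S)) a"
            by (simp add: cocycle)
          also have "\<dots> = (\<Sum>j\<in>insert (J a) S. alt (card {i \<in> insert (J a) S. i < j})
              (lookup (w (insert (J a) S - {j})) a))"
            using S Ja by (simp add: cdiff_def lookup_sum lookup_alt)
          also have "\<dots> = alt (card {i \<in> S. i < J a}) (lookup (w S) a) +
              (\<Sum>j\<in>S. alt (card {i \<in> insert (J a) S. i < j})
                (lookup (w (insert (J a) S - {j})) a))"
            using False finS by (simp add: card_less_insert[OF False, of "J a", simplified])
          also have "(\<Sum>j\<in>S. alt (card {i \<in> insert (J a) S. i < j})
                (lookup (w (insert (J a) S - {j})) a)) =
              (\<Sum>j\<in>S. - alt (card {i \<in> S. i < J a})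
                (alt (card {i \<in> S. i < j}) (lookup (v (S - {j})) a)))"
          proof (rule sum.cong[OF refl])
            fix j assume j: "j \<in> S"
            then have neq: "j \<noteq> J a"
              using False by auto
            have c: "card {i \<in> S. i < J a} = card {i \<in> S - {j}. i < J a} + (if j < J a then 1 else 0)"
              using card_less_insert[of j "S - {j}" "J a"] j by (simp only: insert_Diff) simp
            have "insert (J a) S - {j} = insert (J a) (S - {j})"
              using neq by auto
            then show "alt (card {i \<in> insert (J a) S. i < j})
                (lookup (w (insert (J a) S - {j})) a) =
              - alt (card {i \<in> S. i < J a}) (alt (card {i \<in> S. i < j}) (lookup (v (S - {j})) a))"
              unfolding lookup_v card_less_insert[OF False] c
              using cS[OF j] Ja False neq
              by (auto simp: alt_alt alt_Suc[symmetric] intro!: alt_cong)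
          qed
          also have "\<dots> = - alt (card {i \<in> S. i < J a}) (lookup (cdiff n v S) a)"
            unfolding lhs alt_sum sum_negf ..
          finally have "alt (card {i \<in> S. i < J a}) (lookup (w S) a) =
              alt (card {i \<in> S. i < J a}) (lookup (cdiff n v S) a)"
            by simp
          then show ?thesis
            by (simp add: alt_def split: if_splits)
        qed
      qed
    qed
  qed
  ultimately show ?thesis
    by blast
qed

text \<open>
  A set \<open>S\<close> of less than \<open>n\<close> elements misses some \<open>j < n\<close>, and on the localization at \<open>S\<close> the
  exponents of \<open>X\<^sub>j\<close> are nonnegative.
\<close>

lemma cech_exact:
  fixes w :: "nat set \<Rightarrow> 'k::comm_ring_1 laurent"
  assumes w: "w \<in> cech n (Suc q) (loc n)" and qn: "Suc q < n" and cocycle: "cdiff n w = 0"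
  shows "\<exists>v\<in>cech n q (loc n). cdiff n v = w"
proof (rule cech_exact_nonneg[OF w cocycle])
  fix S a assume a: "lookup (w S) a \<noteq> 0"
  then have S: "S \<subseteq> {..<n}" "card S = Suc q" "w S \<in> loc n S"
    using cech_zero[OF w, of S] cechD[OF w, of S] by fastforce+
  then have "S \<noteq> {..<n}"
    using qn by auto
  then obtain j where "j < n" "j \<notin> S"
    using S by auto
  then show "\<exists>j<n. 0 \<le> lookup a j"
    using S(3) a unfolding loc_iff by blast
qed

section \<open>The transgression of a total cocycle\<close>

lemma totalD: "w \<in> total n r s \<Longrightarrow> S \<subseteq> {..<n} \<Longrightarrow> w S \<in> koszul r (card S + s) (loc n S)"
  by (auto simp: total_def)

lemma total_zero: "w \<in> total n r s \<Longrightarrow> \<not> S \<subseteq> {..<n} \<Longrightarrow> w S = 0"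
  by (auto simp: total_def split: if_splits)

lemma subgrp_total: "subgrp (total n r s)"
  using subgrp_koszul[OF subgrp_loc] unfolding subgrp_def total_def by auto

lemma tdiff_add: "tdiff n r f (w + w') = tdiff n r f w + tdiff n r f w'"
  by (rule ext) (simp add: tdiff_def cdiff_add kdiff_add alt_add)

lemma additive_tdiff: "additive (tdiff n r f)"
  by (simp add: additive_def tdiff_add)

text \<open>
  The sign \<open>(-1)\<close> to the power \<open>card S\<close> makes the two differentials anticommute.
\<close>

lemma tdiff_tdiff:
  assumes w: "w \<in> total n r s"
  shows "tdiff n r f (tdiff n r f w) = 0"
proof
  fix S
  show "tdiff n r f (tdiff n r f w) S = 0 S"
  proof (cases "S \<subseteq> {..<n}")
    case True
    then have finS: "finite S"
      using finite_subset by blast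
    have "cdiff n (\<lambda>S. alt (card S) (kdiff r f (w S))) S =
        (\<Sum>j\<in>S. - alt (card S) (alt (card {i \<in> S. i < j}) (kdiff r f (w (S - {j})))))"
      unfolding cdiff_def if_P[OF True]
    proof (rule sum.cong[OF refl])
      fix j assume "j \<in> S"
      then have "card S = Suc (card (S - {j}))"
        using finS by (metis card_Suc_Diff1)
      then show "alt (card {i \<in> S. i < j}) (alt (card (S - {j})) (kdiff r f (w (S - {j})))) =
          - alt (card S) (alt (card {i \<in> S. i < j}) (kdiff r f (w (S - {j}))))"
        by (simp add: alt_Suc alt_alt add.commute)
    qed
    also have "\<dots> = - alt (card S) (kdiff r f (cdiff n w S))"
      using True by (simp add: cdiff_def kdiff_sum kdiff_alt sum_negf alt_sum)
    finally have "cdiff n (\<lambda>S. alt (card S) (kdiff r f (w S))) S = - alt (card S) (kdiff r f (cdiff n w S))" .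
    moreover have "tdiff n r f w = cdiff n w + (\<lambda>S. alt (card S) (kdiff r f (w S)))"
      by (rule ext) (simp add: tdiff_def)
    ultimately show ?thesis
      by (simp add: tdiff_def[of n r f "_ + _"] cdiff_add cdiff_cdiff kdiff_add kdiff_alt kdiff_kdiff alt_add)
  next
    case False
    then have "tdiff n r f w S = 0"
      using total_zero[OF w False] by (simp add: tdiff_def cdiff_def kdiff_0)
    then show ?thesis
      using False by (simp add: tdiff_def[of n r f "tdiff n r f w"] cdiff_def kdiff_0)
  qed
qed

lemma tdiff_total:
  assumes w: "w \<in> total n r (Suc s)" and f: "\<And>i. i < r \<Longrightarrow> f i \<in> polys n"
  shows "tdiff n r f w \<in> total n r s"
proof -
  have "tdiff n r f w S \<in> koszul r (card S + s) (loc n S)" if S: "S \<subseteq> {..<n}" for S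
  proof -
    have finS: "finite S"
      using S finite_subset by blast
    have "w (S - {j}) \<in> koszul r (card S + s) (loc n S)" if "j \<in> S" for j
    proof -
      have "w (S - {j}) \<in> koszul r (card (S - {j}) + Suc s) (loc n (S - {j}))"
        using S by (intro totalD[OF w]) auto
      moreover have "card (S - {j}) + Suc s = card S + s"
        using card_Suc_Diff1[OF finS that] by simp
      ultimately have "w (S - {j}) \<in> koszul r (card S + s) (loc n (S - {j}))"
        by (simp only:)
      then show ?thesis
        using koszul_mono[OF loc_mono, of "S - {j}" S] by blast
    qed
    then have "cdiff n w S \<in> koszul r (card S + s) (loc n S)"
      unfolding cdiff_def if_P[OF S] by (intro subgrp_sum subgrp_alt subgrp_koszul subgrp_loc)
    moreover have "kdiff r f (w S) \<in> koszul r (card S + s) (loc n S)"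
    proof (rule kdiff_koszul[OF subgrp_loc])
      show "f i * x \<in> loc n S" if "i < r" "x \<in> loc n S" for i x
        using that f[OF that(1)] loc_mono[of "{}" S n] by (intro loc_mult) auto
      show "w S \<in> koszul r (Suc (card S + s)) (loc n S)"
        using totalD[OF w S] by simp
    qed
    ultimately show ?thesis
      unfolding tdiff_def by (intro subgrp_add subgrp_alt subgrp_koszul subgrp_loc)
  qed
  moreover have "tdiff n r f w S = 0" if "\<not> S \<subseteq> {..<n}" for S
    using that total_zero[OF w that] by (simp add: tdiff_def cdiff_def kdiff_0)
  ultimately show ?thesis
    by (simp add: total_def)
qed

lemma kdiff_in_kboundsC: "z \<in> kdiff r f ` koszul r (p + 1) (polys n) \<Longrightarrow> z \<in> kboundsC n r f p"
  by (simp add: kbounds_def koszul_0)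

lemma subgrp_kboundsC: "subgrp (kboundsC n r f p)"
  by (rule subgrp_kbounds[OF subgrp_loc subgrp_zero])

text \<open>
  Descending the staircase: if \<open>q\<close> is the highest Cech degree where \<open>w\<close> is nonzero, then the
  component of degree \<open>q\<close> is a Cech cocycle with coefficients in a free module, hence for \<open>0 < q < n\<close>
  a coboundary, and subtracting a total coboundary lowers \<open>q\<close>. In degree 0 a Cech cocycle
  vanishes.
\<close>

lemma total_cocycle_edge_bound:
  fixes f :: "nat \<Rightarrow> 'k::comm_ring_1 laurent"
  assumes f: "\<And>i. i < r \<Longrightarrow> f i \<in> polys n"
  shows "q < n \<Longrightarrow> w \<in> total n r s \<Longrightarrow> tdiff n r f w = 0 \<Longrightarrow>
    (\<And>S. S \<subseteq> {..<n} \<Longrightarrow> q < card S \<Longrightarrow> w S = 0) \<Longrightarrow>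
    w {} \<in> kdiff r f ` koszul r (s + 1) (polys n)"
proof (induction q arbitrary: w)
  case 0
  have "w {0} = 0"
    using \<open>0 < n\<close> by (intro 0(4)) auto
  moreover have "tdiff n r f w {0} = 0"
    by (simp add: 0(3) zero_fun_def)
  moreover have "{i. i = 0 \<and> i < (0::nat)} = {}"
    by auto
  ultimately have "w {} = 0"
    using \<open>0 < n\<close> by (simp add: tdiff_def cdiff_def kdiff_0)
  then show ?case
    using subgrp_0[OF subgrp_image[OF additive_kdiff subgrp_koszul[OF subgrp_loc]]] by (simp only:)
next
  case (Suc q)
  note w = \<open>w \<in> total n r s\<close>
  have "\<exists>v\<in>cech n q (loc n). cdiff n v = (\<lambda>S. if card S = Suc q then w S T else 0)"
    if T: "T \<subseteq> {..<r}" "card T = Suc q + s" for T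
  proof (rule cech_exact)
    let ?wT = "\<lambda>S. if card S = Suc q then w S T else 0"
    show cech: "?wT \<in> cech n (Suc q) (loc n)"
    proof (rule cechI)
      fix S assume S: "S \<subseteq> {..<n}" "card S = Suc q"
      then show "?wT S \<in> loc n S"
        using koszulD[OF totalD[OF w S(1)] T(1)] T(2) by simp
    next
      fix S assume "\<not> (S \<subseteq> {..<n} \<and> card S = Suc q)"
      then show "?wT S = 0"
        using total_zero[OF w, of S] by (cases "S \<subseteq> {..<n}") auto
    qed
    show "cdiff n ?wT = 0"
    proof
      fix S
      show "cdiff n ?wT S = 0 S"
      proof (cases "S \<subseteq> {..<n} \<and> card S = Suc (Suc q)")
        case False
        then show ?thesis
          using cdiff_cech_zero[OF cech] by simp
      next
        case True
        then have finS: "finite S"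
          using finite_subset by blast
        have "tdiff n r f w S = 0" "w S = 0"
          using Suc.prems True by auto
        then have "cdiff n w S T = 0"
          by (simp add: tdiff_def kdiff_0)
        moreover have "cdiff n w S T = cdiff n ?wT S"
          unfolding cdiff_apply unfolding cdiff_def using True finS by (auto intro!: sum.cong)
        ultimately show ?thesis
          by simp
      qed
    qed
  qed (use Suc.prems in auto)
  then have ex: "\<exists>v. v \<in> cech n q (loc n) \<and> cdiff n v = (\<lambda>S. if card S = Suc q then w S T else 0)"
    if "T \<subseteq> {..<r}" "card T = Suc q + s" for T
    using that by blast
  define V where "V T = (SOME v. v \<in> cech n q (loc n) \<and>
      cdiff n v = (\<lambda>S. if card S = Suc q then w S T else 0))" for T
  have V: "V T \<in> cech n q (loc n)" "cdiff n (V T) = (\<lambda>S. if card S = Suc q then w S T else 0)"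
    if "T \<subseteq> {..<r}" "card T = Suc q + s" for T
    using someI_ex[OF ex[OF that]] unfolding V_def by blast+
  define v where "v S T = (if T \<subseteq> {..<r} \<and> card T = Suc q + s then V T S else 0)" for S T
  have v: "v \<in> total n r (Suc s)"
    unfolding total_def
  proof (intro CollectI allI)
    fix S
    show "if S \<subseteq> {..<n} then v S \<in> koszul r (card S + Suc s) (loc n S) else v S = 0"
    proof (cases "S \<subseteq> {..<n} \<and> card S = q")
      case True
      then have "V T S \<in> loc n S" if "T \<subseteq> {..<r}" "card T = Suc q + s" for T
        using cechD[OF V(1)[OF that]] by blast
      then have "v S \<in> koszul r (Suc q + s) (loc n S)"
        by (intro koszulI) (auto simp only: v_def if_True if_False simp_thms)
      then show ?thesis
        using True by simp
    next
      case False
      then have "v S = 0"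
        using cech_zero[OF V(1) False] by (auto simp: v_def fun_eq_iff)
      then show ?thesis
        by (simp add: subgrp_0 subgrp_koszul subgrp_loc)
    qed
  qed
  have v0: "v S = 0" if "\<not> (S \<subseteq> {..<n} \<and> card S = q)" for S
    using cech_zero[OF V(1) that] by (auto simp: v_def fun_eq_iff)
  have cv: "cdiff n v S = (if card S = Suc q then w S else 0)" if S: "S \<subseteq> {..<n}" for S
  proof
    fix T
    show "cdiff n v S T = (if card S = Suc q then w S else 0) T"
    proof (cases "T \<subseteq> {..<r} \<and> card T = Suc q + s")
      case True
      then have "cdiff n v S T = cdiff n (V T) S"
        unfolding cdiff_apply by (simp add: v_def)
      then show ?thesis
        using V(2)[of T] True by simp
    next
      case False
      then have "cdiff n v S T = 0"
        unfolding cdiff_apply v_def if_not_P[OF False] by (simp add: cdiff_def)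
      moreover have "w S T = 0" if "card S = Suc q"
        using koszul_zero[OF totalD[OF w S]] that False by auto
      ultimately show ?thesis
        by simp
    qed
  qed
  have "(w - tdiff n r f v) {} \<in> kdiff r f ` koszul r (s + 1) (polys n)"
  proof (rule Suc.IH)
    show "w - tdiff n r f v \<in> total n r s"
      using w tdiff_total[OF v f] by (intro subgrp_diff[OF subgrp_total]) auto
    show "tdiff n r f (w - tdiff n r f v) = 0"
      using Suc.prems(3) tdiff_tdiff[OF v, of f] by (simp only: additive.diff[OF additive_tdiff] diff_self)
    fix S assume S: "S \<subseteq> {..<n}" "q < card S"
    then show "(w - tdiff n r f v) S = 0"
    proof (cases "card S = Suc q")
      case False
      have vS: "v S = 0"
        using S by (intro v0) auto
      have "w S = 0"
        using S False by (intro Suc.prems(4)) auto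
      then show ?thesis
        using vS cv[OF S(1)] False
        by (simp only: tdiff_def minus_apply if_False kdiff_0 alt_0_right add_0_right diff_self)
    qed (use v0[of S] cv[OF S(1)] in \<open>simp add: tdiff_def kdiff_0\<close>)
  qed (use Suc.prems in simp)
  then obtain y where y: "y \<in> koszul r (s + 1) (polys n)" "w {} - tdiff n r f v {} = kdiff r f y"
    by auto
  have "tdiff n r f v {} = kdiff r f (v {})"
    by (simp add: tdiff_def cdiff_def)
  then have "w {} = kdiff r f (y + v {})"
    using y(2) by (simp add: kdiff_add diff_eq_eq)
  moreover have "v {} \<in> koszul r (s + 1) (polys n)"
    using totalD[OF v, of "{}"] by simp
  ultimately show ?case
    using y(1) subgrp_add[OF subgrp_koszul[OF subgrp_loc]] by blast
qed

text \<open>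
  This is the injectivity part of the isomorphism of the first spectral sequence, after composition
  with the edge morphism: the class of the bottom component depends only on that of the top
  component.
\<close>

lemma total_cocycle_edge_bound_of_top:
  fixes f :: "nat \<Rightarrow> 'k::comm_ring_1 laurent"
  assumes n: "1 \<le> n" "n \<le> r" and f: "\<And>i. i < r \<Longrightarrow> f i \<in> polys n"
    and w: "w \<in> total n r (r - n)" and cocycle: "tdiff n r f w = 0"
    and top: "(\<lambda>S. if S = {..<n} then w S else 0) \<in> HnK_zero n r"
  shows "w {} \<in> kboundsC n r f (r - n)"
proof -
  obtain v where v: "v \<in> cech n (n - 1) (\<lambda>S. koszul r r (loc n S))"
    and wv: "cdiff n v = (\<lambda>S. if S = {..<n} then w S else 0)"
    using top unfolding cech_bounds_def by auto
  have vt: "v \<in> total n r (Suc (r - n))"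
    unfolding total_def
  proof (intro CollectI allI)
    fix S
    show "if S \<subseteq> {..<n} then v S \<in> koszul r (card S + Suc (r - n)) (loc n S) else v S = 0"
      using cechD[OF v, of S] cech_zero[OF v, of S] n subgrp_0[OF subgrp_koszul[OF subgrp_loc]]
      by (cases "S \<subseteq> {..<n} \<and> card S = n - 1") auto
  qed
  have "(w - tdiff n r f v) {} \<in> kdiff r f ` koszul r (r - n + 1) (polys n)"
  proof (rule total_cocycle_edge_bound[where q="n - 1"])
    show "w - tdiff n r f v \<in> total n r (r - n)"
      using w tdiff_total[OF vt f] by (intro subgrp_diff[OF subgrp_total]) auto
    show "tdiff n r f (w - tdiff n r f v) = 0"
      using cocycle tdiff_tdiff[OF vt, of f] by (simp only: additive.diff[OF additive_tdiff] diff_self)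
    fix S assume S: "S \<subseteq> {..<n}" "n - 1 < card S"
    then have "card S = n"
      using card_mono[of "{..<n}" S] by auto
    then have "S = {..<n}"
      using S by (intro card_subset_eq) auto
    moreover have "v {..<n} = 0"
      using n by (intro cech_zero[OF v]) auto
    ultimately show "(w - tdiff n r f v) S = 0"
      by (simp add: tdiff_def wv kdiff_0)
  qed (use n f in auto)
  then obtain y where y: "y \<in> koszul r (r - n + 1) (polys n)" "w {} - tdiff n r f v {} = kdiff r f y"
    by auto
  have "tdiff n r f v {} = kdiff r f (v {})"
    by (simp add: tdiff_def cdiff_def)
  then have "w {} = kdiff r f (y + v {})"
    using y(2) by (simp add: kdiff_add diff_eq_eq)
  moreover have "v {} \<in> koszul r (r - n + 1) (polys n)"
    using totalD[OF vt, of "{}"] by simp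
  ultimately show ?thesis
    using y(1) subgrp_add[OF subgrp_koszul[OF subgrp_loc]] by (intro kdiff_in_kboundsC) blast
qed

text \<open>
  The transgression may be read off from any total cocycle with the prescribed top component. The
  cocycle also witnesses that the class lies in the image of the isomorphism of the first spectral
  sequence, whose inverse enters the transgression.
\<close>

lemma tau0_eqI:
  fixes f :: "nat \<Rightarrow> 'k::comm_ring_1 laurent"
  assumes n: "1 \<le> n" "n \<le> r" and f: "\<And>i. i < r \<Longrightarrow> f i \<in> polys n"
    and w: "w \<in> total n r (r - n)" and cocycle: "tdiff n r f w = 0"
    and top: "w {..<n} = (\<lambda>T. p * kbasis {..<r} T)"
  shows "tau0 n r f (Hn_class n p) = w {} +o kboundsC n r f (r - n)"
proof -
  define B where "B = tdiff n r f ` total n r (r - n + 1)"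
  define Z where "Z = (HnK_zero n r :: (nat set \<Rightarrow> nat set \<Rightarrow> 'k laurent) set)"
  define t where "t w = (\<lambda>S. if S = {..<n} then w S else 0)" for w :: "nat set \<Rightarrow> nat set \<Rightarrow> 'k laurent"
  have B: "subgrp B"
    unfolding B_def by (intro subgrp_image additive_tdiff subgrp_total)
  have Z: "subgrp Z"
    unfolding Z_def by (intro subgrp_cech_bounds subgrp_koszul subgrp_loc)
  have addt: "additive t"
    by (auto simp: additive_def t_def fun_eq_iff)
  have tB: "t ` B \<subseteq> Z"
  proof
    fix x assume "x \<in> t ` B"
    then obtain v where v: "v \<in> total n r (r - n + 1)" and x: "x = t (tdiff n r f v)"
      by (auto simp: B_def)
    define v' where "v' S = (if S \<subseteq> {..<n} \<and> card S = n - 1 then v S else 0)" for S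
    have v': "v' \<in> cech n (n - 1) (\<lambda>S. koszul r r (loc n S))"
    proof (rule cechI)
      fix S assume "S \<subseteq> {..<n}" "card S = n - 1"
      then show "v' S \<in> koszul r r (loc n S)"
        using totalD[OF v, of S] n by (simp add: v'_def)
    qed (auto simp: v'_def)
    have "v {..<n} \<in> koszul r (r + 1) (loc n {..<n})"
      using totalD[OF v, of "{..<n}"] n by simp
    then have "v {..<n} T = 0" for T
      using koszul_zero[of _ r "r + 1" _ T] card_mono[of "{..<r}" T] by fastforce
    then have "v {..<n} = 0"
      by (simp add: fun_eq_iff)
    then have "tdiff n r f v {..<n} = cdiff n v {..<n}"
      by (simp add: tdiff_def kdiff_0)
    also have "\<dots> = cdiff n v' {..<n}"
      unfolding cdiff_def by (auto simp: v'_def intro!: sum.cong)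
    finally have "x S = cdiff n v' S" for S
    proof (cases "S = {..<n}")
      case False
      then have "\<not> (S \<subseteq> {..<n} \<and> card S = Suc (n - 1))"
        using n card_subset_eq[of "{..<n}" S] by auto
      then show ?thesis
        using False cdiff_cech_zero[OF v'] by (simp add: x t_def)
    qed (simp add: x t_def)
    then show "x \<in> Z"
      unfolding Z_def cech_bounds_def using v' by blast
  qed
  have iso: "first_iso n r (v +o B) = t v +o Z" for v
    unfolding first_iso_def t_def[symmetric, abs_def] Z_def[symmetric]
    by (rule induced_coset[OF addt tB B Z])
  have "wedge_top n r (Hn_class n p) = (\<lambda>S T. (if S = {..<n} then p else 0) * kbasis {..<r} T) +o Z"
    unfolding wedge_top_def Hn_class_def Z_def[symmetric]
  proof (rule induced_coset)
    show add: "additive (\<lambda>(w::nat set \<Rightarrow> 'k laurent) S T. w S * kbasis {..<r} T)"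
      by (auto simp: additive_def fun_eq_iff distrib_right)
    show "(\<lambda>w S T. w S * kbasis {..<r} T) ` Hn_zero n \<subseteq> Z"
    proof clarify
      fix x :: "nat set \<Rightarrow> 'k laurent" assume "x \<in> Hn_zero n"
      then obtain v where v: "v \<in> cech n (n - 1) (loc n)" and x: "x = cdiff n v"
        by (auto simp: cech_bounds_def)
      have "(\<lambda>S T. v S * kbasis {..<r} T) \<in> cech n (n - 1) (\<lambda>S. koszul r r (loc n S))"
        using cechD[OF v] cech_zero[OF v] subgrp_0[OF subgrp_loc]
        by (intro cechI koszulI) (auto simp: kbasis_def fun_eq_iff)
      moreover have "(\<lambda>S T. x S * kbasis {..<r} T) = cdiff n (\<lambda>S T. v S * kbasis {..<r} T)"
        by (rule ext, rule ext)
          (simp add: x cdiff_apply cdiff_map[of "\<lambda>x. x * kbasis {..<r} _"] additive_def distrib_right)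
      ultimately show "(\<lambda>S T. x S * kbasis {..<r} T) \<in> Z"
        unfolding Z_def cech_bounds_def by blast
    qed
    show "subgrp (Hn_zero n :: (nat set \<Rightarrow> 'k laurent) set)"
      by (intro subgrp_cech_bounds subgrp_loc)
  qed (rule Z)
  also have "(\<lambda>S T. (if S = {..<n} then p else 0) * kbasis {..<r} T) = t w"
    by (auto simp: t_def top fun_eq_iff)
  finally have wedge: "wedge_top n r (Hn_class n p) = t w +o Z" .
  have hyper: "hyper n r f (r - n) = (\<lambda>x. x +o B) ` {w \<in> total n r (r - n). tdiff n r f w = 0}"
    by (simp add: hyper_def quot_def B_def)
  define X where "X = inv_into (hyper n r f (r - n)) (first_iso n r) (t w +o Z)"
  have im: "t w +o Z \<in> first_iso n r ` hyper n r f (r - n)"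
    unfolding iso[symmetric] hyper using w cocycle by blast
  have "X \<in> hyper n r f (r - n)"
    unfolding X_def using im by (rule inv_into_into)
  then obtain w' where w': "w' \<in> total n r (r - n)" "tdiff n r f w' = 0" and X: "X = w' +o B"
    by (auto simp: hyper)
  have "first_iso n r X = t w +o Z"
    unfolding X_def using im by (rule f_inv_into_f)
  then have "t w' - t w \<in> Z"
    unfolding X iso by (simp add: coset_eq_iff[OF Z])
  then have "t (w' - w) \<in> Z"
    by (simp add: additive.diff[OF addt])
  moreover have "tdiff n r f (w' - w) = 0"
    using w'(2) cocycle by (simp only: additive.diff[OF additive_tdiff] diff_self)
  ultimately have "(w' - w) {} \<in> kboundsC n r f (r - n)"
    using w w'(1) unfolding t_def Z_def
    by (intro total_cocycle_edge_bound_of_top[OF n f] subgrp_diff[OF subgrp_total])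
  then have "w' {} +o kboundsC n r f (r - n) = w {} +o kboundsC n r f (r - n)"
    by (simp add: coset_eq_iff[OF subgrp_kboundsC])
  moreover have "edge n r f X = w' {} +o kboundsC n r f (r - n)"
    unfolding edge_def X
  proof (rule induced_coset[OF _ _ B subgrp_kboundsC])
    show "additive (\<lambda>w. w {})" for w :: "nat set \<Rightarrow> nat set \<Rightarrow> 'k laurent"
      by (simp add: additive_def)
    show "(\<lambda>w. w {}) ` B \<subseteq> kboundsC n r f (r - n)"
    proof clarify
      fix b assume "b \<in> B"
      then obtain v where v: "v \<in> total n r (r - n + 1)" "b = tdiff n r f v"
        by (auto simp: B_def)
      then have "b {} = kdiff r f (v {})" "v {} \<in> koszul r (r - n + 1) (polys n)"
        using totalD[OF v(1), of "{}"] by (auto simp: tdiff_def cdiff_def)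
      then show "b {} \<in> kboundsC n r f (r - n)"
        by (intro kdiff_in_kboundsC) auto
    qed
  qed
  ultimately show ?thesis
    unfolding tau0_def wedge X_def by simp
qed

section \<open>Additive maps and monomials\<close>

lemma poly_mapping_sum_single: "p = (\<Sum>a\<in>keys p. single a (lookup p a))"
proof (rule poly_mapping_eqI)
  fix b
  have "(\<Sum>a\<in>keys p. lookup (single a (lookup p a)) b)
      = (\<Sum>a\<in>keys p. if a = b then lookup p b else 0)"
    by (intro sum.cong) (auto simp: lookup_single)
  then show "lookup p b = lookup
      (\<Sum>a\<in>keys p. single a (lookup p a)) b"
    by (simp add: lookup_sum in_keys_iff)
qed

lemma additive_sum_singles:
  assumes "additive F"
  shows "F p = (\<Sum>a\<in>keys p. F (single a (lookup p a)))"
  by (subst poly_mapping_sum_single) (rule additive.sum[OF assms])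

lemma additive_eq_on_singles:
  assumes "additive F" and "additive G"
    and "\<And>a. a \<in> keys p \<Longrightarrow> F (single a (lookup p a)) = G (single a (lookup p a))"
  shows "F p = G p"
  unfolding additive_sum_singles[OF assms(1), of p] additive_sum_singles[OF assms(2), of p]
  using assms(3) by (rule sum.cong[OF refl])

lemma additive_in_on_singles:
  assumes "additive F" and "subgrp A"
    and "\<And>a. a \<in> keys p \<Longrightarrow> F (single a (lookup p a)) \<in> A"
  shows "F p \<in> A"
  unfolding additive_sum_singles[OF assms(1), of p] using assms(3) by (rule subgrp_sum[OF assms(2)])

lemma additive_mult_left: "additive (\<lambda>x. c * x)" for c :: "'a::ring"
  by (simp add: additive_def distrib_left)

lemma additive_mult_right: "additive (\<lambda>x. x * c)" for c :: "'a::ring"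
  by (simp add: additive_def distrib_right)

lemma additive_ident: "additive (\<lambda>x. x)"
  by (simp add: additive_def)

lemma additive_comp: "additive F \<Longrightarrow> additive G \<Longrightarrow> additive (\<lambda>x. F (G x))"
  by (simp add: additive_def)

text \<open>
  Subgroups defined by conditions on exponents and coefficients can be tested on products of monomials.
\<close>

lemma mult_in_subgrp:
  fixes P Q :: "'a::comm_monoid_add \<Rightarrow>\<^sub>0 'b::comm_ring"
  assumes A: "subgrp A"
    and mem: "\<And>b c. b \<in> keys P \<Longrightarrow> c \<in> keys Q \<Longrightarrow>
      single (b + c) (lookup P b * lookup Q c) \<in> A"
  shows "P * Q \<in> A"
proof (rule additive_in_on_singles[OF additive_mult_right A])
  fix b assume b: "b \<in> keys P"
  show "single b (lookup P b) * Q \<in> A"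
    by (rule additive_in_on_singles[OF additive_mult_left A]) (simp add: mult_single mem[OF b])
qed

lemma lookup_single_mult:
  fixes Q :: "'a::ab_group_add \<Rightarrow>\<^sub>0 'b::comm_ring"
  shows "lookup (single c x * Q) b = x * lookup Q (b - c)"
proof (rule additive_eq_on_singles[where p=Q])
  show "additive (\<lambda>Q. lookup (single c x * Q) b)"
    by (simp add: additive_def distrib_left lookup_add)
  show "additive (\<lambda>Q. x * lookup Q (b - c))"
    by (simp add: additive_def distrib_left lookup_add)
qed (auto simp: mult_single lookup_single when_def algebra_simps)

lemma lookup_const_mult: "lookup (const c * p) a = c * lookup p a"
  for c :: "'k::comm_ring_1"
  by (simp add: const_def lookup_single_mult)

lemma const_0: "const 0 = 0"
  by (simp add: const_def)

lemma const_1: "const 1 = 1"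
  by (simp add: const_def)

lemma const_mult: "const (a * b) = const a * const b"
  by (simp add: const_def mult_single)

lemma const_add: "const (a + b) = const a + const b"
  by (simp add: const_def single_add)

lemma const_minus: "const (- a) = - const a"
  by (simp add: const_def single_uminus)

lemma const_sum: "const (\<Sum>i\<in>I. F i) = (\<Sum>i\<in>I. const (F i))"
  by (induction I rule: infinite_finite_induct) (auto simp: const_0 const_add)

lemma const_in_loc: "const c \<in> loc n S"
  by (auto simp: const_def loc_iff lookup_single when_def split: if_splits)

section \<open>Polynomials in \<open>Y\<close> with Laurent coefficients in \<open>X\<close>\<close>

definition poly_exps :: "nat \<Rightarrow> (nat \<Rightarrow>\<^sub>0 int) set" where
  "poly_exps n = {b. keys b \<subseteq> {..<n} \<and> (\<forall>j. 0 \<le> lookup b j)}"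

lemma poly_exps_0: "0 \<in> poly_exps n"
  by (simp add: poly_exps_def)

lemma poly_exps_add: "b \<in> poly_exps n \<Longrightarrow> c \<in> poly_exps n \<Longrightarrow> b + c \<in> poly_exps n"
  using keys_add[of b c] by (auto simp: poly_exps_def lookup_add)

lemma poly_exps_single: "j < n \<Longrightarrow> 0 \<le> c \<Longrightarrow> single j c \<in> poly_exps n"
  by (auto simp: poly_exps_def lookup_single when_def)

lemma polys_iff: "p \<in> polys n \<longleftrightarrow> (\<forall>a. lookup p a \<noteq> 0 \<longrightarrow> a \<in> poly_exps n)"
  by (auto simp: loc_iff poly_exps_def)

text \<open>
  Polynomials in \<open>Y\<close> whose coefficients lie in the localization \<open>loc n S\<close>: the localization at
  \<open>\<Prod>j\<in>S. X\<^sub>j\<close> of \<open>k[X,Y]\<close>.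
\<close>

definition loc2 :: "nat \<Rightarrow> nat set \<Rightarrow> 'k::zero laurent2 set" where
  "loc2 n S = {P. \<forall>b. lookup P b \<noteq> 0 \<longrightarrow> b \<in> poly_exps n \<and> lookup P b \<in> loc n S}"

lemma polys2_loc2: "polys2 n = loc2 n {}"
  by (auto simp: polys2_def loc2_def poly_exps_def in_keys_iff)

lemma loc2_mono: "S \<subseteq> S' \<Longrightarrow> loc2 n S \<subseteq> loc2 n S'"
  using loc_mono[of S S' n] by (auto simp: loc2_def)

lemma subgrp_coefficients: "(\<And>b. subgrp (A b)) \<Longrightarrow> subgrp {P. \<forall>b. lookup P b \<in> A b}"
  by (simp add: subgrp_def lookup_minus)

lemma subgrp_loc2: "subgrp (loc2 n S :: 'k::ab_group_add laurent2 set)"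
proof -
  have "(0 :: 'k laurent) \<in> loc n S"
    by (rule subgrp_0[OF subgrp_loc])
  then have "(loc2 n S :: 'k laurent2 set) = {P. \<forall>b. lookup P b \<in> (if b \<in> poly_exps n then loc n S else {0})}"
    by (auto simp: loc2_def split: if_splits) metis
  then show ?thesis
    by (simp only:) (intro subgrp_coefficients, simp add: subgrp_loc subgrp_zero)
qed

lemma single_in_loc2: "b \<in> poly_exps n \<Longrightarrow> p \<in> loc n S \<Longrightarrow> single b p \<in> loc2 n S"
  by (auto simp: loc2_def lookup_single when_def)

lemma loc2D: "P \<in> loc2 n S \<Longrightarrow> b \<in> keys P \<Longrightarrow> b \<in> poly_exps n \<and> lookup P b \<in> loc n S"
  by (auto simp: loc2_def in_keys_iff)

lemma loc2_mult: "P \<in> loc2 n S \<Longrightarrow> Q \<in> loc2 n S \<Longrightarrow> P * Q \<in> loc2 n S"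
  for P Q :: "'k::comm_ring_1 laurent2"
  by (rule mult_in_subgrp[OF subgrp_loc2]) (blast dest: loc2D intro: single_in_loc2 poly_exps_add loc_mult)

lemma one_in_loc2: "(1 :: 'k::comm_ring_1 laurent2) \<in> loc2 n S"
proof -
  have "single 0 (const (1::'k)) \<in> loc2 n S"
    by (intro single_in_loc2 poly_exps_0 const_in_loc)
  then show ?thesis
    by (simp add: const_1)
qed

lemma loc2_prod: "(\<And>i. i \<in> I \<Longrightarrow> P i \<in> loc2 n S) \<Longrightarrow> (\<Prod>i\<in>I. P i) \<in> loc2 n S"
  for P :: "'i \<Rightarrow> 'k::comm_ring_1 laurent2"
  by (induction I rule: infinite_finite_induct) (auto simp: one_in_loc2 loc2_mult)

lemma lookup_in_Y: "lookup (in_Y p) b = const (lookup p b)"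
  by (simp add: in_Y_def map.rep_eq when_def const_0)

lemma in_Y_add: "in_Y (p + q) = in_Y p + in_Y q" for p q :: "'k::comm_ring_1 laurent"
  by (rule poly_mapping_eqI) (simp add: lookup_in_Y lookup_add const_add)

lemma additive_in_Y: "additive (in_Y :: 'k::comm_ring_1 laurent \<Rightarrow> _)"
  by (simp add: additive_def in_Y_add)

lemma in_Y_single: "in_Y (single b c) = single b (const c)"
  by (rule poly_mapping_eqI) (auto simp: lookup_in_Y lookup_single when_def const_0)

lemma in_Y_in_loc2: "p \<in> polys n \<Longrightarrow> in_Y p \<in> loc2 n S"
proof -
  assume p: "p \<in> polys n"
  have "b \<in> poly_exps n" if "const (lookup p b) \<noteq> 0" for b
    using p that const_0 unfolding polys_iff by metis
  then show ?thesis
    by (simp add: loc2_def lookup_in_Y const_in_loc)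
qed

text \<open>
  The map \<open>id \<otimes> U\<close>, where \<open>U\<close> gives the values of a linear form on the monomials in \<open>Y\<close>.
\<close>

definition pair_Y :: "((nat \<Rightarrow>\<^sub>0 int) \<Rightarrow> 'k) \<Rightarrow> 'k::comm_ring_1 laurent2 \<Rightarrow> 'k laurent" where
  "pair_Y U P = (\<Sum>b\<in>keys P. const (U b) * lookup P b)"

lemma additive_pair_Y: "additive (pair_Y U)"
  unfolding additive_def pair_Y_def
  by (intro allI setsum_keys_plus_distrib) (auto simp: distrib_left)

lemma pair_Y_single: "pair_Y U (single b p) = const (U b) * p"
  by (simp add: pair_Y_def)

lemma pair_Y_in_X: "pair_Y U (in_X p * P) = p * pair_Y U P"
  by (rule additive_eq_on_singles[where p=P])
    (auto simp: additive_def distrib_left additive.add[OF additive_pair_Y] in_X_def mult_single pair_Y_single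
      mult.left_commute)

lemma pair_Y_in_loc: "P \<in> loc2 n S \<Longrightarrow> pair_Y U P \<in> loc n S"
  unfolding pair_Y_def
  by (intro subgrp_sum subgrp_loc loc_mult const_in_loc) (blast dest: loc2D)

text \<open>
  \<open>U\<close> is a linear form on \<open>k[Y]\<close> that vanishes on the ideal generated by the \<open>f\<^sub>i\<close> and on all monomials
  divisible by some \<open>Y\<^sub>j\<close> to the power \<open>N\<close>, extended by 0 to the other Laurent monomials. The bound \<open>N\<close>
  replaces power series in \<open>Y\<close> by polynomials.
\<close>

definition dual_coeffs ::
  "nat \<Rightarrow> nat \<Rightarrow> (nat \<Rightarrow> 'k::comm_ring_1 laurent) \<Rightarrow> nat \<Rightarrow> ((nat \<Rightarrow>\<^sub>0 int) \<Rightarrow> 'k) \<Rightarrow> bool" where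
  "dual_coeffs n r f N U \<longleftrightarrow>
     (\<forall>b. U b \<noteq> 0 \<longrightarrow> b \<in> poly_exps n \<and> (\<forall>j<n. lookup b j < int N)) \<and>
     (\<forall>i<r. \<forall>b\<in>poly_exps n. (\<Sum>a\<in>keys (f i). lookup (f i) a * U (a + b)) = 0)"

lemma pair_Y_in_Y_zero:
  assumes U: "dual_coeffs n r f N U" and i: "i < r" and P: "P \<in> loc2 n S"
  shows "pair_Y U (in_Y (f i) * P) = 0"
proof (rule additive_eq_on_singles[where p=P])
  show "additive (\<lambda>P. pair_Y U (in_Y (f i) * P))"
    by (intro additive_comp[OF additive_pair_Y] additive_mult_left)
  show "additive (\<lambda>P::'a laurent2. 0 :: 'a laurent)"
    by (simp add: additive_def)
  fix b assume "b \<in> keys P"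
  then have b: "b \<in> poly_exps n"
    using loc2D[OF P] by blast
  define c where "c = lookup P b"
  let ?F = "\<lambda>p. pair_Y U (in_Y p * single b c)"
  have F: "additive ?F"
    by (intro additive_comp[OF additive_pair_Y] additive_comp[OF additive_mult_right] additive_in_Y)
  have "?F (f i) = (\<Sum>a\<in>keys (f i). ?F (single a (lookup (f i) a)))"
    by (rule additive_sum_singles[OF F])
  also have "\<dots> = const (\<Sum>a\<in>keys (f i). lookup (f i) a * U (a + b)) * c"
    by (simp add: in_Y_single mult_single pair_Y_single const_sum const_mult sum_distrib_right mult.assoc
        mult.left_commute)
  also have "\<dots> = 0"
    using U i b by (simp add: dual_coeffs_def const_0)
  finally show "?F (f i) = 0" .
qed

text \<open>
  The expansion of \<open>1/(X\<^sub>j - Y\<^sub>j)\<close> in powers of \<open>Y\<^sub>j\<close>, truncated at the power \<open>N\<close>.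
\<close>

definition invdiff :: "nat \<Rightarrow> nat \<Rightarrow> 'k::comm_ring_1 laurent2" where
  "invdiff N j = (\<Sum>a<N. single (single j (int a))
     (single (single j (- int a - 1)) 1))"

lemma mult_invdiff:
  "(in_X (Xvar j) - in_Y (Xvar j)) * invdiff N j =
     1 - single (single j (int N)) (single (single j (- int N)) 1)"
proof (induction N)
  case 0
  show ?case
    by (simp add: invdiff_def)
next
  case (Suc N)
  have "invdiff (Suc N) j = invdiff N j + single (single j (int N))
     (single (single j (- int N - 1)) (1::'a))"
    by (simp add: invdiff_def)
  moreover have e: "- 1 - int N = - int N - 1"
    by simp
  ultimately show ?case
    by (simp only: distrib_left Suc.IH)
      (simp add: e left_diff_distrib in_X_def in_Y_def Xvar_def const_1 mult_single single_add[symmetric] map_single const_0)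
qed

lemma single_in_loc: "j \<in> S \<Longrightarrow> j < n \<Longrightarrow> single (single j c) x \<in> loc n S"
  by (auto simp: loc_iff lookup_single when_def split: if_splits)

lemma invdiff_in_loc2: "j \<in> S \<Longrightarrow> j < n \<Longrightarrow> invdiff N j \<in> loc2 n S"
  unfolding invdiff_def
  by (intro subgrp_sum[OF subgrp_loc2] single_in_loc2 single_in_loc poly_exps_single) auto

text \<open>
  The error of the truncation is divisible by the power \<open>N\<close> of \<open>Y\<^sub>j\<close>, which \<open>U\<close> cannot see.
\<close>

lemma pair_Y_mult_invdiff:
  assumes U: "dual_coeffs n r f N U" and j: "j < n" and P: "P \<in> loc2 n S"
  shows "pair_Y U ((in_X (Xvar j) - in_Y (Xvar j)) * (invdiff N j * P)) = pair_Y U P"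
proof -
  define x where "x = single (single j (- int N)) (1::'a)"
  have "pair_Y U (single (single j (int N)) x * P) = 0"
  proof (rule additive_eq_on_singles[where p=P])
    show "additive (\<lambda>P. pair_Y U (single (single j (int N)) x * P))"
      by (intro additive_comp[OF additive_pair_Y] additive_mult_left)
    show "additive (\<lambda>P::'a laurent2. 0 :: 'a laurent)"
      by (simp add: additive_def)
    fix b assume "b \<in> keys P"
    then have "b \<in> poly_exps n"
      using loc2D[OF P] by blast
    then have "int N \<le> lookup (single j (int N) + b) j"
      by (simp add: poly_exps_def lookup_add)
    then have "U (single j (int N) + b) = 0"
      using U j unfolding dual_coeffs_def by force
    then show "pair_Y U (single (single j (int N)) x *
        single b (lookup P b)) = 0"
      by (simp add: mult_single pair_Y_single const_0)
  qed
  moreover have "(in_X (Xvar j) - in_Y (Xvar j)) * (invdiff N j * P) =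
      P - single (single j (int N)) x * P"
    unfolding mult.assoc[of _ _ P, symmetric] mult_invdiff by (simp add: left_diff_distrib x_def)
  ultimately show ?thesis
    by (simp add: additive.diff[OF additive_pair_Y])
qed

definition neg_ones :: "nat \<Rightarrow> nat \<Rightarrow>\<^sub>0 int" where
  "neg_ones n = (\<Sum>j<n. single j (-1))"

lemma lookup_neg_ones: "lookup (neg_ones n) j = (if j < n then - 1 else 0)"
proof -
  have "lookup (neg_ones n) j = (\<Sum>l<n. if l = j then - 1 else 0)"
    by (simp add: neg_ones_def lookup_sum lookup_single when_def)
  then show ?thesis
    by simp
qed

text \<open>
  The coefficients of \<open>\<Prod>j<k. 1/(X\<^sub>j - Y\<^sub>j) = \<Sum>b. Y\<^sup>b X\<^sup>-\<^sup>1\<^sup>-\<^sup>b\<close>, up to the truncation.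
\<close>

lemma lookup_prod_invdiff:
  "lookup (lookup (\<Prod>j<k. invdiff N j :: 'k::comm_ring_1 laurent2) b) a =
    (if b \<in> poly_exps k \<and> (\<forall>j<k. lookup b j < int N) \<and> a = neg_ones k - b then 1 else 0)"
proof (induction k arbitrary: a b)
  case 0
  have "b \<in> poly_exps 0 \<longleftrightarrow> b = 0"
    by (auto simp: poly_exps_def)
  then show ?case
    by (auto simp: lookup_one when_def neg_ones_def)
next
  case (Suc k)
  define P where "P = (\<Prod>j<k. invdiff N j :: 'k laurent2)"
  define C where "C k b a \<longleftrightarrow> b \<in> poly_exps k \<and> (\<forall>j<k. lookup b j < int N) \<and> a = neg_ones k - b"
    for k b and a :: "nat \<Rightarrow>\<^sub>0 int"
  have C: "C k b a \<longleftrightarrow> (\<forall>j. if j < k then 0 \<le> lookup b j \<and> lookup b j < int N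
      \<and> lookup a j = - 1 - lookup b j
      else lookup b j = 0 \<and> lookup a j = 0)" (is "_ \<longleftrightarrow> (\<forall>j. ?C j)") for k b a
  proof
    assume *: "C k b a"
    show "\<forall>j. ?C j"
    proof
      fix j
      have "j \<notin> keys b" if "\<not> j < k"
        using * that by (auto simp: C_def poly_exps_def)
      then show "?C j"
        using * by (auto simp: C_def poly_exps_def lookup_minus lookup_neg_ones in_keys_iff)
    qed
  next
    assume *: "\<forall>j. ?C j"
    have "keys b \<subseteq> {..<k}"
      using * by (auto simp: in_keys_iff) (meson not_le_imp_less)
    moreover have "0 \<le> lookup b j" for j
      using spec[OF *, of j] by (auto split: if_splits)
    moreover have "a = neg_ones k - b"
    proof (rule poly_mapping_eqI)
      fix j
      show "lookup a j = lookup (neg_ones k - b) j"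
        using spec[OF *, of j] by (auto simp: lookup_minus lookup_neg_ones split: if_splits)
    qed
    ultimately show "C k b a"
      using * by (auto simp: C_def poly_exps_def)
  qed
  \<comment> \<open>In the factor \<open>invdiff N k\<close>, the exponent of \<open>Y\<^sub>k\<close> selects a single summand.\<close>
  have step: "C k (b - single k (int c)) (a - single k (- int c - 1)) \<longleftrightarrow>
      C (Suc k) b a \<and> c = nat (lookup b k)" if "c < N" for c
  proof -
    have "(\<forall>j. P j) \<longleftrightarrow> P k \<and> (\<forall>j. j \<noteq> k \<longrightarrow> P j)" for P :: "nat \<Rightarrow> bool"
      by metis
    note split = this
    show ?thesis
      unfolding C
      apply (subst (1 2) split)
      using that by (auto simp: lookup_minus lookup_single when_def less_Suc_eq split: if_splits)
  qed
  have "lookup (lookup (invdiff N k * P) b) a =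
      (\<Sum>c<N. lookup (lookup P (b - single k (int c)))
         (a - single k (- int c - 1)))"
    by (simp add: invdiff_def sum_distrib_right lookup_sum lookup_single_mult)
  also have "\<dots> = (\<Sum>c<N. if c = nat (lookup b k) then if C (Suc k) b a then 1 else 0 else 0)"
  proof (rule sum.cong[OF refl])
    fix c assume c: "c \<in> {..<N}"
    have "lookup (lookup P (b - single k (int c)))
         (a - single k (- int c - 1)) =
       (if C k (b - single k (int c)) (a - single k (- int c - 1)) then 1 else 0)"
      unfolding P_def C_def by (rule Suc.IH)
    then show "lookup (lookup P (b - single k (int c)))
         (a - single k (- int c - 1)) =
       (if c = nat (lookup b k) then if C (Suc k) b a then 1 else 0 else 0)"
      using step[of c] c by auto
  qed
  also have "\<dots> = (if C (Suc k) b a then 1 else 0)"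
  proof -
    have "nat (lookup b k) < N" if "C (Suc k) b a"
      using that[unfolded C, rule_format, of k] by auto
    then show ?thesis
      by (auto simp: sum.delta)
  qed
  finally show ?case
    by (simp add: P_def C_def mult.commute)
qed

text \<open>
  The Laurent polynomial \<open>\<Sum>b. U(Y\<^sup>b) X\<^sup>-\<^sup>1\<^sup>-\<^sup>b\<close>, in the form in which it appears as the top component of
  the total cocycle. Its class in \<open>H\<^sup>n\<^sub>\<mm>(C)\<close> represents \<open>U\<close> under the residue pairing.
\<close>

definition dual_poly :: "nat \<Rightarrow> nat \<Rightarrow> ((nat \<Rightarrow>\<^sub>0 int) \<Rightarrow> 'k::comm_ring_1) \<Rightarrow> 'k laurent" where
  "dual_poly n N U = pair_Y U (\<Prod>j<n. invdiff N j)"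

lemma lookup_pair_Y: "lookup (pair_Y U P) a =
    (\<Sum>b\<in>keys P. U b * lookup (lookup P b) a)"
  by (simp add: pair_Y_def lookup_sum lookup_const_mult)

lemma lookup_dual_poly:
  assumes U: "dual_coeffs n r f N U"
  shows "lookup (dual_poly n N U) a = U (neg_ones n - a)"
proof -
  define P where "P = (\<Prod>j<n. invdiff N j :: 'a laurent2)"
  have P: "lookup (lookup P b) a =
      (if b \<in> poly_exps n \<and> (\<forall>j<n. lookup b j < int N) \<and> b = neg_ones n - a then 1 else 0)" for b
    unfolding P_def lookup_prod_invdiff by (auto simp: algebra_simps)
  have "lookup (pair_Y U P) a =
      (\<Sum>b\<in>keys P. if b = neg_ones n - a then U (neg_ones n - a) else 0)"
    unfolding lookup_pair_Y
  proof (rule sum.cong[OF refl])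
    fix b
    have "U b = 0" if "\<not> (b \<in> poly_exps n \<and> (\<forall>j<n. lookup b j < int N))"
      using U that unfolding dual_coeffs_def by blast
    then show "U b * lookup (lookup P b) a =
        (if b = neg_ones n - a then U (neg_ones n - a) else 0)"
      unfolding P by auto
  qed
  also have "\<dots> = U (neg_ones n - a)"
  proof -
    have "neg_ones n - a \<in> keys P" if "U (neg_ones n - a) \<noteq> 0"
    proof -
      have "lookup (lookup P (neg_ones n - a)) a = 1"
        using U that unfolding P dual_coeffs_def by simp
      then show ?thesis
        by (auto simp: in_keys_iff)
    qed
    then show ?thesis
      by auto
  qed
  finally show ?thesis
    by (simp add: dual_poly_def P_def)
qed

section \<open>The total cocycle of a linear form\<close>

text \<open>
  The image under \<open>id \<otimes> U\<close> of the total cocycle with components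
  \<open>(\<Prod>j\<in>S. 1/(X\<^sub>j - Y\<^sub>j)) \<epsilon>\<^sub>S\<close> of the Koszul complex of the \<open>X\<^sub>j - Y\<^sub>j\<close>. The signs are forced by the
  conventions for the two differentials up to a global sign, which is chosen to be trivial in the top
  component.
\<close>

definition transgression_cocycle ::
  "nat \<Rightarrow> nat \<Rightarrow> (nat \<Rightarrow> nat \<Rightarrow> 'k laurent2) \<Rightarrow> nat \<Rightarrow> ((nat \<Rightarrow>\<^sub>0 int) \<Rightarrow> 'k::comm_ring_1)
    \<Rightarrow> nat set \<Rightarrow> nat set \<Rightarrow> 'k laurent" where
  "transgression_cocycle n r g N U S T = (if S \<subseteq> {..<n} then
     alt (\<Sum>j\<in>{..<n} - S. n - 1 - j) (pair_Y U ((\<Prod>j\<in>S. invdiff N j) * kcontract r g S n T)) else 0)"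

lemma kcontract_full: "{..<k} \<subseteq> S \<Longrightarrow> kcontract r g S k = kbasis {..<r}"
  by (induction k) (auto simp: lessThan_Suc)

context
  fixes n r N :: nat and f :: "nat \<Rightarrow> 'k::comm_ring_1 laurent"
    and g :: "nat \<Rightarrow> nat \<Rightarrow> 'k laurent2" and U :: "(nat \<Rightarrow>\<^sub>0 int) \<Rightarrow> 'k"
  assumes nr: "n \<le> r"
    and f: "\<And>i. i < r \<Longrightarrow> f i \<in> polys n"
    and g: "\<And>i j. i < r \<Longrightarrow> j < n \<Longrightarrow> g i j \<in> polys2 n"
    and decomp: "\<And>i. i < r \<Longrightarrow> in_X (f i) - in_Y (f i) = (\<Sum>j<n. (in_X (Xvar j) - in_Y (Xvar j)) * g i j)"
    and U: "dual_coeffs n r f N U"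
begin

abbreviation (input) "W \<equiv> transgression_cocycle n r g N U"

lemma kcontract_loc2:
  assumes "S \<subseteq> {..<n}"
  shows "kcontract r g S n \<in> koszul r (card S + (r - n)) (loc2 n S')"
proof -
  have "kcontract r g S n \<in> koszul r (r - n + card (S \<inter> {..<n})) (loc2 n S')"
    using g loc2_mono[of "{}" S' n]
    by (intro kcontract_koszul subgrp_loc2 one_in_loc2 loc2_mult nr) (auto simp: polys2_loc2)
  moreover have "S \<inter> {..<n} = S"
    using assms by auto
  ultimately show ?thesis
    by (simp add: add.commute)
qed

lemma kcontract_in_loc2: "S \<subseteq> {..<n} \<Longrightarrow> kcontract r g S n T \<in> loc2 n S'"
  by (rule koszul_in[OF kcontract_loc2 subgrp_0[OF subgrp_loc2]])

lemma prod_invdiff_in_loc2: "S \<subseteq> S' \<Longrightarrow> S \<subseteq> {..<n} \<Longrightarrow> (\<Prod>j\<in>S. invdiff N j) \<in> loc2 n S'"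
  by (intro loc2_prod invdiff_in_loc2) auto

lemma transgression_cocycle_total: "W \<in> total n r (r - n)"
proof -
  have "W S \<in> koszul r (card S + (r - n)) (loc n S)" if S: "S \<subseteq> {..<n}" for S
  proof (rule koszulI)
    fix T
    show "W S T \<in> loc n S"
      using S unfolding transgression_cocycle_def
      by (auto intro!: subgrp_alt subgrp_loc pair_Y_in_loc loc2_mult prod_invdiff_in_loc2 kcontract_in_loc2)
    assume "\<not> (T \<subseteq> {..<r} \<and> card T = card S + (r - n))"
    then show "W S T = 0"
      using koszul_zero[OF kcontract_loc2[OF S]]
      by (simp add: transgression_cocycle_def additive.zero[OF additive_pair_Y])
  qed
  moreover have "W S = 0" if "\<not> S \<subseteq> {..<n}" for S
    using that by (simp add: transgression_cocycle_def fun_eq_iff)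
  ultimately show ?thesis
    by (simp add: total_def)
qed

text \<open>
  Under \<open>id \<otimes> U\<close>, multiplication by \<open>f\<^sub>i\<close> comes from multiplication by \<open>f\<^sub>i(X) - f\<^sub>i(Y)\<close>, because \<open>U\<close>
  vanishes on the ideal of the \<open>f\<^sub>i\<close>. The decomposition turns the Koszul differential into the sum of
  \<open>X\<^sub>j - Y\<^sub>j\<close> times the contraction by the form \<open>j\<close>; this contraction is zero for \<open>j \<notin> S\<close>, while for
  \<open>j \<in> S\<close> the factor \<open>X\<^sub>j - Y\<^sub>j\<close> cancels \<open>1/(X\<^sub>j - Y\<^sub>j)\<close>.
\<close>

lemma kdiff_transgression_cocycle:
  assumes S: "S \<subseteq> {..<n}"
  shows "kdiff r f (W S) T = (\<Sum>j\<in>S. alt (card {i \<in> S. j < i}) (W (S - {j}) T))"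
proof -
  define e where "e S = (\<Sum>j\<in>{..<n} - S. n - 1 - j)" for S
  define \<phi> where "\<phi> P = alt (e S) (pair_Y U ((\<Prod>j\<in>S. invdiff N j) * P))" for P
  define F where "F i = in_X (f i) - in_Y (f i)" for i
  have finS: "finite S"
    using S finite_subset by blast
  have add: "additive \<phi>"
    by (simp add: \<phi>_def additive_def distrib_left alt_add additive.add[OF additive_pair_Y])
  have "kdiff r f (\<lambda>T. \<phi> (kcontract r g S n T)) T = \<phi> (kdiff r F (kcontract r g S n) T)"
  proof (rule kdiff_map[where M="loc2 n S"])
    fix i and x :: "'k laurent2" assume i: "i < r" and x: "x \<in> loc2 n S"
    have "(\<Prod>j\<in>S. invdiff N j) * (F i * x) =
        in_X (f i) * ((\<Prod>j\<in>S. invdiff N j) * x) - in_Y (f i) * ((\<Prod>j\<in>S. invdiff N j) * x)"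
      by (simp add: F_def algebra_simps)
    moreover have "pair_Y U (in_Y (f i) * ((\<Prod>j\<in>S. invdiff N j) * x)) = 0"
      using S x by (intro pair_Y_in_Y_zero[OF U i] loc2_mult prod_invdiff_in_loc2) auto
    ultimately show "\<phi> (F i * x) = f i * \<phi> x"
      by (simp add: \<phi>_def additive.diff[OF additive_pair_Y] pair_Y_in_X alt_mult_right)
  qed (use add kcontract_in_loc2[OF S] in auto)
  moreover have "(\<lambda>T. \<phi> (kcontract r g S n T)) = W S"
    using S by (auto simp: transgression_cocycle_def \<phi>_def e_def)
  ultimately have "kdiff r f (W S) T = \<phi> (kdiff r F (kcontract r g S n) T)"
    by simp
  also have "kdiff r F (kcontract r g S n) =
      kdiff r (\<lambda>i. \<Sum>j<n. (in_X (Xvar j) - in_Y (Xvar j)) * g i j) (kcontract r g S n)"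
    by (rule kdiff_cong) (simp add: F_def decomp)
  also have "\<phi> (\<dots> T) = (\<Sum>j<n. \<phi> ((in_X (Xvar j) - in_Y (Xvar j)) *
      kdiff r (\<lambda>i. g i j) (kcontract r g S n) T))"
    by (simp add: kdiff_seq_sum additive.sum[OF add])
  also have "\<dots> = (\<Sum>j<n. if j \<in> S then alt (card {i \<in> S. j < i}) (W (S - {j}) T) else 0)"
  proof (rule sum.cong[OF refl])
    fix j assume "j \<in> {..<n}"
    then have j: "j < n"
      by simp
    define c where "c = card {i. j < i \<and> i < n \<and> i \<notin> S}"
    show "\<phi> ((in_X (Xvar j) - in_Y (Xvar j)) * kdiff r (\<lambda>i. g i j) (kcontract r g S n) T) =
        (if j \<in> S then alt (card {i \<in> S. j < i}) (W (S - {j}) T) else 0)"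
    proof (cases "j \<in> S")
      case True
      define Q where "Q = (\<Prod>j\<in>S - {j}. invdiff N j) * kcontract r g (S - {j}) n T"
      have Q: "Q \<in> loc2 n S"
        unfolding Q_def using S by (intro loc2_mult prod_invdiff_in_loc2 kcontract_in_loc2) auto
      have "\<phi> ((in_X (Xvar j) - in_Y (Xvar j)) * kdiff r (\<lambda>i. g i j) (kcontract r g S n) T) =
          alt c (\<phi> ((in_X (Xvar j) - in_Y (Xvar j)) * kcontract r g (S - {j}) n T))"
        using True by (simp add: kdiff_kcontract[OF j] c_def alt_apply alt_mult_right additive_alt[OF add])
      also have "\<phi> ((in_X (Xvar j) - in_Y (Xvar j)) * kcontract r g (S - {j}) n T) =
          alt (e S) (pair_Y U ((in_X (Xvar j) - in_Y (Xvar j)) * (invdiff N j * Q)))"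
        using prod.remove[OF finS True, of "invdiff N :: nat \<Rightarrow> 'k laurent2"]
        by (simp add: \<phi>_def Q_def ac_simps)
      also have "\<dots> = alt (e S) (pair_Y U Q)"
        by (simp only: pair_Y_mult_invdiff[OF U j Q])
      also have "pair_Y U Q = alt (e (S - {j})) (W (S - {j}) T)"
        using S by (auto simp: transgression_cocycle_def Q_def e_def alt_alt alt_def)
      also have "alt c (alt (e S) (alt (e (S - {j})) (W (S - {j}) T))) =
          alt (card {i \<in> S. j < i}) (W (S - {j}) T)"
      proof -
        have "{..<n} - (S - {j}) = insert j ({..<n} - S)"
          using j by auto
        then have e: "e (S - {j}) = (n - 1 - j) + e S"
          using True by (simp add: e_def)
        \<comment> \<open>The sign \<open>n - 1 - j\<close> of the cocycle and the sign \<open>c\<close> of the contraction leave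
          the number of the elements of \<open>S\<close> above \<open>j\<close>.\<close>
        have "{j<..<n} = {i. j < i \<and> i < n \<and> i \<notin> S} \<union> {i \<in> S. j < i}"
          using S by auto
        then have "card {j<..<n} = c + card {i \<in> S. j < i}"
          unfolding c_def by (simp only:) (intro card_Un_disjoint, use finS in auto)
        then have "n - 1 - j = c + card {i \<in> S. j < i}"
          using j by simp
        then show ?thesis
          unfolding alt_alt e by (intro alt_cong) auto
      qed
      finally show ?thesis
        using True by simp
    qed (simp add: kdiff_kcontract[OF j] additive.zero[OF add])
  qed
  also have "\<dots> = (\<Sum>j\<in>S. alt (card {i \<in> S. j < i}) (W (S - {j}) T))"
  proof -
    have "{..<n} \<inter> S = S"
      using S by auto
    then show ?thesis
      by (simp add: sum.inter_restrict[symmetric])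
  qed
  finally show ?thesis .
qed

lemma tdiff_transgression_cocycle: "tdiff n r f W = 0"
proof (rule ext, rule ext)
  fix S T
  show "tdiff n r f W S T = 0 S T"
  proof (cases "S \<subseteq> {..<n}")
    case True
    then have finS: "finite S"
      using finite_subset by blast
    have "tdiff n r f W S T = cdiff n W S T + alt (card S) (kdiff r f (W S) T)"
      by (simp add: tdiff_def alt_apply)
    also have "\<dots> = (\<Sum>j\<in>S. alt (card {i \<in> S. i < j}) (W (S - {j}) T) +
        alt (card S) (alt (card {i \<in> S. j < i}) (W (S - {j}) T)))"
      using True unfolding cdiff_apply
      by (simp add: cdiff_def kdiff_transgression_cocycle alt_sum sum.distrib)
    also have "\<dots> = 0"
    proof (rule sum.neutral, rule ballI)
      fix j assume j: "j \<in> S"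
      \<comment> \<open>The numbers of elements of \<open>S\<close> below and above \<open>j\<close> add up to \<open>card S - 1\<close>, whence the
        opposite signs.\<close>
      have "S = insert j ({i \<in> S. i < j} \<union> {i \<in> S. j < i})"
        using j by auto
      then have "card S = card (insert j ({i \<in> S. i < j} \<union> {i \<in> S. j < i}))"
        by simp
      also have "\<dots> = Suc (card {i \<in> S. i < j} + card {i \<in> S. j < i})"
        using finS by (subst card_insert_disjoint) (auto intro!: card_Un_disjoint)
      finally have "alt (card S) (alt (card {i \<in> S. j < i}) (W (S - {j}) T)) =
          - alt (card {i \<in> S. i < j}) (W (S - {j}) T)"
        unfolding alt_alt alt_Suc[symmetric] by (intro alt_cong) auto
      then show "alt (card {i \<in> S. i < j}) (W (S - {j}) T) +
          alt (card S) (alt (card {i \<in> S. j < i}) (W (S - {j}) T)) = 0"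
        by simp
    qed
    finally show ?thesis
      by simp
  next
    case False
    then have "W S = 0"
      by (rule total_zero[OF transgression_cocycle_total])
    then show ?thesis
      using False by (simp add: tdiff_def cdiff_def kdiff_0)
  qed
qed

lemma transgression_cocycle_empty:
  "W {} = (\<lambda>T. alt (\<Sum>j<n. n - 1 - j) (pair_Y U (kcontract r g {} n T)))"
  by (simp add: transgression_cocycle_def fun_eq_iff)

text \<open>
  Top and bottom component of the cocycle: the transgression of the class that represents \<open>U\<close> is,
  up to a sign that depends only on \<open>n\<close>, the image of the Morley form under \<open>id \<otimes> U\<close>.
\<close>

lemma tau0_dual_poly:
  assumes "1 \<le> n"
  shows "tau0 n r f (Hn_class n (dual_poly n N U)) =
    (\<lambda>T. alt (\<Sum>j<n. n - 1 - j) (pair_Y U (kcontract r g {} n T))) +o kboundsC n r f (r - n)"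
  unfolding transgression_cocycle_empty[symmetric]
proof (rule tau0_eqI[OF assms nr f transgression_cocycle_total tdiff_transgression_cocycle])
  show "W {..<n} = (\<lambda>T. dual_poly n N U * kbasis {..<r} T)"
    by (rule ext) (simp add: transgression_cocycle_def kcontract_full kbasis_def dual_poly_def
      additive.zero[OF additive_pair_Y])
qed

lemma pair_Y_kcontract_koszul: "(\<lambda>T. pair_Y U (kcontract r g {} n T)) \<in> koszul r (r - n) (polys n)"
proof -
  have "kcontract r g {} n \<in> koszul r (r - n) (loc2 n {})"
    using kcontract_loc2[of "{}"] by simp
  then show ?thesis
    by (intro koszulI) (auto simp: koszul_zero additive.zero[OF additive_pair_Y] intro: pair_Y_in_loc koszulD)
qed

lemma kdiff_pair_Y_kcontract: "kdiff r f (\<lambda>T. pair_Y U (kcontract r g {} n T)) = 0"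
proof -
  have "kdiff r f (W {}) = 0"
    by (rule ext) (simp add: kdiff_transgression_cocycle)
  moreover have "W {} = alt (\<Sum>j<n. n - 1 - j) (\<lambda>T. pair_Y U (kcontract r g {} n T))"
    by (simp add: transgression_cocycle_empty fun_eq_iff alt_apply)
  ultimately have "alt (\<Sum>j<n. n - 1 - j) (kdiff r f (\<lambda>T. pair_Y U (kcontract r g {} n T))) = 0"
    by (simp add: kdiff_alt)
  then show ?thesis
    by (simp add: alt_def split: if_splits)
qed

text \<open>
  In Cech degree 1 the cocycle condition says that the bottom component becomes a Koszul boundary once
  \<open>X\<^sub>j\<close> is inverted. The boundary is taken of a chain with denominators at most the power \<open>N\<close> of \<open>X\<^sub>j\<close>.
\<close>

lemma pair_Y_kcontract_torsion:
  assumes j: "j < n"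
  shows "(\<lambda>T. single (single j (int N)) 1 * pair_Y U (kcontract r g {} n T))
    \<in> kdiff r f ` koszul r (r - n + 1) (polys n)"
proof -
  define x where "x = single (single j (int N)) (1::'k)"
  define s where "s = (\<Sum>j<n. n - 1 - j)"
  define v where "v T = alt s (x * W {j} T)" for T
  have "kdiff r f v T = x * pair_Y U (kcontract r g {} n T)" for T
  proof -
    have "kdiff r f (W {j}) T = alt (card {i \<in> {j}. j < i}) (W ({j} - {j}) T)"
      using j by (subst kdiff_transgression_cocycle) auto
    moreover have "{i \<in> {j}. j < i} = {}"
      by auto
    ultimately have "kdiff r f (W {j}) T = W {} T"
      by (simp only: card.empty alt_0_left Diff_cancel)
    moreover have "v = alt s (\<lambda>T. x * W {j} T)"
      by (simp add: v_def fun_eq_iff alt_apply)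
    ultimately show ?thesis
      by (simp add: kdiff_alt alt_apply kdiff_mult transgression_cocycle_empty s_def alt_mult_right alt_alt)
        (simp add: alt_def)
  qed
  moreover have "v \<in> koszul r (r - n + 1) (polys n)"
  proof -
    have W: "W {j} \<in> koszul r (card {j} + (r - n)) (loc n {j})"
      using j by (intro totalD[OF transgression_cocycle_total]) auto
    have "in_X x * invdiff N j \<in> loc2 n {}"
      unfolding invdiff_def in_X_def x_def sum_distrib_left
    proof (rule subgrp_sum[OF subgrp_loc2])
      fix a assume "a \<in> {..<N}"
      then show "single 0 (single (single j (int N)) 1) *
         single (single j (int a))
          (single (single j (- int a - 1)) (1::'k)) \<in> loc2 n {}"
        unfolding mult_single single_add[symmetric] using j
        by (auto intro!: single_in_loc2 poly_exps_single simp: polys_iff lookup_single when_def split: if_splits)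
    qed
    then have "pair_Y U (in_X x * invdiff N j * kcontract r g {j} n T) \<in> polys n" for T
      by (rule pair_Y_in_loc[OF loc2_mult[OF _ kcontract_in_loc2]]) (use j in auto)
    then have "x * W {j} T \<in> polys n" for T
      using j by (simp add: transgression_cocycle_def alt_mult_right subgrp_alt[OF subgrp_loc] mult.assoc pair_Y_in_X)
    then show ?thesis
      unfolding v_def using koszul_zero[OF W] by (intro koszulI) (auto intro: subgrp_alt[OF subgrp_loc])
  qed
  ultimately show ?thesis
    unfolding x_def[symmetric] by (intro image_eqI[of _ _ v]) auto
qed

end

section \<open>The Morley form as an iterated contraction\<close>

lemma strict_mono_on_ge:
  fixes u :: "nat \<Rightarrow> nat"
  assumes u: "strict_mono_on {..<k} u"
  shows "a < k \<Longrightarrow> a \<le> u a"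
proof (induction a)
  case (Suc a)
  then have "u a < u (Suc a)"
    using u by (simp add: strict_mono_on_def)
  then show ?case
    using Suc by simp
qed simp

text \<open>
  The sign of a contraction counts the indices below \<open>u p\<close> that are still present. When an increasing
  sequence \<open>u\<close> has been removed, \<open>u p - p\<close> of them are left.
\<close>

lemma card_below_complement:
  fixes u :: "nat \<Rightarrow> nat"
  assumes u: "strict_mono_on {..<k} u" and ur: "u ` {..<k} \<subseteq> {..<r}" and p: "p < k"
  shows "card {j \<in> {..<r} - u ` {..<k}. j < u p} + p = u p"
proof -
  have mono: "u a < u b \<longleftrightarrow> a < b" if "a < k" "b < k" for a b
    using strict_mono_on_less[OF u] that by simp
  have up: "u p < r"
    using p ur by auto
  have "{j \<in> {..<r} - u ` {..<k}. j < u p} = {..<u p} - u ` {..<p}"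
    using p up by (auto simp: mono)
  moreover have sub: "u ` {..<p} \<subseteq> {..<u p}"
    using p by (auto simp: mono)
  moreover have "card (u ` {..<p}) = p"
    using p inj_on_subset[OF strict_mono_on_imp_inj_on[OF u], of "{..<p}"] by (simp add: card_image)
  ultimately have "card {j \<in> {..<r} - u ` {..<k}. j < u p} = u p - p"
    by (simp add: card_Diff_subset)
  then show ?thesis
    using strict_mono_on_ge[OF u p] by simp
qed

text \<open>
  The last contraction is the Laplace expansion along the last column. The sign of the shuffle
  that starts with \<open>u\<close> appears here as the parity of \<open>\<Sum>a<k. u a - a\<close>, written with \<open>+\<close> instead of \<open>-\<close>.
\<close>

lemma kcontract_eq_det:
  fixes g :: "nat \<Rightarrow> nat \<Rightarrow> 'a::comm_ring_1"
  assumes "strict_mono_on {..<k} u" and "u ` {..<k} \<subseteq> {..<r}"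
  shows "kcontract r g {} k ({..<r} - u ` {..<k}) =
    alt (\<Sum>a<k. u a + a) (det (mat k k (\<lambda>(a, b). g (u a) b)))"
  using assms
proof (induction k arbitrary: u)
  case 0
  then show ?case
    by (simp add: kbasis_def)
next
  case (Suc k)
  note u = Suc.prems(1) and ur = Suc.prems(2)
  have inj: "inj_on u {..<Suc k}"
    by (rule strict_mono_on_imp_inj_on[OF u])
  define A where "A = mat (Suc k) (Suc k) (\<lambda>(a, b). g (u a) b)"
  define T where "T = {..<r} - u ` {..<Suc k}"
  define c where "c p = card {j \<in> T. j < u p}" for p
  have c: "c p + p = u p" if "p < Suc k" for p
    unfolding c_def T_def by (rule card_below_complement[OF u ur that])
  have step: "kcontract r g {} k (insert (u p) T) =
      alt (\<Sum>a<k. u (insert_index p a) + a) (det (mat_delete A p k))" if p: "p < Suc k" for p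
  proof -
    have ii: "insert_index p ` {..<k} = {..<Suc k} - {p}"
      using insert_index_image[OF p] by (simp add: atLeast0LessThan)
    then have lt: "insert_index p a < Suc k" if "a < k" for a
      using that by blast
    have "strict_mono_on {..<k} (u \<circ> insert_index p)"
    proof (rule strict_mono_onI)
      fix a b assume "a \<in> {..<k}" "b \<in> {..<k}" "a < b"
      then show "(u \<circ> insert_index p) a < (u \<circ> insert_index p) b"
        using lt by (simp add: strict_mono_on_less[OF u]) (simp add: insert_index_def)
    qed
    moreover have im: "(u \<circ> insert_index p) ` {..<k} = u ` {..<Suc k} - {u p}"
      unfolding image_comp[symmetric] ii using p inj by (auto simp: inj_on_def)
    ultimately have "kcontract r g {} k ({..<r} - (u \<circ> insert_index p) ` {..<k}) =
        alt (\<Sum>a<k. (u \<circ> insert_index p) a + a)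
          (det (mat k k (\<lambda>(a, b). g ((u \<circ> insert_index p) a) b)))"
      using ur by (intro Suc.IH) (auto simp: o_def)
    moreover have "{..<r} - (u \<circ> insert_index p) ` {..<k} = insert (u p) T"
      unfolding im T_def using ur p by auto
    moreover have "mat k k (\<lambda>(a, b). g ((u \<circ> insert_index p) a) b) = mat_delete A p k"
      by (rule eq_matI) (auto simp: mat_delete_def A_def insert_index_def)
    ultimately show ?thesis
      by simp
  qed
  have "kcontract r g {} (Suc k) T =
      (\<Sum>i\<in>u ` {..<Suc k}. alt (card {j \<in> T. j < i}) (g i k * kcontract r g {} k (insert i T)))"
  proof -
    have "{..<r} - T = u ` {..<Suc k}"
      using ur by (auto simp: T_def)
    then show ?thesis
      by (simp add: kdiff_def)
  qed
  also have "\<dots> = (\<Sum>p<Suc k. alt (c p) (g (u p) k * kcontract r g {} k (insert (u p) T)))"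
    by (subst sum.reindex[OF inj]) (simp add: c_def)
  also have "\<dots> = (\<Sum>p<Suc k. alt (\<Sum>a<Suc k. u a + a) (A $$ (p, k) * cofactor A p k))"
  proof (rule sum.cong[OF refl])
    fix p assume "p \<in> {..<Suc k}"
    then have p: "p < Suc k"
      by simp
    have "(\<Sum>a<Suc k. u a) = u p + (\<Sum>a\<in>{..<Suc k} - {p}. u a)"
      using p by (intro sum.remove) auto
    also have "{..<Suc k} - {p} = insert_index p ` {..<k}"
      using insert_index_image[OF p] by (simp add: atLeast0LessThan)
    also have "(\<Sum>a\<in>insert_index p ` {..<k}. u a) = (\<Sum>a<k. u (insert_index p a))"
      by (subst sum.reindex[OF insert_index_inj_on]) simp
    finally have "(\<Sum>a<Suc k. u a + a) = u p + (\<Sum>a<k. u (insert_index p a) + a) + k"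
      by (simp add: sum.distrib)
    also have "u p = c p + p"
      by (rule c[OF p, symmetric])
    finally have s: "(\<Sum>a<Suc k. u a + a) = c p + (\<Sum>a<k. u (insert_index p a) + a) + (p + k)"
      by simp
    have "cofactor A p k = alt (p + k) (det (mat_delete A p k))"
      by (simp add: cofactor_def alt_def)
    moreover have "A $$ (p, k) = g (u p) k"
      using p by (simp add: A_def)
    ultimately show "alt (c p) (g (u p) k * kcontract r g {} k (insert (u p) T)) =
        alt (\<Sum>a<Suc k. u a + a) (A $$ (p, k) * cofactor A p k)"
      unfolding s step[OF p] by (simp only: alt_mult_right alt_alt) (rule alt_cong, auto)
  qed
  also have "\<dots> = alt (\<Sum>a<Suc k. u a + a) (det A)"
  proof -
    have "det A = (\<Sum>p<Suc k. A $$ (p, k) * cofactor A p k)"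
      by (rule laplace_expansion_column) (simp_all add: A_def)
    then show ?thesis
      by (simp only: alt_sum)
  qed
  finally show ?case
    by (simp add: T_def A_def)
qed

lemma kdiff_delta_kbasis:
  assumes "c \<in> V" and "c < r"
  shows "kdiff r (\<lambda>i. if i = c then 1 else 0) (kbasis V) =
    alt (card {j \<in> V. j < c}) (kbasis (V - {c}) :: nat set \<Rightarrow> 'a::comm_ring_1)"
proof
  fix T
  have "kdiff r (\<lambda>i. if i = c then 1 else 0) (kbasis V) T =
      (\<Sum>i\<in>{..<r} - T. if i = c then alt (card {j \<in> T. j < c}) (kbasis V (insert c T)) else (0::'a))"
    unfolding kdiff_def by (intro sum.cong) auto
  also have "\<dots> = (if c \<notin> T then alt (card {j \<in> T. j < c}) (kbasis V (insert c T)) else 0)"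
    using assms by simp
  also have "\<dots> = alt (card {j \<in> V. j < c}) (kbasis (V - {c}) T)"
  proof (cases "T = V - {c}")
    case True
    moreover have "{j \<in> V - {c}. j < c} = {j \<in> V. j < c}"
      by auto
    ultimately show ?thesis
      using assms by (simp add: kbasis_def insert_absorb)
  next
    case False
    then have "\<not> (c \<notin> T \<and> insert c T = V)"
      by auto
    then show ?thesis
      using False by (auto simp: kbasis_def)
  qed
  finally show "kdiff r (\<lambda>i. if i = c then 1 else 0) (kbasis V) T =
    alt (card {j \<in> V. j < c}) (kbasis (V - {c}) :: nat set \<Rightarrow> 'a) T"
    by (simp add: alt_apply)
qed

text \<open>
  Removing the basis vectors \<open>e\<^bsub>\<sigma> 0\<^esub>, e\<^bsub>\<sigma> 1\<^esub>, \<dots>\<close> one after the other collects one sign for each inversion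
  of \<open>\<sigma>\<close>.
\<close>

lemma kcontract_permutation:
  fixes \<sigma> :: "nat \<Rightarrow> nat"
  assumes \<sigma>: "\<sigma> permutes {..<r}" and "k \<le> r"
  shows "kcontract r (\<lambda>i b. if i = \<sigma> b then 1 else 0) {} k =
    alt (\<Sum>b<k. card {j \<in> {..<r} - \<sigma> ` {..<b}. j < \<sigma> b})
      (kbasis ({..<r} - \<sigma> ` {..<k}) :: nat set \<Rightarrow> 'a::comm_ring_1)"
  using \<open>k \<le> r\<close>
proof (induction k)
  case (Suc k)
  let ?g = "\<lambda>i b. if i = \<sigma> b then 1 else 0 :: 'a"
  define e where "e b = card {j \<in> {..<r} - \<sigma> ` {..<b}. j < \<sigma> b}" for b
  have k: "\<sigma> k < r" "\<sigma> k \<notin> \<sigma> ` {..<k}"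
    using permutes_in_image[OF \<sigma>, of k] Suc.prems permutes_inj[OF \<sigma>] by (auto simp: inj_def)
  have "kcontract r ?g {} (Suc k) = kdiff r (\<lambda>i. ?g i k) (alt (\<Sum>b<k. e b) (kbasis ({..<r} - \<sigma> ` {..<k})))"
    using Suc by (simp add: e_def)
  also have "\<dots> = alt (\<Sum>b<k. e b) (alt (e k) (kbasis ({..<r} - \<sigma> ` {..<k} - {\<sigma> k})))"
    unfolding e_def using k by (simp add: kdiff_alt kdiff_delta_kbasis)
  also have "{..<r} - \<sigma> ` {..<k} - {\<sigma> k} = {..<r} - \<sigma> ` {..<Suc k}"
    by (auto simp: lessThan_Suc)
  finally show ?case
    by (simp add: alt_alt e_def)
qed simp

text \<open>
  Contracting by all columns of the permutation matrix in two ways, as its determinant and one basis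
  vector after the other.
\<close>

lemma sign_eq_inversions:
  fixes \<sigma> :: "nat \<Rightarrow> nat"
  assumes \<sigma>: "\<sigma> permutes {..<r}"
  shows "sign \<sigma> = alt (\<Sum>b<r. card {j \<in> {..<r} - \<sigma> ` {..<b}. j < \<sigma> b}) 1"
proof -
  define g where "g i b = (if i = \<sigma> b then 1 else 0 :: int)" for i b
  define e where "e b = card {j \<in> {..<r} - \<sigma> ` {..<b}. j < \<sigma> b}" for b
  have "kcontract r g {} r = alt (\<Sum>b<r. e b) (kbasis ({..<r} - \<sigma> ` {..<r}))"
    unfolding g_def e_def by (rule kcontract_permutation[OF \<sigma>]) simp
  then have "kcontract r g {} r {} = alt (\<Sum>b<r. e b) 1"
    using permutes_image[OF \<sigma>] by (simp add: alt_apply kbasis_def)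
  moreover have "kcontract r g {} r ({..<r} - (\<lambda>a. a) ` {..<r}) =
      alt (\<Sum>a<r. a + a) (det (mat r r (\<lambda>(a, b). g a b)))"
    by (rule kcontract_eq_det) (auto simp: strict_mono_on_def)
  moreover have "even (\<Sum>a<r. a + a)"
    by (rule dvd_sum) simp
  moreover have "det (mat r r (\<lambda>(a, b). g a b)) = sign \<sigma>"
  proof -
    have \<sigma>': "\<sigma> permutes {0..<r}"
      using \<sigma> by (simp add: atLeast0LessThan)
    define P where "P = mat r r (\<lambda>(i, j). (1\<^sub>m r :: int mat) $$ (\<sigma> i, j))"
    have "det P = sign \<sigma> * det (1\<^sub>m r :: int mat)"
      unfolding P_def by (subst det_permute_rows[OF _ \<sigma>']) auto
    then have "det P = sign \<sigma>"
      by (simp add: det_one)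
    moreover have "mat r r (\<lambda>(a, b). g a b) = transpose_mat P"
      using permutes_in_image[OF \<sigma>'] by (intro eq_matI) (auto simp: P_def g_def)
    moreover have "P \<in> carrier_mat r r"
      by (simp add: P_def)
    ultimately show ?thesis
      by (simp add: det_transpose)
  qed
  ultimately show ?thesis
    by (simp add: e_def alt_def)
qed

text \<open>
  As a shuffle is increasing on both blocks, counting at each index \<open>b\<close> the later values below \<open>\<sigma> b\<close>
  gives \<open>\<sigma> b - b\<close> for \<open>b < n\<close> and nothing for \<open>b \<ge> n\<close>.
\<close>

lemma sign_shuffle:
  assumes "n \<le> r" and \<sigma>: "\<sigma> \<in> shuffle_perms n r"
  shows "sign \<sigma> = alt (\<Sum>a<n. \<sigma> a + a) 1"
proof -
  have p: "\<sigma> permutes {..<r}" and mono1: "strict_mono_on {..<n} \<sigma>" and mono2: "strict_mono_on {n..<r} \<sigma>"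
    using \<sigma> by (auto simp: shuffle_perms_def)
  define e where "e b = card {j \<in> {..<r} - \<sigma> ` {..<b}. j < \<sigma> b}" for b
  have e1: "e b + b = \<sigma> b" if b: "b < n" for b
  proof -
    have mono: "strict_mono_on {..<Suc b} \<sigma>"
      using mono1 b by (auto simp: strict_mono_on_def)
    have "\<sigma> ` {..<Suc b} \<subseteq> {..<r}"
      using image_mono[of "{..<Suc b}" "{..<r}" \<sigma>] permutes_image[OF p] b assms(1) by simp
    from card_below_complement[OF mono this, of b]
    have "card {j \<in> {..<r} - \<sigma> ` {..<Suc b}. j < \<sigma> b} + b = \<sigma> b"
      by simp
    moreover have "{j \<in> {..<r} - \<sigma> ` {..<Suc b}. j < \<sigma> b} = {j \<in> {..<r} - \<sigma> ` {..<b}. j < \<sigma> b}"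
      by (auto simp: lessThan_Suc)
    ultimately show ?thesis
      by (simp add: e_def)
  qed
  have e2: "e b = 0" if b: "n \<le> b" "b < r" for b
  proof -
    have "j \<in> \<sigma> ` {..<b}" if "j < r" "j < \<sigma> b" for j
    proof -
      have "j \<in> \<sigma> ` {..<r}"
        using permutes_image[OF p] that(1) by simp
      then obtain c where c: "c < r" "j = \<sigma> c"
        by auto
      have "c < b"
      proof (rule ccontr)
        assume "\<not> c < b"
        then have "\<sigma> b \<le> \<sigma> c"
          using strict_mono_on_leD[OF mono2, of b c] b c(1) by simp
        then show False
          using that(2) unfolding c(2) by simp
      qed
      then show ?thesis
        using c by auto
    qed
    then have "{j \<in> {..<r} - \<sigma> ` {..<b}. j < \<sigma> b} = {}"
      by auto
    then show ?thesis
      by (simp add: e_def)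
  qed
  have "(\<Sum>b<r. e b) = (\<Sum>b<n. e b)"
    using assms(1) e2 by (intro sum.mono_neutral_right) auto
  moreover have "(\<Sum>a<n. \<sigma> a + a) = (\<Sum>b<n. e b) + 2 * (\<Sum>b<n. b)"
  proof -
    have "(\<Sum>a<n. \<sigma> a + a) = (\<Sum>a<n. e a + 2 * a)"
      by (rule sum.cong) (simp_all add: e1[symmetric])
    then show ?thesis
      by (simp add: sum.distrib sum_distrib_left)
  qed
  ultimately have "even (\<Sum>b<r. e b) \<longleftrightarrow> even (\<Sum>a<n. \<sigma> a + a)"
    by simp
  then show ?thesis
    unfolding sign_eq_inversions[OF p] e_def[symmetric] by (rule alt_cong)
qed

text \<open>
  A shuffle is determined by the set of its last \<open>r - n\<close> values, since it is increasing on both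
  blocks. Each coefficient of the Morley form is therefore a single signed minor.
\<close>

lemma shuffle_unique:
  assumes nr: "n \<le> r" and \<sigma>: "\<sigma> \<in> shuffle_perms n r" and \<tau>: "\<tau> \<in> shuffle_perms n r"
    and eq: "\<sigma> ` {n..<r} = \<tau> ` {n..<r}"
  shows "\<sigma> = \<tau>"
proof
  fix i
  have p: "\<sigma> permutes {..<r}" "\<tau> permutes {..<r}"
    using \<sigma> \<tau> by (auto simp: shuffle_perms_def)
  have im: "\<rho> ` {..<n} = {..<r} - \<rho> ` {n..<r}" if "\<rho> permutes {..<r}" for \<rho>
  proof -
    have "{..<n} = {..<r} - {n..<r}"
      using nr by auto
    then have "\<rho> ` {..<n} = \<rho> ` {..<r} - \<rho> ` {n..<r}"
      using image_set_diff[OF permutes_inj[OF that]] by metis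
    then show ?thesis
      by (simp add: permutes_image[OF that])
  qed
  have strict: "sorted_wrt (<) (map \<rho> [a..<b])" if "strict_mono_on {a..<b} \<rho>" for a b and \<rho> :: "nat \<Rightarrow> nat"
    by (auto simp: sorted_wrt_iff_nth_less intro!: strict_mono_onD[OF that])
  have "map \<tau> [0..<n] = map \<sigma> [0..<n]"
    using \<sigma> \<tau> eq im[OF p(1)] im[OF p(2)]
    by (intro strict_sorted_equal strict) (auto simp: shuffle_perms_def atLeast0LessThan)
  moreover have "map \<tau> [n..<r] = map \<sigma> [n..<r]"
    using \<sigma> \<tau> eq by (intro strict_sorted_equal strict) (auto simp: shuffle_perms_def)
  moreover have "\<sigma> i = i" "\<tau> i = i" if "\<not> i < r"
    using p that by (auto intro: permutes_not_in)
  ultimately show "\<sigma> i = \<tau> i"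
    by (cases "i < n"; cases "i < r") auto
qed

lemma shuffle_exists:
  assumes nr: "n \<le> r" and T: "T \<subseteq> {..<r}" "card T = r - n"
  shows "\<exists>\<sigma>\<in>shuffle_perms n r. \<sigma> ` {n..<r} = T"
proof -
  define xs where "xs = sorted_list_of_set ({..<r} - T)"
  define ys where "ys = sorted_list_of_set T"
  define \<sigma> where "\<sigma> i = (if i < r then (xs @ ys) ! i else i)" for i
  have finT: "finite T"
    using T finite_subset by blast
  have xs: "length xs = n" "set xs = {..<r} - T" "sorted_wrt (<) xs" "distinct xs"
    using T nr finT by (auto simp: xs_def card_Diff_subset)
  have ys: "length ys = r - n" "set ys = T" "sorted_wrt (<) ys" "distinct ys"
    using T finT by (auto simp: ys_def)
  have "bij_betw ((!) (xs @ ys)) {..<r} {..<r}"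
    using xs ys nr T by (intro bij_betw_nth) auto
  then have "bij_betw \<sigma> {..<r} {..<r}"
    by (rule bij_betw_cong[THEN iffD1, rotated]) (simp add: \<sigma>_def)
  then have "\<sigma> permutes {..<r}"
    by (rule bij_imp_permutes) (simp add: \<sigma>_def)
  moreover have "strict_mono_on {..<n} \<sigma>"
    using xs nr by (auto simp: strict_mono_on_def \<sigma>_def nth_append sorted_wrt_iff_nth_less)
  moreover have "strict_mono_on {n..<r} \<sigma>"
    using xs ys nr by (auto simp: strict_mono_on_def \<sigma>_def nth_append sorted_wrt_iff_nth_less)
  moreover have "\<sigma> ` {n..<r} = T"
  proof -
    have "\<sigma> ` {n..<r} = (\<lambda>i. ys ! (i - n)) ` {n..<r}"
      using xs by (intro image_cong) (auto simp: \<sigma>_def nth_append)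
    also have "\<dots> = (!) ys ` {..<r - n}"
    proof -
      have "(\<lambda>i. i - n) ` {n..<r} = {..<r - n}"
        using nr by (cases "n < r") (simp_all add: image_minus_const_atLeastLessThan_nat atLeast0LessThan)
      then have "(!) ys ` ((\<lambda>i. i - n) ` {n..<r}) = (!) ys ` {..<r - n}"
        by simp
      then show ?thesis
        by (simp only: image_image)
    qed
    also have "\<dots> = T"
      using ys by (auto simp: set_conv_nth)
    finally show ?thesis .
  qed
  ultimately show ?thesis
    by (auto simp: shuffle_perms_def)
qed

text \<open>
  The sign \<open>\<epsilon>(\<sigma>)\<close> of the definition of the Morley form is exactly the sign of the iterated contraction.
\<close>

lemma Delta_eq_kcontract:
  assumes nr: "n \<le> r"
  shows "Delta n r g = kcontract r g {} n"
proof
  fix T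
  have card_im: "\<sigma> ` {n..<r} \<subseteq> {..<r} \<and> card (\<sigma> ` {n..<r}) = r - n"
    if "\<sigma> \<in> shuffle_perms n r" for \<sigma>
  proof -
    have p: "\<sigma> permutes {..<r}"
      using that by (simp add: shuffle_perms_def)
    have "card (\<sigma> ` {n..<r}) = r - n"
      using inj_on_subset[OF permutes_inj[OF p]] by (simp add: card_image)
    moreover have "\<sigma> ` {n..<r} \<subseteq> \<sigma> ` {..<r}"
      by auto
    ultimately show ?thesis
      using permutes_image[OF p] by simp
  qed
  have fin: "finite (shuffle_perms n r)"
    by (rule finite_subset[OF _ finite_permutations[of "{..<r}"]]) (auto simp: shuffle_perms_def)
  show "Delta n r g T = kcontract r g {} n T"
  proof (cases "T \<subseteq> {..<r} \<and> card T = r - n")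
    case False
    then have "\<sigma> ` {n..<r} \<noteq> T" if "\<sigma> \<in> shuffle_perms n r" for \<sigma>
      using card_im[OF that] by auto
    then have "Delta n r g T = 0"
      unfolding Delta_def kbasis_def by (intro sum.neutral) auto
    moreover have "kcontract r g {} n \<in> koszul r (r - n) UNIV"
      using kcontract_koszul[of UNIV r n g "{}"] nr by (simp add: subgrp_def)
    then have "kcontract r g {} n T = 0"
      using False by (rule koszul_zero)
    ultimately show ?thesis
      by simp
  next
    case True
    then obtain \<sigma> where \<sigma>: "\<sigma> \<in> shuffle_perms n r" and T: "\<sigma> ` {n..<r} = T"
      using shuffle_exists[OF nr] by blast
    have p: "\<sigma> permutes {..<r}" and mono: "strict_mono_on {..<n} \<sigma>"
      using \<sigma> by (auto simp: shuffle_perms_def)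
    define D where "D = det (mat n n (\<lambda>(a, b). g (\<sigma> a) b))"
    have "Delta n r g T = (\<Sum>\<tau>\<in>shuffle_perms n r. if \<tau> = \<sigma> then of_int (sign \<sigma>) * D else 0)"
      unfolding Delta_def
    proof (rule sum.cong[OF refl])
      fix \<tau> assume \<tau>: "\<tau> \<in> shuffle_perms n r"
      have "\<tau> ` {n..<r} = T \<longleftrightarrow> \<tau> = \<sigma>"
        using shuffle_unique[OF nr \<tau> \<sigma>] T by auto
      then show "of_int (sign \<tau>) * det (mat n n (\<lambda>(a, b). g (\<tau> a) b)) * kbasis (\<tau> ` {n..<r}) T =
          (if \<tau> = \<sigma> then of_int (sign \<sigma>) * D else 0)"
        by (auto simp: kbasis_def D_def)
    qed
    also have "\<dots> = alt (\<Sum>a<n. \<sigma> a + a) D"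
      using fin \<sigma> sign_shuffle[OF nr \<sigma>] by (simp add: alt_def)
    also have "\<dots> = kcontract r g {} n ({..<r} - \<sigma> ` {..<n})"
      unfolding D_def using permutes_image[OF p] image_mono[of "{..<n}" "{..<r}" \<sigma>] nr
      by (intro kcontract_eq_det[symmetric] mono) simp
    also have "{..<r} - \<sigma> ` {..<n} = T"
    proof -
      have "{n..<r} = {..<r} - {..<n}"
        using nr by auto
      then have "\<sigma> ` {n..<r} = \<sigma> ` {..<r} - \<sigma> ` {..<n}"
        using image_set_diff[OF permutes_inj[OF p]] by metis
      then show ?thesis
        using permutes_image[OF p] T by simp
    qed
    finally show ?thesis .
  qed
qed

section \<open>Top local cohomology and the residue\<close>

abbreviation top_cochain :: "nat \<Rightarrow> 'k::zero laurent \<Rightarrow> nat set \<Rightarrow> 'k laurent" where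
  "top_cochain n p \<equiv> \<lambda>S. if S = {..<n} then p else 0"

text \<open>
  The involution \<open>a \<mapsto> -1 - a\<close> exchanges the exponents of the monomials of \<open>C\<close> and of those that
  survive in \<open>H\<^sup>n\<^sub>\<mm>(C)\<close>.
\<close>

lemma neg_exp_iff: "neg_ones n - a \<in> poly_exps n \<longleftrightarrow>
    keys a \<subseteq> {..<n} \<and> (\<forall>j<n. lookup a j < 0)"
proof
  assume *: "neg_ones n - a \<in> poly_exps n"
  have "lookup a j = 0" if "\<not> j < n" for j
  proof -
    have "j \<notin> keys (neg_ones n - a)"
      using * that by (auto simp: poly_exps_def)
    then show ?thesis
      using that by (simp add: in_keys_iff lookup_minus lookup_neg_ones)
  qed
  then have "keys a \<subseteq> {..<n}"
    by (auto simp: in_keys_iff)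
  moreover have "lookup a j < 0" if "j < n" for j
  proof -
    have "0 \<le> lookup (neg_ones n - a) j"
      using * by (simp add: poly_exps_def)
    then show ?thesis
      using that by (simp add: lookup_minus lookup_neg_ones)
  qed
  ultimately show "keys a \<subseteq> {..<n} \<and> (\<forall>j<n. lookup a j < 0)"
    by blast
next
  assume *: "keys a \<subseteq> {..<n} \<and> (\<forall>j<n. lookup a j < 0)"
  have "lookup a j = 0" if "\<not> j < n" for j
    using * that by (metis in_keys_iff lessThan_iff subsetD)
  then have lookup: "lookup (neg_ones n - a) j =
      (if j < n then - 1 - lookup a j else 0)" for j
    by (simp add: lookup_minus lookup_neg_ones)
  have "keys (neg_ones n - a) \<subseteq> {..<n}"
    by (auto simp: in_keys_iff lookup split: if_splits)
  moreover have "0 \<le> lookup (neg_ones n - a) j" for j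
  proof (cases "j < n")
    case True
    then have "lookup a j < 0"
      using * by blast
    then show ?thesis
      by (simp add: lookup)
  qed (simp add: lookup)
  ultimately show "neg_ones n - a \<in> poly_exps n"
    by (simp add: poly_exps_def)
qed

lemma subgrp_Hn_zero: "subgrp (Hn_zero n)"
  by (intro subgrp_cech_bounds subgrp_loc)

lemma cech_top: "w \<in> cech n n MS \<longleftrightarrow> (\<exists>p\<in>MS {..<n}. w = top_cochain n p)"
proof
  assume w: "w \<in> cech n n MS"
  have "w S = 0" if "S \<noteq> {..<n}" for S
    using that card_subset_eq[of "{..<n}" S] by (intro cech_zero[OF w]) auto
  then have "w = top_cochain n (w {..<n})"
    by auto
  moreover have "w {..<n} \<in> MS {..<n}"
    by (rule cechD[OF w]) auto
  ultimately show "\<exists>p\<in>MS {..<n}. w = top_cochain n p"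
    by blast
next
  assume "\<exists>p\<in>MS {..<n}. w = top_cochain n p"
  then obtain p where p: "p \<in> MS {..<n}" "w = top_cochain n p"
    by blast
  show "w \<in> cech n n MS"
  proof (rule cechI)
    fix S assume "S \<subseteq> {..<n}" "card S = n"
    then have "S = {..<n}"
      by (intro card_subset_eq) auto
    then show "w S \<in> MS S"
      using p by simp
  qed (use p in auto)
qed

text \<open>
  A monomial with \<open>a\<^sub>j \<ge> 0\<close> lives on the localization without \<open>X\<^sub>j\<close>, hence is a coboundary, whereas
  coboundaries contain no monomials with all exponents negative.
\<close>

lemma top_cochain_in_Hn_zero_iff:
  fixes p :: "'k::comm_ring_1 laurent"
  assumes n: "1 \<le> n" and p: "p \<in> loc n {..<n}"
  shows "top_cochain n p \<in> Hn_zero n \<longleftrightarrow> (\<forall>a. neg_ones n - a \<in> poly_exps n \<longrightarrow> lookup p a = 0)"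
proof
  assume "top_cochain n p \<in> Hn_zero n"
  then obtain v where v: "v \<in> cech n (n - 1) (loc n)" and pv: "top_cochain n p = cdiff n v"
    by (auto simp: cech_bounds_def)
  show "\<forall>a. neg_ones n - a \<in> poly_exps n \<longrightarrow> lookup p a = 0"
  proof (intro allI impI)
    fix a assume "neg_ones n - a \<in> poly_exps n"
    then have a: "\<forall>j<n. lookup a j < 0"
      by (simp add: neg_exp_iff)
    have "lookup (v ({..<n} - {j})) a = 0" if "j < n" for j
    proof -
      have "v ({..<n} - {j}) \<in> loc n ({..<n} - {j})"
        using that by (intro cechD[OF v]) auto
      then show ?thesis
        using a that unfolding loc_iff by (metis DiffE insertI1 not_less)
    qed
    moreover have "p = cdiff n v {..<n}"
      using fun_cong[OF pv, of "{..<n}"] by simp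
    ultimately show "lookup p a = 0"
      by (simp add: cdiff_def lookup_sum lookup_alt)
  qed
next
  assume p0: "\<forall>a. neg_ones n - a \<in> poly_exps n \<longrightarrow> lookup p a = 0"
  have "\<exists>v\<in>cech n (n - 1) (loc n). cdiff n v = top_cochain n p"
  proof (rule cech_exact_nonneg)
    have cech: "top_cochain n p \<in> cech n n (loc n)"
      unfolding cech_top using p by blast
    then show "top_cochain n p \<in> cech n (Suc (n - 1)) (loc n)"
      using n by simp
    have "\<not> (S \<subseteq> {..<n} \<and> card S = Suc n)" for S
      using card_mono[of "{..<n}" S] by auto
    then show "cdiff n (top_cochain n p) = 0"
      using cdiff_cech_zero[OF cech] by (intro ext) simp
    fix S a assume "lookup (top_cochain n p S) a \<noteq> 0"
    then have a: "lookup p a \<noteq> 0"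
      by (auto split: if_splits)
    then have "\<not> (neg_ones n - a \<in> poly_exps n)" "keys a \<subseteq> {..<n}"
      using p0 p unfolding loc_iff by blast+
    then show "\<exists>j<n. 0 \<le> lookup a j"
      unfolding neg_exp_iff by force
  qed
  then show "top_cochain n p \<in> Hn_zero n"
    unfolding cech_bounds_def by (metis image_eqI)
qed

lemma Hn_class_eq_iff:
  fixes p q :: "'k::comm_ring_1 laurent"
  assumes n: "1 \<le> n" and p: "p \<in> loc n {..<n}" and q: "q \<in> loc n {..<n}"
  shows "Hn_class n p = Hn_class n q \<longleftrightarrow>
    (\<forall>a. neg_ones n - a \<in> poly_exps n \<longrightarrow> lookup p a = lookup q a)"
proof -
  have "top_cochain n p - top_cochain n q = top_cochain n (p - q)"
    by (auto simp: fun_eq_iff)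
  then have "Hn_class n p = Hn_class n q \<longleftrightarrow> top_cochain n (p - q) \<in> Hn_zero n"
    unfolding Hn_class_def coset_eq_iff[OF subgrp_Hn_zero] by simp
  then show ?thesis
    using top_cochain_in_Hn_zero_iff[OF n subgrp_diff[OF subgrp_loc p q]] by (simp add: lookup_minus)
qed

lemma Hn_class_0: "Hn_class n 0 = Hn_zero n"
proof -
  have "(\<lambda>S. if S = {..<n} then 0 else 0) = (0 :: nat set \<Rightarrow> 'a laurent)"
    by (simp add: fun_eq_iff)
  then show ?thesis
    unfolding Hn_class_def by (simp only: set_zero_plus)
qed

lemma cech_top_image: "cech n n MS = top_cochain n ` MS {..<n}"
  by (auto simp: cech_top)

lemma Hn_eq: "Hn n = Hn_class n ` loc n {..<n}"
  unfolding Hn_def quot_def Hn_class_def cech_top_image image_image ..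

lemma Hn_deg_eq: "Hn_deg n m \<mu> = Hn_class n ` (loc n {..<n} \<inter> homog n m \<mu>)"
  unfolding Hn_deg_def quot_def Hn_class_def cech_top_image image_image ..

lemma polys_loc: "polys n \<subseteq> loc n S"
  by (rule loc_mono) simp

lemma Hn_mult_class:
  fixes b p :: "'k::comm_ring_1 laurent"
  assumes b: "b \<in> polys n"
  shows "Hn_mult n b (Hn_class n p) = Hn_class n (b * p)"
proof -
  have "Hn_mult n b (Hn_class n p) = (\<lambda>S. b * top_cochain n p S) +o Hn_zero n"
    unfolding Hn_mult_def Hn_class_def
  proof (rule induced_coset[OF _ _ subgrp_Hn_zero subgrp_Hn_zero])
    show "additive (\<lambda>(w::nat set \<Rightarrow> 'k laurent) S. b * w S)"
      by (simp add: additive_def fun_eq_iff distrib_left)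
    show "(\<lambda>w S. b * w S) ` Hn_zero n \<subseteq> Hn_zero n"
    proof clarify
      fix x :: "nat set \<Rightarrow> 'k laurent" assume "x \<in> Hn_zero n"
      then obtain v where v: "v \<in> cech n (n - 1) (loc n)" and x: "x = cdiff n v"
        by (auto simp: cech_bounds_def)
      have "(\<lambda>S. b * v S) \<in> cech n (n - 1) (loc n)"
        using cechD[OF v] cech_zero[OF v] subsetD[OF polys_loc b] by (intro cechI) (auto intro!: loc_mult)
      moreover have "(\<lambda>S. b * x S) = cdiff n (\<lambda>S. b * v S)"
        by (rule ext) (simp add: x cdiff_map[OF additive_mult_left])
      ultimately show "(\<lambda>S. b * x S) \<in> Hn_zero n"
        unfolding cech_bounds_def by blast
    qed
  qed
  also have "(\<lambda>S. b * top_cochain n p S) = top_cochain n (b * p)"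
    by auto
  finally show ?thesis
    by (simp add: Hn_class_def)
qed

lemma inv_X_eq: "inv_X n = single (neg_ones n) 1"
  by (simp add: inv_X_def neg_ones_def)

lemma keys_neg_ones: "keys (neg_ones n) \<subseteq> {..<n}"
  by (auto simp: in_keys_iff lookup_neg_ones split: if_splits)

lemma inv_X_loc: "inv_X n \<in> loc n {..<n}"
  using keys_neg_ones by (auto simp: inv_X_eq loc_iff lookup_single when_def lookup_neg_ones split: if_splits)

lemma wdeg_add: "wdeg n m (a + b) = wdeg n m a + wdeg n m b"
  by (simp add: wdeg_def lookup_add distrib_left sum.distrib)

lemma wdeg_diff: "wdeg n m (a - b) = wdeg n m a - wdeg n m b"
  by (simp add: wdeg_def lookup_minus right_diff_distrib sum_subtractf)

lemma wdeg_neg_ones: "wdeg n m (neg_ones n) = - (\<Sum>j<n. int (m j))"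
  by (simp add: wdeg_def lookup_neg_ones sum_negf)

lemma wdeg_0: "wdeg n m 0 = 0"
  by (simp add: wdeg_def)

lemma wdeg_poly_exps_nonneg: "a \<in> poly_exps n \<Longrightarrow> 0 \<le> wdeg n m a"
  by (auto simp: wdeg_def poly_exps_def intro!: sum_nonneg)

lemma lookup_le_wdeg:
  assumes a: "a \<in> poly_exps n" and j: "j < n" and m: "0 < m j"
  shows "lookup a j \<le> wdeg n m a"
proof -
  have "lookup a j \<le> int (m j) * lookup a j"
    using m a mult_right_mono[of 1 "int (m j)" "lookup a j"] by (simp add: poly_exps_def)
  also have "\<dots> \<le> wdeg n m a"
    unfolding wdeg_def using a j by (intro member_le_sum) (auto simp: poly_exps_def)
  finally show ?thesis .
qed

lemma poly_exps_wdeg_0: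
  assumes a: "a \<in> poly_exps n" and m: "\<And>j. j < n \<Longrightarrow> 0 < m j" and "wdeg n m a = 0"
  shows "a = 0"
proof (rule poly_mapping_eqI)
  fix j
  show "lookup a j = lookup 0 j"
  proof (cases "j < n")
    case True
    then have "lookup a j \<le> 0"
      using lookup_le_wdeg[OF a True, of m] m assms(3) by simp
    then show ?thesis
      using a by (simp add: poly_exps_def order_antisym)
  next
    case False
    then have "j \<notin> keys a"
      using a by (auto simp: poly_exps_def)
    then show ?thesis
      by (simp add: in_keys_iff)
  qed
qed

text \<open>
  In degree \<open>-\<Sum>j<n. m j\<close> the only monomial with all exponents negative is \<open>1/(X\<^sub>0 \<cdots> X\<^sub>n\<^sub>-\<^sub>1)\<close>, as all
  weights are positive.
\<close>

lemma residue_class: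
  fixes p :: "'k::comm_ring_1 laurent"
  assumes n: "1 \<le> n" and m: "\<And>j. j < n \<Longrightarrow> 0 < m j"
    and p: "p \<in> loc n {..<n}" and deg: "p \<in> homog n m (- (\<Sum>j<n. int (m j)))"
  shows "residue n (Hn_class n p) = lookup p (neg_ones n)"
proof -
  have eq: "Hn_class n p = Hn_mult n (const c) (Hn_class n (inv_X n)) \<longleftrightarrow> c = lookup p (neg_ones n)"
    for c
  proof -
    have *: "const c * inv_X n \<in> loc n {..<n}"
      by (intro loc_mult const_in_loc inv_X_loc)
    have "lookup p a = 0" if "neg_ones n - a \<in> poly_exps n" "a \<noteq> neg_ones n" for a
    proof (rule ccontr)
      assume "lookup p a \<noteq> 0"
      then have "wdeg n m a = - (\<Sum>j<n. int (m j))"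
        using deg by (simp add: homog_def in_keys_iff)
      then have "wdeg n m (neg_ones n - a) = 0"
        by (simp add: wdeg_diff wdeg_neg_ones)
      then show False
        using poly_exps_wdeg_0[OF that(1) m] that(2) by simp
    qed
    moreover have "lookup (const c * inv_X n) a = (if a = neg_ones n then c else 0)" for a
      by (auto simp: lookup_const_mult inv_X_eq lookup_single)
    ultimately show ?thesis
      unfolding Hn_mult_class[OF const_in_loc] Hn_class_eq_iff[OF n p *] using poly_exps_0 by auto
  qed
  show ?thesis
    unfolding residue_def eq by simp
qed

section \<open>Generated ideals\<close>

lemma ideal_gen_mem:
  assumes "c \<in> A" and "g \<in> G"
  shows "c * g \<in> ideal_gen A G"
  unfolding ideal_gen_def using assms by (intro CollectI exI[of _ "\<lambda>_. c"] exI[of _ "{g}"]) auto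

lemma ideal_gen_subset:
  assumes "subgrp B" and "\<And>c g. c \<in> A \<Longrightarrow> g \<in> G \<Longrightarrow> c * g \<in> B"
  shows "ideal_gen A G \<subseteq> B"
  using assms by (auto simp: ideal_gen_def intro!: subgrp_sum)

lemma subgrp_ideal_gen:
  assumes A: "subgrp A"
  shows "subgrp (ideal_gen A G)"
  unfolding subgrp_def
proof (intro conjI ballI)
  show "0 \<in> ideal_gen A G"
    unfolding ideal_gen_def by (intro CollectI exI[of _ "\<lambda>_. 0"] exI[of _ "{}"]) auto
  fix x y assume "x \<in> ideal_gen A G" "y \<in> ideal_gen A G"
  then obtain c F c' F' where x: "x = (\<Sum>g\<in>F. c g * g)" "finite F" "F \<subseteq> G" "\<forall>g\<in>F. c g \<in> A"
    and y: "y = (\<Sum>g\<in>F'. c' g * g)" "finite F'" "F' \<subseteq> G" "\<forall>g\<in>F'. c' g \<in> A"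
    by (auto simp: ideal_gen_def)
  define e where "e g = (if g \<in> F then c g else 0) - (if g \<in> F' then c' g else 0)" for g
  have "x = (\<Sum>g\<in>F \<union> F'. (if g \<in> F then c g else 0) * g)"
    unfolding x(1) using x(2) y(2) by (intro sum.mono_neutral_cong_left) auto
  moreover have "y = (\<Sum>g\<in>F \<union> F'. (if g \<in> F' then c' g else 0) * g)"
    unfolding y(1) using x(2) y(2) by (intro sum.mono_neutral_cong_left) auto
  ultimately have "x - y = (\<Sum>g\<in>F \<union> F'. e g * g)"
    by (simp add: e_def left_diff_distrib sum_subtractf)
  moreover have "e g \<in> A" for g
    unfolding e_def using x(4) y(4) subgrp_0[OF A] by (intro subgrp_diff[OF A]) auto
  ultimately show "x - y \<in> ideal_gen A G"
    unfolding ideal_gen_def using x y by (intro CollectI exI[of _ e] exI[of _ "F \<union> F'"]) auto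
qed

lemma subgrp_idl: "subgrp (idl n r f)"
  unfolding idl_def by (rule subgrp_ideal_gen[OF subgrp_loc])

lemma idl_mem: "c \<in> polys n \<Longrightarrow> i < r \<Longrightarrow> c * f i \<in> idl n r f"
  unfolding idl_def by (rule ideal_gen_mem) auto

lemma idl_mult: "c \<in> polys n \<Longrightarrow> p \<in> idl n r f \<Longrightarrow> c * p \<in> idl n r f"
  for p :: "'k::comm_ring_1 laurent"
proof -
  assume c: "c \<in> polys n" and p: "p \<in> idl n r f"
  have "subgrp {p. c * p \<in> idl n r f}"
    using subgrp_idl[of n r f] by (auto simp: subgrp_def right_diff_distrib)
  then have "idl n r f \<subseteq> {p. c * p \<in> idl n r f}"
    unfolding idl_def using c loc_mult
    by (intro ideal_gen_subset) (auto simp: mult.assoc[symmetric] intro!: ideal_gen_mem)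
  then show "c * p \<in> idl n r f"
    using p by auto
qed

section \<open>Linear forms on \<open>B\<close> and the perfect pairing\<close>

text \<open>
  A form on \<open>B\<^sub>q\<close>, lifted to a form on \<open>C\<close> that vanishes in degrees other than \<open>q\<close> and given by
  its values on monomials.
\<close>

definition form_coeff ::
  "nat \<Rightarrow> (nat \<Rightarrow> nat) \<Rightarrow> nat \<Rightarrow> (nat \<Rightarrow> 'k::comm_ring_1 laurent) \<Rightarrow> int \<Rightarrow> ('k laurent set \<Rightarrow> 'k)
    \<Rightarrow> (nat \<Rightarrow>\<^sub>0 int) \<Rightarrow> 'k" where
  "form_coeff n m r f q u b =
     (if b \<in> poly_exps n \<and> wdeg n m b = q then u (single b 1 +o idl n r f) else 0)"

definition pair_sum :: "((nat \<Rightarrow>\<^sub>0 int) \<Rightarrow> 'k) \<Rightarrow> 'k::comm_ring_1 laurent \<Rightarrow> 'k" where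
  "pair_sum U p = (\<Sum>a\<in>keys p. lookup p a * U a)"

lemma additive_pair_sum: "additive (pair_sum U)"
  unfolding additive_def pair_sum_def
  by (intro allI setsum_keys_plus_distrib[where f="\<lambda>a c. c * U a"]) (auto simp: distrib_right)

lemma pair_sum_single: "pair_sum U (single a c) = c * U a"
  by (simp add: pair_sum_def)

lemma pair_sum_mult_single:
  "pair_sum U (p * single b 1) =
    (\<Sum>a\<in>keys p. lookup p a * U (a + b))"
proof -
  let ?F = "\<lambda>p. pair_sum U (p * single b 1)"
  have F: "additive ?F"
    by (intro additive_comp[OF additive_pair_sum] additive_mult_right)
  have "?F p = (\<Sum>a\<in>keys p. ?F (single a (lookup p a)))"
    by (rule additive_sum_singles[OF F])
  then show ?thesis
    by (simp add: mult_single pair_sum_single)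
qed

lemma subgrp_homog: "subgrp (homog n m q)"
  unfolding homog_def by (rule subgrp_support)

lemma homog_mult: "p \<in> homog n m q \<Longrightarrow> p' \<in> homog n m q' \<Longrightarrow> p * p' \<in> homog n m (q + q')"
  using keys_mult[of p p'] by (fastforce simp: homog_def wdeg_add)

text \<open>
  The elements of the dual of \<open>B\<^sub>q\<close> are functions of cosets; by linearity they are determined by
  their values on the cosets of monomials.
\<close>

lemma Bdual_eq_pair_sum:
  fixes u :: "'k::comm_ring_1 laurent set \<Rightarrow> 'k"
  assumes u: "u \<in> Bdual n m r f q" and p: "p \<in> polys n" "p \<in> homog n m q"
  shows "u (p +o idl n r f) = pair_sum (form_coeff n m r f q u) p"
proof -
  let ?I = "idl n r f"
  define M where "M = (polys n \<inter> homog n m q :: 'k laurent set)"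
  have M: "subgrp M"
    using subgrp_loc[of n "{}"] subgrp_homog[of n m q] by (auto simp: M_def subgrp_def)
  have B: "x +o ?I \<in> Bdeg n m r f q" if "x \<in> M" for x
    using that by (auto simp: Bdeg_def quot_def M_def)
  have add: "u ((x + y) +o ?I) = u (x +o ?I) + u (y +o ?I)" if "x \<in> M" "y \<in> M" for x y
    using u B[OF that(1)] B[OF that(2)] unfolding Bdual_def
    by (simp add: coset_plus_coset[OF subgrp_idl, symmetric])
  have zero: "u (0 +o ?I) = 0"
    using add[of 0 0] subgrp_0[OF M] by simp
  have scale: "u (const c * x +o ?I) = c * u (x +o ?I)" if "x \<in> M" for c x
  proof -
    have "induced ((*) (const c)) ?I (x +o ?I) = const c * x +o ?I"
      by (rule induced_coset[OF additive_mult_left _ subgrp_idl subgrp_idl])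
        (auto intro: idl_mult const_in_loc)
    moreover have "u (induced ((*) (const c)) ?I (x +o ?I)) = c * u (x +o ?I)"
      using u B[OF that] by (simp add: Bdual_def)
    ultimately show ?thesis
      by simp
  qed
  have keys: "a \<in> poly_exps n \<and> wdeg n m a = q" if "a \<in> keys p" for a
    using p that by (auto simp: polys_iff homog_def in_keys_iff)
  have mono: "single a c \<in> M" if "a \<in> keys p" for a c
    using keys[OF that] by (auto simp: M_def polys_iff homog_def lookup_single when_def split: if_splits)
  have sum: "u ((\<Sum>a\<in>F. single a (lookup p a)) +o ?I) =
      (\<Sum>a\<in>F. lookup p a * u (single a 1 +o ?I))"
    if "finite F" "F \<subseteq> keys p" for F
    using that
  proof (induction F rule: finite_induct)
    case empty
    show ?case
      using zero by simp
  next
    case (insert a F)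
    then have a: "a \<in> keys p"
      by simp
    have "const (lookup p a) * single a 1 =
        single a (lookup p a)"
      by (simp add: const_def mult_single)
    then have "u (single a (lookup p a) +o ?I) =
        lookup p a * u (single a 1 +o ?I)"
      using scale[OF mono[OF a, of 1], of "lookup p a"] by simp
    moreover have "(\<Sum>a\<in>F. single a (lookup p a)) \<in> M"
      using insert.prems by (intro subgrp_sum[OF M] mono) auto
    ultimately show ?case
      using insert add mono[OF a] by simp
  qed
  have "u (p +o ?I) = (\<Sum>a\<in>keys p. lookup p a * u (single a 1 +o ?I))"
    using sum[OF finite_keys order_refl] by (simp add: poly_mapping_sum_single[symmetric])
  also have "\<dots> = pair_sum (form_coeff n m r f q u) p"
    unfolding pair_sum_def using keys by (intro sum.cong) (auto simp: form_coeff_def)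
  finally show ?thesis .
qed

text \<open>
  A product of \<open>f\<^sub>i\<close> with a monomial is homogeneous. It lies either in degree \<open>q\<close>, where the form vanishes on
  the ideal, or in another degree, where all the values are 0. A monomial of degree \<open>q\<close> has no
  exponent greater than \<open>q\<close>, which gives the bound for the truncation.
\<close>

lemma form_coeff_dual:
  fixes u :: "'k::comm_ring_1 laurent set \<Rightarrow> 'k"
  assumes m: "\<And>j. j < n \<Longrightarrow> 0 < m j"
    and f: "\<And>i. i < r \<Longrightarrow> f i \<in> polys n \<inter> homog n m (int (d i))"
    and u: "u \<in> Bdual n m r f q"
  shows "dual_coeffs n r f (nat q + 1) (form_coeff n m r f q u)"
  unfolding dual_coeffs_def
proof (intro conjI allI impI ballI)
  fix b assume "form_coeff n m r f q u b \<noteq> 0"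
  then have b: "b \<in> poly_exps n" "wdeg n m b = q"
    by (auto simp: form_coeff_def split: if_splits)
  show "b \<in> poly_exps n"
    by (rule b)
  fix j assume "j < n"
  then show "lookup b j < int (nat q + 1)"
    using lookup_le_wdeg[OF b(1), of j m] m b(2) by force
next
  fix i b assume i: "i < r" and b: "b \<in> poly_exps n"
  note fi = f[OF i]
  show "(\<Sum>a\<in>keys (f i). lookup (f i) a * form_coeff n m r f q u (a + b)) = 0"
  proof (cases "int (d i) + wdeg n m b = q")
    case True
    have mono: "single b 1 \<in> polys n" "single b (1::'k) \<in> homog n m (wdeg n m b)"
      using b by (auto simp: polys_iff homog_def lookup_single when_def split: if_splits)
    have p: "f i * single b 1 \<in> polys n" "f i * single b 1 \<in> homog n m q"
      using fi mono homog_mult[of "f i" n m "int (d i)" "single b 1" "wdeg n m b"] True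
      by (auto intro: loc_mult)
    have "f i * single b 1 \<in> idl n r f"
      using idl_mem[OF mono(1) i] by (simp add: mult.commute)
    then have "f i * single b 1 +o idl n r f = 0 +o idl n r f"
      by (simp add: coset_eq_self_iff[OF subgrp_idl])
    moreover have "u (0 +o idl n r f) = 0"
      using Bdual_eq_pair_sum[OF u, of 0] by (simp add: pair_sum_def subgrp_0[OF subgrp_loc] subgrp_0[OF subgrp_homog])
    ultimately show ?thesis
      using Bdual_eq_pair_sum[OF u p] by (simp add: pair_sum_mult_single)
  next
    case False
    then have "form_coeff n m r f q u (a + b) = 0" if "a \<in> keys (f i)" for a
      using that fi by (auto simp: form_coeff_def homog_def wdeg_add)
    then show ?thesis
      by (intro sum.neutral) auto
  qed
qed

lemma dual_poly_in_loc: "dual_poly n N U \<in> loc n {..<n}"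
  unfolding dual_poly_def by (intro pair_Y_in_loc loc2_prod invdiff_in_loc2) auto

lemma lookup_mult_sum:
  fixes p h :: "'k::comm_ring_1 laurent"
  shows "lookup (p * h) a =
    (\<Sum>c\<in>keys p. lookup p c * lookup h (a - c))"
proof -
  let ?F = "\<lambda>p. lookup (p * h) a"
  have F: "additive ?F"
    by (simp add: additive_def distrib_right lookup_add)
  have "?F p = (\<Sum>c\<in>keys p. ?F (single c (lookup p c)))"
    by (rule additive_sum_singles[OF F])
  then show ?thesis
    by (simp add: lookup_single_mult)
qed

lemma dual_poly_annihilated:
  assumes n: "1 \<le> n" and f: "\<And>i. i < r \<Longrightarrow> f i \<in> polys n" and U: "dual_coeffs n r f N U"
  shows "Hn_class n (dual_poly n N U) \<in> H0f n r f"
proof -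
  have "Hn_mult n (f i) (Hn_class n (dual_poly n N U)) = Hn_zero n" if i: "i < r" for i
  proof -
    have "f i \<in> loc n {..<n}"
      using f[OF i] polys_loc by blast
    then have loc: "f i * dual_poly n N U \<in> loc n {..<n}"
      by (rule loc_mult[OF _ dual_poly_in_loc])
    have "lookup (f i * dual_poly n N U) a = 0" if "neg_ones n - a \<in> poly_exps n" for a
    proof -
      have "lookup (f i * dual_poly n N U) a =
          (\<Sum>c\<in>keys (f i). lookup (f i) c * U (c + (neg_ones n - a)))"
        by (simp add: lookup_mult_sum lookup_dual_poly[OF U] algebra_simps)
      then show ?thesis
        using U i that by (simp add: dual_coeffs_def)
    qed
    then have "Hn_class n (f i * dual_poly n N U) = Hn_class n 0"
      using Hn_class_eq_iff[OF n loc subgrp_0[OF subgrp_loc]] by simp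
    then show ?thesis
      by (simp add: Hn_mult_class[OF f[OF i]] Hn_class_0)
  qed
  then show ?thesis
    using imageI[OF dual_poly_in_loc, of "Hn_class n"] by (simp add: H0f_def Hn_eq)
qed

lemma residue_mult_dual_poly:
  assumes n: "1 \<le> n" and m: "\<And>j. j < n \<Longrightarrow> 0 < m j" and U: "dual_coeffs n r f N U"
    and Udeg: "\<And>b. U b \<noteq> 0 \<Longrightarrow> wdeg n m b = q" and b: "b \<in> polys n" "b \<in> homog n m q"
  shows "residue n (Hn_mult n b (Hn_class n (dual_poly n N U))) = pair_sum U b"
proof -
  have deg: "dual_poly n N U \<in> homog n m (- (\<Sum>j<n. int (m j)) - q)"
    unfolding homog_def
  proof (intro CollectI ballI)
    fix a assume "a \<in> keys (dual_poly n N U)"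
    then have "wdeg n m (neg_ones n - a) = q"
      by (intro Udeg) (simp add: in_keys_iff lookup_dual_poly[OF U])
    then show "wdeg n m a = - (\<Sum>j<n. int (m j)) - q"
      by (simp add: wdeg_diff wdeg_neg_ones)
  qed
  have "b \<in> loc n {..<n}"
    using b polys_loc by blast
  then have 1: "b * dual_poly n N U \<in> loc n {..<n}"
    by (rule loc_mult[OF _ dual_poly_in_loc])
  have 2: "b * dual_poly n N U \<in> homog n m (- (\<Sum>j<n. int (m j)))"
    using homog_mult[OF b(2) deg] by simp
  have "residue n (Hn_class n (b * dual_poly n N U)) =
      lookup (b * dual_poly n N U) (neg_ones n)"
    by (rule residue_class[OF n _ 1 2]) (rule m)
  then show ?thesis
    by (simp add: Hn_mult_class[OF b(1)] lookup_mult_sum lookup_dual_poly[OF U] pair_sum_def)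
qed

text \<open>
  The element that represents \<open>u\<close> has the coefficients \<open>u(X\<^sup>b)\<close> at \<open>X\<^sup>-\<^sup>1\<^sup>-\<^sup>b\<close>. It is unique because the
  pairing with \<open>X\<^sup>b\<close> extracts the coefficient at \<open>X\<^sup>-\<^sup>1\<^sup>-\<^sup>b\<close>.
\<close>

lemma dual_elt_eq:
  fixes u :: "'k::comm_ring_1 laurent set \<Rightarrow> 'k"
  assumes n: "1 \<le> n" and m: "\<And>j. j < n \<Longrightarrow> 0 < m j"
    and f: "\<And>i. i < r \<Longrightarrow> f i \<in> polys n \<inter> homog n m (int (d i))"
    and q: "q = delta n m r d - \<nu>" and u: "u \<in> Bdual n m r f q"
  shows "dual_elt n m r d f \<nu> u = Hn_class n (dual_poly n (nat q + 1) (form_coeff n m r f q u))"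
proof -
  define U where "U = form_coeff n m r f q u"
  define h where "h = dual_poly n (nat q + 1) U"
  define \<mu> where "\<mu> = \<nu> - (\<Sum>i<r. int (d i))"
  have U: "dual_coeffs n r f (nat q + 1) U"
    unfolding U_def by (rule form_coeff_dual[OF m f u])
  have Udeg: "wdeg n m b = q" if "U b \<noteq> 0" for b
    using that by (auto simp: U_def form_coeff_def split: if_splits)
  have \<mu>q: "\<mu> = - (\<Sum>j<n. int (m j)) - q"
    by (simp add: \<mu>_def q delta_def)
  have lookup_h: "lookup h a = U (neg_ones n - a)" for a
    unfolding h_def by (rule lookup_dual_poly[OF U])
  have h: "h \<in> loc n {..<n}"
    by (simp add: h_def dual_poly_in_loc)
  have "wdeg n m a = \<mu>" if "lookup h a \<noteq> 0" for a
    using Udeg[of "neg_ones n - a"] that by (simp add: lookup_h wdeg_diff wdeg_neg_ones \<mu>q)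
  then have hdeg: "h \<in> homog n m \<mu>"
    by (simp add: homog_def in_keys_iff)
  have pairing: "residue n (Hn_mult n b (Hn_class n h)) = u (b +o idl n r f)"
    if "b \<in> polys n \<inter> homog n m q" for b
  proof -
    have "residue n (Hn_mult n b (Hn_class n h)) = pair_sum U b"
      unfolding h_def by (rule residue_mult_dual_poly[where m=m, OF n _ U]) (use m Udeg that in auto)
    then show ?thesis
      using that Bdual_eq_pair_sum[OF u, of b] by (simp add: U_def)
  qed
  have ann: "Hn_class n h \<in> H0f n r f"
    unfolding h_def using f by (intro dual_poly_annihilated[OF n _ U]) auto
  show ?thesis
    unfolding dual_elt_def q[symmetric] \<mu>_def[symmetric] U_def[symmetric] h_def[symmetric]
  proof (rule the_equality)
    show "Hn_class n h \<in> H0f n r f \<and> Hn_class n h \<in> Hn_deg n m \<mu> \<and>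
        (\<forall>b\<in>polys n \<inter> homog n m q. residue n (Hn_mult n b (Hn_class n h)) = u (b +o idl n r f))"
      using ann pairing h hdeg by (auto simp: Hn_deg_eq)
  next
    fix A assume A: "A \<in> H0f n r f \<and> A \<in> Hn_deg n m \<mu> \<and>
        (\<forall>b\<in>polys n \<inter> homog n m q. residue n (Hn_mult n b A) = u (b +o idl n r f))"
    then obtain p where p: "p \<in> loc n {..<n}" "p \<in> homog n m \<mu>" and Ap: "A = Hn_class n p"
      by (auto simp: Hn_deg_eq)
    have "lookup p a = lookup h a" if a: "neg_ones n - a \<in> poly_exps n" for a
    proof (cases "wdeg n m a = \<mu>")
      case False
      then have "a \<notin> keys p" "a \<notin> keys h"
        using p(2) hdeg by (auto simp: homog_def)
      then show ?thesis
        by (simp add: in_keys_iff)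
    next
      case True
      define b where "b = single (neg_ones n - a) (1::'k)"
      have "wdeg n m (neg_ones n - a) = q"
        using True by (simp add: wdeg_diff wdeg_neg_ones \<mu>q)
      then have b: "b \<in> polys n" "b \<in> homog n m q"
        using a by (auto simp: b_def polys_iff homog_def lookup_single when_def split: if_splits)
      have key: "residue n (Hn_mult n b (Hn_class n p')) = lookup p' a"
        if p': "p' \<in> loc n {..<n}" "p' \<in> homog n m \<mu>" for p'
      proof -
        have "b \<in> loc n {..<n}"
          using b polys_loc by blast
        then have 1: "b * p' \<in> loc n {..<n}"
          using p' by (intro loc_mult)
        have 2: "b * p' \<in> homog n m (- (\<Sum>j<n. int (m j)))"
          using homog_mult[OF b(2) p'(2)] by (simp add: \<mu>q)
        have "residue n (Hn_class n (b * p')) = lookup (b * p') (neg_ones n)"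
          by (rule residue_class[OF n _ 1 2]) (rule m)
        then show ?thesis
          unfolding Hn_mult_class[OF b(1)] by (simp add: b_def lookup_single_mult)
      qed
      show ?thesis
        using key[OF p] key[OF h hdeg] A Ap pairing[of b] b by simp
    qed
    then show "A = Hn_class n h"
      unfolding Ap using Hn_class_eq_iff[OF n p(1) h] by blast
  qed
qed

section \<open>The sign of the transgression\<close>

lemma khom_scale_coset:
  "khom_scale n r f c (z +o kboundsC n r f (r - n)) = (\<lambda>T. const c * z T) +o kboundsC n r f (r - n)"
  unfolding khom_scale_def
proof (rule induced_coset[OF _ _ subgrp_kboundsC subgrp_kboundsC])
  show "additive (\<lambda>(z::nat set \<Rightarrow> 'a laurent) T. const c * z T)"
    by (simp add: additive_def fun_eq_iff distrib_left)
  show "(\<lambda>z T. const c * z T) ` kboundsC n r f (r - n) \<subseteq> kboundsC n r f (r - n)"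
    by (rule kbounds_map[where \<phi>="\<lambda>_ x. const c * x"])
      (auto simp: additive_mult_left mult.left_commute intro!: loc_mult const_in_loc subgrp_0[OF subgrp_loc])
qed

text \<open>
  For \<open>(X\<^sub>0, \<dots>, X\<^sub>n\<^sub>-\<^sub>1, 0, \<dots>, 0)\<close> the form \<open>1\<close> on \<open>B\<^sub>0 = k\<close> is evaluation at the origin.
\<close>

lemma std_seq_dual_coeffs:
  "dual_coeffs n r (std_seq n :: nat \<Rightarrow> 'k::comm_ring_1 laurent) 1 (\<lambda>b. if b = 0 then 1 else 0)"
  unfolding dual_coeffs_def
proof (intro conjI allI impI ballI)
  fix i :: nat and b assume b: "b \<in> poly_exps n"
  show "(\<Sum>a\<in>keys (std_seq n i :: 'k laurent).
      lookup (std_seq n i) a * (if a + b = 0 then 1 else (0::'k))) = 0"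
  proof (rule sum.neutral, rule ballI)
    fix a assume "a \<in> keys (std_seq n i :: 'k laurent)"
    then have "a = single i 1"
      by (auto simp: std_seq_def Xvar_def split: if_splits)
    then have "0 < lookup (a + b) i"
      using b by (simp add: lookup_add poly_exps_def add_pos_nonneg)
    then show "lookup (std_seq n i) a * (if a + b = 0 then 1 else (0::'k)) = 0"
      by auto
  qed
qed (auto simp: poly_exps_0 split: if_splits)

lemma std_seq_in_polys: "std_seq n i \<in> polys n"
  by (auto simp: std_seq_def Xvar_def polys_iff lookup_single when_def intro: poly_exps_single split: if_splits)

text \<open>
  Here the matrix \<open>g\<close> consists of the unit matrix and zero rows, and the Morley form is
  \<open>e\<^sub>n \<and> \<dots> \<and> e\<^sub>r\<^sub>-\<^sub>1\<close>.
\<close>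

lemma tau0_std_seq:
  fixes n r :: nat
  assumes n: "1 \<le> n" "n \<le> r"
  shows "tau0 n r (std_seq n :: nat \<Rightarrow> 'k::comm_ring_1 laurent) (Hn_class n (inv_X n)) =
    (\<lambda>T. alt (\<Sum>j<n. n - 1 - j) (kbasis {n..<r} T)) +o kboundsC n r (std_seq n) (r - n)"
proof -
  define U where "U = (\<lambda>b::nat \<Rightarrow>\<^sub>0 int. if b = 0 then 1 else (0::'k))"
  define g where "g = (\<lambda>(i::nat) (j::nat). if i = j then 1 else 0 :: 'k laurent2)"
  have U: "dual_coeffs n r (std_seq n) 1 U"
    unfolding U_def by (rule std_seq_dual_coeffs)
  have "dual_poly n 1 U = inv_X n"
  proof (rule poly_mapping_eqI)
    fix a
    show "lookup (dual_poly n 1 U) a = lookup (inv_X n) a"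
      unfolding lookup_dual_poly[OF U] by (auto simp: U_def inv_X_eq lookup_single when_def)
  qed
  moreover have "tau0 n r (std_seq n) (Hn_class n (dual_poly n 1 U)) =
      (\<lambda>T. alt (\<Sum>j<n. n - 1 - j) (pair_Y U (kcontract r g {} n T))) +o kboundsC n r (std_seq n) (r - n)"
  proof (rule tau0_dual_poly[OF n(2) std_seq_in_polys _ _ U n(1)])
    show "g i j \<in> polys2 n" for i j
      by (simp add: g_def polys2_loc2 one_in_loc2 subgrp_0[OF subgrp_loc2])
    fix i
    have "(\<Sum>j<n. (in_X (Xvar j) - in_Y (Xvar j)) * g i j) =
        (\<Sum>j<n. if i = j then in_X (Xvar i) - in_Y (Xvar i) else 0)"
      by (intro sum.cong) (auto simp: g_def)
    then show "in_X (std_seq n i) - in_Y (std_seq n i) = (\<Sum>j<n. (in_X (Xvar j) - in_Y (Xvar j)) * g i j)"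
      by (simp add: std_seq_def in_X_def additive.zero[OF additive_in_Y])
  qed
  moreover have "kcontract r g {} n = kbasis {n..<r}"
  proof -
    have inv: "{j \<in> {..<r} - id ` {..<b}. j < id b} = {}" for b
      by auto
    have compl: "{..<r} - id ` {..<n} = {n..<r}"
      by auto
    have "kcontract r (\<lambda>i b. if i = id b then 1 else 0) {} n =
      alt (\<Sum>b<n. card {j \<in> {..<r} - id ` {..<b}. j < id b}) (kbasis ({..<r} - id ` {..<n}) :: _ \<Rightarrow> 'k laurent2)"
      by (rule kcontract_permutation[OF permutes_id n(2)])
    then show ?thesis
      unfolding inv compl by (simp add: g_def)
  qed
  moreover have "pair_Y U (kbasis {n..<r} T) = kbasis {n..<r} T" for T
  proof -
    have "pair_Y U 1 = 1"
      using pair_Y_single[of U 0 1] by (simp add: U_def const_1)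
    then show ?thesis
      by (simp add: kbasis_def additive.zero[OF additive_pair_Y])
  qed
  ultimately show ?thesis
    by simp
qed

text \<open>
  Boundaries have coefficients in the ideal of the variables. Hence no nonzero constant annihilates
  the class of \<open>e\<^sub>n \<and> \<dots> \<and> e\<^sub>r\<^sub>-\<^sub>1\<close>, and the normalization determines the sign as an element of \<open>k\<close>.
\<close>

lemma kbounds_std_seq_const:
  assumes "z \<in> kboundsC n r (std_seq n) p"
  shows "lookup (z T) 0 = 0"
proof -
  obtain v where z: "z = kdiff r (std_seq n) v" and v: "v \<in> koszul r (p + 1) (polys n)"
    using assms by (auto simp: koszul_0 elim!: kboundsE)
  have "lookup (std_seq n i * v T') 0 = 0" for i T'
  proof (cases "i < n")
    case True
    have "v T' \<in> polys n"
      by (rule koszul_in[OF v subgrp_0[OF subgrp_loc]])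
    moreover have "- single i (1::int) \<notin> poly_exps n"
    proof
      assume "- single i (1::int) \<in> poly_exps n"
      then have "0 \<le> lookup (- single i (1::int)) i"
        unfolding poly_exps_def by blast
      then show False
        by simp
    qed
    ultimately show ?thesis
      using True by (simp add: std_seq_def Xvar_def lookup_single_mult polys_iff) blast
  qed (simp add: std_seq_def)
  then show ?thesis
    by (simp add: z kdiff_def lookup_sum lookup_alt)
qed

lemma tau_sign_eq:
  assumes n: "1 \<le> n" "n \<le> r"
  shows "tau_sign n r = (alt (\<Sum>j<n. n - 1 - j) 1 :: 'k::comm_ring_1)"
proof -
  define e where "e = (\<Sum>j<n. n - 1 - j)"
  let ?K = "kbasis {n..<r} :: nat set \<Rightarrow> 'k laurent"
  let ?Z = "kboundsC n r (std_seq n :: nat \<Rightarrow> 'k laurent) (r - n)"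
  have "khom_scale n r (std_seq n) s (tau0 n r (std_seq n) (Hn_class n (inv_X n))) =
      (\<lambda>T. const s * alt e (?K T)) +o ?Z" for s
    unfolding tau0_std_seq[OF n] e_def[symmetric] by (rule khom_scale_coset)
  then have iff: "khom_scale n r (std_seq n) s (tau0 n r (std_seq n) (Hn_class n (inv_X n))) = ?K +o ?Z \<longleftrightarrow>
      (\<lambda>T. const s * alt e (?K T)) - ?K \<in> ?Z" for s
    by (simp add: coset_eq_iff[OF subgrp_kboundsC])
  have "s \<in> {1, - 1} \<and> (\<lambda>T. const s * alt e (?K T)) - ?K \<in> ?Z \<longleftrightarrow> s = alt e 1" for s
  proof
    assume s: "s \<in> {1, - 1} \<and> (\<lambda>T. const s * alt e (?K T)) - ?K \<in> ?Z"
    have "lookup (((\<lambda>T. const s * alt e (?K T)) - ?K) {n..<r}) 0 = 0"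
      by (rule kbounds_std_seq_const[OF conjunct2[OF s]])
    then have "s * alt e 1 = 1"
      by (simp add: kbasis_def lookup_minus lookup_const_mult lookup_alt)
    then have "alt e s = 1"
      by (simp add: alt_mult_right)
    then have "alt e (alt e s) = alt e 1"
      by simp
    then show "s = alt e 1"
      by (simp add: alt_alt) (simp add: alt_def)
  next
    assume s: "s = alt e 1"
    have "(\<lambda>T. const s * alt e (?K T)) = ?K"
      by (rule ext) (simp add: s alt_def const_1 const_minus)
    then show "s \<in> {1, - 1} \<and> (\<lambda>T. const s * alt e (?K T)) - ?K \<in> ?Z"
      using subgrp_0[OF subgrp_kboundsC[where n=n and r=r and f="std_seq n" and p="r - n"]] by (simp add: s alt_def del: minus_apply)
  qed
  then show ?thesis
    unfolding tau_sign_def iff e_def[symmetric] by simp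
qed

section \<open>Bihomogeneous components\<close>

lemma homog2_iff: "P \<in> homog2 n m q \<longleftrightarrow> (\<forall>b. lookup P b \<in> homog n m (q - wdeg n m b))"
proof -
  have "lookup P b \<in> homog n m (q - wdeg n m b) \<longleftrightarrow>
      (\<forall>a\<in>keys (lookup P b). wdeg n m a + wdeg n m b = q)" for b
    by (auto simp: homog_def)
  moreover have "b \<notin> keys P \<Longrightarrow> keys (lookup P b) = {}" for b
    by (simp add: in_keys_iff)
  ultimately show ?thesis
    by (auto simp: homog2_def)
qed

lemma subgrp_homog2: "subgrp (homog2 n m q :: 'k::ab_group_add laurent2 set)"
proof -
  have "(homog2 n m q :: 'k laurent2 set) = {P. \<forall>b. lookup P b \<in> homog n m (q - wdeg n m b)}"
    by (auto simp: homog2_iff)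
  then show ?thesis
    by (simp only: subgrp_coefficients subgrp_homog)
qed

lemma single_in_homog2: "x \<in> homog n m (q - wdeg n m b) \<Longrightarrow> single b x \<in> homog2 n m q"
  for x :: "'k::ab_group_add laurent"
  by (auto simp: homog2_iff lookup_single when_def subgrp_0[OF subgrp_homog])

lemma homog2_mult: "P \<in> homog2 n m q \<Longrightarrow> Q \<in> homog2 n m q' \<Longrightarrow> P * Q \<in> homog2 n m (q + q')"
  for P Q :: "'k::comm_ring_1 laurent2"
proof (rule mult_in_subgrp[OF subgrp_homog2])
  fix b c assume P: "P \<in> homog2 n m q" and Q: "Q \<in> homog2 n m q'"
    and b: "b \<in> keys P" and c: "c \<in> keys Q"
  have "lookup P b \<in> homog n m (q - wdeg n m b)"
    using P by (simp add: homog2_iff)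
  moreover have "lookup Q c \<in> homog n m (q' - wdeg n m c)"
    using Q by (simp add: homog2_iff)
  ultimately have "lookup P b * lookup Q c
      \<in> homog n m ((q - wdeg n m b) + (q' - wdeg n m c))"
    by (rule homog_mult)
  moreover have "(q - wdeg n m b) + (q' - wdeg n m c) = (q + q') - wdeg n m (b + c)"
    by (simp add: wdeg_add)
  ultimately have "lookup P b * lookup Q c \<in> homog n m ((q + q') - wdeg n m (b + c))"
    by (simp only:)
  then show "single (b + c) (lookup P b * lookup Q c) \<in> homog2 n m (q + q')"
    by (rule single_in_homog2)
qed

text \<open>
  A contraction by the column \<open>j\<close> that removes \<open>e\<^sub>i\<close> multiplies by \<open>g i j\<close>, of degree \<open>d\<^sub>i - m\<^sub>j\<close>.
\<close>

lemma kcontract_homog2: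
  fixes g :: "nat \<Rightarrow> nat \<Rightarrow> 'k::comm_ring_1 laurent2"
  assumes g: "\<And>i j. i < r \<Longrightarrow> j < k \<Longrightarrow> g i j \<in> homog2 n m (int (d i) - int (m j))"
  shows "T \<subseteq> {..<r} \<Longrightarrow>
    kcontract r g {} k T \<in> homog2 n m ((\<Sum>i\<in>{..<r} - T. int (d i)) - (\<Sum>j<k. int (m j)))"
  using g
proof (induction k arbitrary: T)
  case 0
  have "(1 :: 'k laurent2) \<in> homog2 n m 0"
    by (auto simp: homog2_def wdeg_0)
  then show ?case
    by (simp add: kbasis_def subgrp_0[OF subgrp_homog2])
next
  case (Suc k)
  have "g i k * kcontract r g {} k (insert i T) \<in>
      homog2 n m ((\<Sum>i\<in>{..<r} - T. int (d i)) - (\<Sum>j<Suc k. int (m j)))" if i: "i \<in> {..<r} - T" for i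
  proof -
    have "kcontract r g {} k (insert i T) \<in>
        homog2 n m ((\<Sum>i\<in>{..<r} - insert i T. int (d i)) - (\<Sum>j<k. int (m j)))"
      using Suc.prems i by (intro Suc.IH) auto
    moreover have "g i k \<in> homog2 n m (int (d i) - int (m k))"
      using Suc.prems i by auto
    ultimately have "g i k * kcontract r g {} k (insert i T) \<in> homog2 n m ((int (d i) - int (m k)) +
        ((\<Sum>i\<in>{..<r} - insert i T. int (d i)) - (\<Sum>j<k. int (m j))))"
      by (intro homog2_mult)
    moreover have "(\<Sum>i\<in>{..<r} - T. int (d i)) = int (d i) + (\<Sum>i\<in>{..<r} - insert i T. int (d i))"
    proof -
      have "{..<r} - T - {i} = {..<r} - insert i T"
        by auto
      then show ?thesis
        using i sum.remove[of "{..<r} - T" i "\<lambda>i. int (d i)"] by simp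
    qed
    ultimately show ?thesis
      by (simp add: algebra_simps)
  qed
  then show ?case
    by (auto simp: kdiff_def intro!: subgrp_sum[OF subgrp_homog2] subgrp_alt[OF subgrp_homog2])
qed

lemma lookup_hpart:
  "lookup (hpart n m p x) a = (if wdeg n m a = p then lookup x a else 0)"
proof -
  have "lookup (hpart n m p x) a =
      (\<Sum>b\<in>{b \<in> keys x. wdeg n m b = p}. if b = a then lookup x a else 0)"
    unfolding hpart_def lookup_sum by (intro sum.cong) (auto simp: lookup_single)
  then show ?thesis
    by (auto simp: in_keys_iff)
qed

lemma additive_hpart: "additive (hpart n m p)"
  unfolding additive_def by (auto intro!: poly_mapping_eqI simp: lookup_hpart lookup_add)

lemma hpart_homog: "x \<in> homog n m q \<Longrightarrow> hpart n m p x = (if p = q then x else 0)"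
  by (intro poly_mapping_eqI) (auto simp: lookup_hpart homog_def in_keys_iff)

lemma hpart_mult:
  fixes f y :: "'k::comm_ring_1 laurent"
  assumes f: "f \<in> homog n m e"
  shows "hpart n m p (f * y) = f * hpart n m (p - e) y"
proof (rule additive_eq_on_singles[where p=y])
  show "additive (\<lambda>y. hpart n m p (f * y))"
    by (rule additive_comp[OF additive_hpart additive_mult_left])
  show "additive (\<lambda>y. f * hpart n m (p - e) y)"
    by (rule additive_comp[OF additive_mult_left additive_hpart])
  fix a
  have s: "single a (lookup y a) \<in> homog n m (wdeg n m a)"
    by (auto simp: homog_def)
  show "hpart n m p (f * single a (lookup y a)) =
      f * hpart n m (p - e) (single a (lookup y a))"
    by (auto simp: hpart_homog[OF homog_mult[OF f s]] hpart_homog[OF s])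
qed

text \<open>
  The component of bidegree \<open>(p,q)\<close> of one coefficient of a chain, without the shift of \<open>p\<close> by the
  degree of \<open>e\<^sub>T\<close>.
\<close>

definition bihom :: "nat \<Rightarrow> (nat \<Rightarrow> nat) \<Rightarrow> int \<Rightarrow> int \<Rightarrow> 'k::comm_ring_1 laurent2 \<Rightarrow> 'k laurent2" where
  "bihom n m p q P = (\<Sum>b\<in>{b \<in> keys P. wdeg n m b = q}.
     single b (hpart n m p (lookup P b)))"

lemma bipart_eq_bihom: "bipart n m d p q = (\<lambda>z T. bihom n m (p - (\<Sum>i\<in>T. int (d i))) q (z T))"
  by (intro ext) (simp add: bipart_def bihom_def)

lemma lookup_bihom:
  "lookup (bihom n m p q P) b = (if wdeg n m b = q then hpart n m p (lookup P b) else 0)"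
proof -
  have "lookup (bihom n m p q P) b =
      (\<Sum>c\<in>{c \<in> keys P. wdeg n m c = q}. if c = b then hpart n m p (lookup P b) else 0)"
    unfolding bihom_def lookup_sum by (intro sum.cong) (auto simp: lookup_single)
  then show ?thesis
    by (auto simp: in_keys_iff additive.zero[OF additive_hpart])
qed

lemma additive_bihom: "additive (bihom n m p q)"
  unfolding additive_def
  by (auto intro!: poly_mapping_eqI simp: lookup_bihom lookup_add additive.add[OF additive_hpart])

lemma bihom_in_X_mult:
  assumes "f \<in> homog n m e"
  shows "bihom n m p q (in_X f * x) = in_X f * bihom n m (p - e) q x"
  by (rule poly_mapping_eqI) (auto simp: lookup_bihom in_X_def lookup_single_mult hpart_mult[OF assms])

lemma bihom_single:
  "bihom n m p q (single c x) = (if wdeg n m c = q then single c (hpart n m p x) else 0)"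
  by (intro poly_mapping_eqI) (auto simp: lookup_bihom lookup_single when_def additive.zero[OF additive_hpart])

lemma bihom_mult_in_Y:
  fixes f :: "'k::comm_ring_1 laurent"
  assumes f: "f \<in> homog n m e"
  shows "bihom n m p q (c * in_Y f) = bihom n m p (q - e) c * in_Y f"
proof (rule additive_eq_on_singles[where p=c])
  show "additive (\<lambda>c. bihom n m p q (c * in_Y f))"
    by (rule additive_comp[OF additive_bihom additive_mult_right])
  show "additive (\<lambda>c. bihom n m p (q - e) c * in_Y f)"
    by (rule additive_comp[OF additive_mult_right additive_bihom])
  fix b
  define y where "y = lookup c b"
  show "bihom n m p q (single b y * in_Y f) = bihom n m p (q - e) (single b y) * in_Y f"
  proof (rule additive_eq_on_singles[where p=f])
    show "additive (\<lambda>f. bihom n m p q (single b y * in_Y f))"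
      by (intro additive_comp[OF additive_bihom] additive_comp[OF additive_mult_left] additive_in_Y)
    show "additive (\<lambda>f. bihom n m p (q - e) (single b y) * in_Y f)"
      by (intro additive_comp[OF additive_mult_left] additive_in_Y)
    fix a assume "a \<in> keys f"
    then have a: "wdeg n m a = e"
      using f by (simp add: homog_def)
    define k where "k = const (lookup f a)"
    have "k \<in> homog n m 0"
      by (auto simp: k_def const_def homog_def wdeg_0)
    then have "hpart n m p (y * k) = hpart n m p y * k"
      using hpart_mult[of k n m 0 p y] by (simp add: mult.commute)
    then show "bihom n m p q (single b y * in_Y (single a (lookup f a))) =
        bihom n m p (q - e) (single b y) * in_Y (single a (lookup f a))"
      unfolding in_Y_single k_def[symmetric] by (auto simp: mult_single bihom_single wdeg_add a)
  qed
qed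

lemma bihom_in_polys2:
  assumes "P \<in> polys2 n"
  shows "bihom n m p q P \<in> polys2_Y n m q"
proof -
  have "hpart n m p (lookup P b) \<in> polys n \<and> (hpart n m p (lookup P b) \<noteq> 0 \<longrightarrow> b \<in> poly_exps n)" for b
  proof -
    have "b \<in> poly_exps n \<and> lookup P b \<in> polys n" if "lookup P b \<noteq> 0"
      using assms that by (auto simp: polys2_loc2 loc2_def)
    then show ?thesis
      by (cases "lookup P b = 0")
        (auto simp: polys_iff lookup_hpart additive.zero[OF additive_hpart])
  qed
  then show ?thesis
    by (auto simp: polys2_Y_def polys2_loc2 loc2_def lookup_bihom in_keys_iff split: if_splits)
qed

lemma subgrp_polys2: "subgrp (polys2 n)"
  by (simp add: polys2_loc2 subgrp_loc2)

lemma subgrp_polys2_Y: "subgrp (polys2_Y n m q :: 'k::ab_group_add laurent2 set)"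
proof -
  have "(polys2_Y n m q :: 'k laurent2 set) = polys2 n \<inter> {P. \<forall>b\<in>keys P. wdeg n m b = q}"
    by (auto simp: polys2_Y_def)
  then show ?thesis
    by (simp only: subgrp_Int subgrp_polys2 subgrp_support)
qed

lemma subgrp_idlY: "subgrp (idlY n r f)"
  unfolding idlY_def by (rule subgrp_ideal_gen[OF subgrp_polys2])

lemma idlY_mem: "c \<in> polys2 n \<Longrightarrow> i < r \<Longrightarrow> c * in_Y (f i) \<in> idlY n r f"
  unfolding idlY_def by (rule ideal_gen_mem) auto

lemma polys2_mult: "P \<in> polys2 n \<Longrightarrow> Q \<in> polys2 n \<Longrightarrow> P * Q \<in> polys2 n"
  for P Q :: "'k::comm_ring_1 laurent2"
  by (simp add: polys2_loc2 loc2_mult)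

text \<open>
  The ideal generated by the \<open>1 \<otimes> f\<^sub>i\<close> is bihomogeneous.
\<close>

lemma bihom_idlY:
  fixes f :: "nat \<Rightarrow> 'k::comm_ring_1 laurent"
  assumes f: "\<And>i. i < r \<Longrightarrow> f i \<in> polys n \<inter> homog n m (int (d i))" and P: "P \<in> idlY n r f"
  shows "bihom n m p q P \<in> polys2_Y n m q \<inter> idlY n r f"
proof -
  have "idlY n r f \<subseteq> {P. bihom n m p q P \<in> polys2_Y n m q \<inter> idlY n r f}"
    unfolding idlY_def
  proof (rule ideal_gen_subset)
    show "subgrp {P. bihom n m p q P \<in> polys2_Y n m q \<inter> ideal_gen (polys2 n) ((\<lambda>i. in_Y (f i)) ` {..<r})}"
      by (intro subgrp_vimage additive_bihom subgrp_Int subgrp_polys2_Y subgrp_ideal_gen subgrp_polys2)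
    fix c h :: "'k laurent2"
    assume c: "c \<in> polys2 n" and "h \<in> (\<lambda>i. in_Y (f i)) ` {..<r}"
    then obtain i where i: "i < r" and h: "h = in_Y (f i)"
      by auto
    have "bihom n m p q (c * h) = bihom n m p (q - int (d i)) c * in_Y (f i)"
      unfolding h using f[OF i] by (intro bihom_mult_in_Y) auto
    moreover have "bihom n m p (q - int (d i)) c \<in> polys2 n"
      using bihom_in_polys2[OF c] by (auto simp: polys2_Y_def)
    moreover have "c * h \<in> polys2 n"
      using f[OF i] c unfolding h by (intro polys2_mult) (auto simp: polys2_loc2 in_Y_in_loc2)
    ultimately show "c * h \<in> {P. bihom n m p q P \<in> polys2_Y n m q \<inter> ideal_gen (polys2 n) ((\<lambda>i. in_Y (f i)) ` {..<r})}"
      using bihom_in_polys2[of "c * h" n m p q] i by (auto intro!: ideal_gen_mem)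
  qed
  then show ?thesis
    using P by auto
qed

section \<open>The map defined by the Morley form\<close>

lemma Nabla_eq:
  fixes f :: "nat \<Rightarrow> 'k::comm_ring_1 laurent"
  assumes f: "\<And>i. i < r \<Longrightarrow> f i \<in> polys n"
  shows "Nabla n r f g = Delta n r g +o kbounds r (\<lambda>i. in_X (f i)) (polys2 n) (idlY n r f) (r - n)"
  unfolding Nabla_def Delta_class_def
proof (rule induced_coset[OF additive_ident _ subgrp_kbounds[OF subgrp_polys2 subgrp_zero]
      subgrp_kbounds[OF subgrp_polys2 subgrp_idlY]])
  show "(\<lambda>z. z) ` kbounds r (\<lambda>i. in_X (f i) - in_Y (f i)) (polys2 n) {0} (r - n)
      \<subseteq> kbounds r (\<lambda>i. in_X (f i)) (polys2 n) (idlY n r f) (r - n)"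
  proof clarify
    fix z assume "z \<in> kbounds r (\<lambda>i. in_X (f i) - in_Y (f i)) (polys2 n) {0} (r - n)"
    then obtain v where v: "v \<in> koszul r (r - n + 1) (polys2 n)"
      and z: "z = kdiff r (\<lambda>i. in_X (f i) - in_Y (f i)) v"
      by (auto simp: koszul_0 elim!: kboundsE)
    have vT: "v T \<in> polys2 n" for T
      by (rule koszul_in[OF v subgrp_0[OF subgrp_polys2]])
    have "kdiff r (\<lambda>i. in_X (f i)) v = z + kdiff r (\<lambda>i. in_Y (f i)) v"
      unfolding z kdiff_seq_add[symmetric] by simp
    then have "z = kdiff r (\<lambda>i. in_X (f i)) v + - kdiff r (\<lambda>i. in_Y (f i)) v"
      by (simp add: algebra_simps)
    moreover have "kdiff r (\<lambda>i. in_Y (f i)) v \<in> koszul r (r - n) (idlY n r f)"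
    proof -
      have "kdiff r (\<lambda>i. in_Y (f i)) v \<in> koszul r (r - n) (polys2 n)"
        using v f by (intro kdiff_koszul subgrp_polys2 polys2_mult) (auto simp: polys2_loc2 in_Y_in_loc2)
      moreover have "kdiff r (\<lambda>i. in_Y (f i)) v T \<in> idlY n r f" for T
        unfolding kdiff_def
      proof (rule subgrp_sum[OF subgrp_idlY])
        fix i assume "i \<in> {..<r} - T"
        then have "v (insert i T) * in_Y (f i) \<in> idlY n r f"
          by (intro idlY_mem vT) auto
        then show "alt (card {j \<in> T. j < i}) (in_Y (f i) * v (insert i T)) \<in> idlY n r f"
          by (simp add: subgrp_alt[OF subgrp_idlY] mult.commute)
      qed
      ultimately show ?thesis
        by (intro koszulI) (auto simp: koszul_zero)
    qed
    then have "- kdiff r (\<lambda>i. in_Y (f i)) v \<in> koszul r (r - n) (idlY n r f)"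
      by (rule subgrp_minus[OF subgrp_koszul[OF subgrp_idlY]])
    ultimately show "z \<in> kbounds r (\<lambda>i. in_X (f i)) (polys2 n) (idlY n r f) (r - n)"
      using v by (intro kboundsI)
  qed
qed

lemma Nabla_part_eq:
  fixes f :: "nat \<Rightarrow> 'k::comm_ring_1 laurent"
  assumes f: "\<And>i. i < r \<Longrightarrow> f i \<in> polys n \<inter> homog n m (int (d i))"
  shows "Nabla_part n m r d f g p q = bipart n m d p q (Delta n r g)
    +o kbounds r (\<lambda>i. in_X (f i)) (polys2_Y n m q) (polys2_Y n m q \<inter> idlY n r f) (r - n)"
proof -
  have Nabla: "Nabla n r f g = Delta n r g +o kbounds r (\<lambda>i. in_X (f i)) (polys2 n) (idlY n r f) (r - n)"
    using f by (intro Nabla_eq) auto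
  show ?thesis
    unfolding Nabla_part_def Nabla
  proof (rule induced_coset[OF _ _ subgrp_kbounds[OF subgrp_polys2 subgrp_idlY]
        subgrp_kbounds[OF subgrp_polys2_Y subgrp_Int[OF subgrp_polys2_Y subgrp_idlY]]])
    show "additive (bipart n m d p q)"
      by (simp add: bipart_eq_bihom additive_def fun_eq_iff additive.add[OF additive_bihom])
    show "bipart n m d p q ` kbounds r (\<lambda>i. in_X (f i)) (polys2 n) (idlY n r f) (r - n)
        \<subseteq> kbounds r (\<lambda>i. in_X (f i)) (polys2_Y n m q) (polys2_Y n m q \<inter> idlY n r f) (r - n)"
      unfolding bipart_eq_bihom
    proof (rule kbounds_map)
      fix T i and x :: "'k laurent2"
      assume T: "T \<subseteq> {..<r}" and i: "i < r" "i \<notin> T"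
      then have fin: "finite T"
        using finite_subset by blast
      have "bihom n m (p - (\<Sum>i\<in>T. int (d i))) q (in_X (f i) * x) =
          in_X (f i) * bihom n m (p - (\<Sum>i\<in>T. int (d i)) - int (d i)) q x"
        using f[OF i(1)] by (intro bihom_in_X_mult) auto
      then show "bihom n m (p - (\<Sum>i\<in>T. int (d i))) q (in_X (f i) * x) =
          in_X (f i) * bihom n m (p - (\<Sum>i\<in>insert i T. int (d i))) q x"
        using i fin by (simp add: algebra_simps)
    next
      show "bihom n m (p - (\<Sum>i\<in>T. int (d i))) q x \<in> polys2_Y n m q \<inter> idlY n r f"
        if "x \<in> idlY n r f" for T x
        using that by (intro bihom_idlY[where d=d] f)
    qed (auto intro: additive_bihom bihom_in_polys2 subgrp_0[OF subgrp_polys2])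
  qed
qed

lemma pair_Y_cong:
  assumes "\<And>b. b \<in> keys P \<Longrightarrow> U b = U' b"
  shows "pair_Y U P = pair_Y U' P"
  unfolding pair_Y_def using assms by (intro sum.cong) auto

text \<open>
  For an element of total degree \<open>p + q\<close>, a form that is supported in degree \<open>q\<close> sees only the
  component of bidegree \<open>(p,q)\<close>.
\<close>

lemma pair_Y_bihom:
  assumes P: "P \<in> homog2 n m (p + q)" and U: "\<And>b. U b \<noteq> 0 \<Longrightarrow> wdeg n m b = q"
  shows "pair_Y U (bihom n m p q P) = pair_Y U P"
proof -
  have "pair_Y U (P - bihom n m p q P) = 0"
    unfolding pair_Y_def
  proof (rule sum.neutral, rule ballI)
    fix b
    show "const (U b) * lookup (P - bihom n m p q P) b = 0"
    proof (cases "U b = 0")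
      case False
      then have b: "wdeg n m b = q"
        by (rule U)
      have "lookup P b \<in> homog n m (p + q - wdeg n m b)"
        using P by (simp add: homog2_iff)
      then have "lookup P b \<in> homog n m p"
        using b by simp
      then show ?thesis
        using b by (simp add: lookup_minus lookup_bihom hpart_homog)
    qed (simp add: const_0)
  qed
  then show ?thesis
    by (simp add: additive.diff[OF additive_pair_Y])
qed

lemma id_tensor_eq_pair_Y: "id_tensor n r f u = pair_Y (\<lambda>b. u (single b 1 +o idl n r f))"
  by (rule ext) (simp add: id_tensor_def pair_Y_def)

text \<open>
  All the maps in the definition of \<open>\<omega>\<close> act on the representative \<open>\<Delta>\<close>. Its coefficient at \<open>e\<^sub>T\<close> is
  homogeneous of degree \<open>\<delta> - \<Sum>i\<in>T. d i\<close>, so that taking the component of bidegree \<open>(\<nu>, \<delta> - \<nu>)\<close> before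
  applying \<open>id \<otimes> u\<close> changes nothing.
\<close>

lemma omega_part_eq:
  fixes f :: "nat \<Rightarrow> 'k::comm_ring_1 laurent"
  assumes n: "n \<le> r" and m: "\<And>j. j < n \<Longrightarrow> 0 < m j"
    and f: "\<And>i. i < r \<Longrightarrow> f i \<in> polys n \<inter> homog n m (int (d i))"
    and g: "\<And>i j. i < r \<Longrightarrow> j < n \<Longrightarrow> g i j \<in> polys2 n \<inter> homog2 n m (int (d i) - int (m j))"
    and q: "q = delta n m r d - \<nu>" and u: "u \<in> Bdual n m r f q"
  shows "omega_part n m r d f g \<nu> u =
    (\<lambda>T. pair_Y (form_coeff n m r f q u) (kcontract r g {} n T)) +o kboundsC n r f (r - n)"
proof -
  define U where "U = form_coeff n m r f q u"
  have U: "dual_coeffs n r f (nat q + 1) U"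
    unfolding U_def by (rule form_coeff_dual[OF m f u])
  have eqU: "id_tensor n r f u P = pair_Y U P" if "P \<in> polys2_Y n m q" for P
    unfolding id_tensor_eq_pair_Y using that
    by (intro pair_Y_cong) (auto simp: U_def form_coeff_def polys2_Y_def polys2_loc2 dest: loc2D)
  have add: "additive (id_tensor n r f u)"
    by (simp add: id_tensor_eq_pair_Y additive_pair_Y)
  have idlY: "pair_Y U P = 0" if "P \<in> idlY n r f" for P
  proof -
    have "idlY n r f \<subseteq> {P. pair_Y U P = 0}"
      unfolding idlY_def
    proof (rule ideal_gen_subset)
      show "subgrp {P. pair_Y U P = 0}"
        by (simp add: subgrp_def additive.zero[OF additive_pair_Y] additive.diff[OF additive_pair_Y])
      fix c h :: "'k laurent2" assume "c \<in> polys2 n" "h \<in> (\<lambda>i. in_Y (f i)) ` {..<r}"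
      then show "c * h \<in> {P. pair_Y U P = 0}"
        using pair_Y_in_Y_zero[OF U, of _ c "{}"] by (auto simp: polys2_loc2 mult.commute)
    qed
    then show ?thesis
      using that by auto
  qed
  have sub: "polys2_Y n m q \<subseteq> polys2 n"
    by (auto simp: polys2_Y_def)
  have Nabla: "Nabla_part n m r d f g \<nu> q = bipart n m d \<nu> q (Delta n r g)
    +o kbounds r (\<lambda>i. in_X (f i)) (polys2_Y n m q) (polys2_Y n m q \<inter> idlY n r f) (r - n)"
    by (intro Nabla_part_eq f)
  have "omega_part n m r d f g \<nu> u =
      (\<lambda>T. id_tensor n r f u (bipart n m d \<nu> q (Delta n r g) T)) +o kboundsC n r f (r - n)"
    unfolding omega_part_def q[symmetric] Nabla
  proof (rule induced_coset[OF _ _ subgrp_kbounds[OF subgrp_polys2_Y subgrp_Int[OF subgrp_polys2_Y subgrp_idlY]]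
        subgrp_kboundsC])
    show "additive (\<lambda>(z::nat set \<Rightarrow> 'k laurent2) T. id_tensor n r f u (z T))"
      by (simp add: additive_def fun_eq_iff additive.add[OF add])
    show "(\<lambda>z T. id_tensor n r f u (z T)) `
        kbounds r (\<lambda>i. in_X (f i)) (polys2_Y n m q) (polys2_Y n m q \<inter> idlY n r f) (r - n)
        \<subseteq> kboundsC n r f (r - n)"
    proof (rule kbounds_map[where \<phi>="\<lambda>_. id_tensor n r f u"])
      show "id_tensor n r f u (in_X (f i) * x) = f i * id_tensor n r f u x" for i x
        by (simp add: id_tensor_eq_pair_Y pair_Y_in_X)
      show "id_tensor n r f u x \<in> polys n" if "x \<in> polys2_Y n m q" for x
        using that sub by (auto simp: id_tensor_eq_pair_Y polys2_loc2 intro!: pair_Y_in_loc)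
      show "id_tensor n r f u x \<in> {0}" if "x \<in> polys2_Y n m q \<inter> idlY n r f" for x
        using that by (simp add: eqU idlY)
    qed (auto simp: add subgrp_0[OF subgrp_polys2_Y])
  qed
  also have "(\<lambda>T. id_tensor n r f u (bipart n m d \<nu> q (Delta n r g) T)) = (\<lambda>T. pair_Y U (kcontract r g {} n T))"
  proof
    fix T
    define Z where "Z = kcontract r g {} n"
    define p where "p = \<nu> - (\<Sum>i\<in>T. int (d i))"
    have Z: "Z \<in> koszul r (r - n) (polys2 n)"
      unfolding Z_def
      using kcontract_koszul[where r=r and k=n and g=g and S="{}" and R="polys2 n"] g n
      by (auto simp: polys2_loc2 subgrp_loc2 one_in_loc2 loc2_mult)
    have ZT: "Z T \<in> polys2 n"
      by (rule koszul_in[OF Z subgrp_0[OF subgrp_polys2]])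
    have "id_tensor n r f u (bipart n m d \<nu> q (Delta n r g) T) = pair_Y U (bihom n m p q (Z T))"
      unfolding Delta_eq_kcontract[OF n] bipart_eq_bihom Z_def[symmetric] p_def[symmetric]
      by (rule eqU[OF bihom_in_polys2[OF ZT]])
    also have "\<dots> = pair_Y U (Z T)"
    proof (cases "T \<subseteq> {..<r}")
      case True
      have "Z T \<in> homog2 n m ((\<Sum>i\<in>{..<r} - T. int (d i)) - (\<Sum>j<n. int (m j)))"
        unfolding Z_def using g True by (intro kcontract_homog2) auto
      moreover have "(\<Sum>i\<in>{..<r} - T. int (d i)) - (\<Sum>j<n. int (m j)) = p + q"
      proof -
        have "(\<Sum>i\<in>{..<r} - T. int (d i)) = (\<Sum>i<r. int (d i)) - (\<Sum>i\<in>T. int (d i))"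
          using True by (intro sum_diff) auto
        then show ?thesis
          by (simp add: p_def q delta_def)
      qed
      ultimately show ?thesis
        by (intro pair_Y_bihom) (auto simp: U_def form_coeff_def split: if_splits)
    next
      case False
      then have "Z T = 0"
        by (intro koszul_zero[OF Z]) auto
      then show ?thesis
        by (simp add: additive.zero[OF additive_bihom])
    qed
    finally show "id_tensor n r f u (bipart n m d \<nu> q (Delta n r g) T) = pair_Y U (kcontract r g {} n T)"
      by (simp add: Z_def)
  qed
  finally show ?thesis
    by (simp add: U_def)
qed

section \<open>Torsion classes and the theorem\<close>

lemma kboundsC_mult:
  assumes "c \<in> polys n" and "z \<in> kboundsC n r f p"
  shows "(\<lambda>T. c * z T) \<in> kboundsC n r f p"
proof -
  have "(\<lambda>z T. c * z T) ` kboundsC n r f p \<subseteq> kboundsC n r f p"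
    by (rule kbounds_map[where \<phi>="\<lambda>_ x. c * x"])
      (auto simp: additive_mult_left mult.left_commute subgrp_0[OF subgrp_loc] intro!: loc_mult assms)
  then show ?thesis
    using assms by auto
qed

text \<open>
  The power \<open>\<mm>\<^sup>e\<close>, described by the total degrees of monomials; hence all weights are 1.
\<close>

definition high_order :: "nat \<Rightarrow> nat \<Rightarrow> 'k::comm_ring_1 laurent set" where
  "high_order n e = {x \<in> polys n. \<forall>b\<in>keys x. int e \<le> wdeg n (\<lambda>_. 1) b}"

lemma subgrp_high_order: "subgrp (high_order n e :: 'k::comm_ring_1 laurent set)"
proof -
  have "(high_order n e :: 'k laurent set) = polys n \<inter> {x. \<forall>b\<in>keys x. int e \<le> wdeg n (\<lambda>_. 1) b}"
    by (auto simp: high_order_def)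
  then show ?thesis
    by (simp only: subgrp_Int subgrp_loc subgrp_support)
qed

lemma high_order_mult:
  assumes "x \<in> high_order n e" and "y \<in> high_order n e'"
  shows "x * y \<in> high_order n (e + e')"
proof -
  have "int (e + e') \<le> wdeg n (\<lambda>_. 1) b" if "b \<in> keys (x * y)" for b
  proof -
    have "b \<in> {a + c |a c. a \<in> keys x \<and> c \<in> keys y}"
      using keys_mult that by blast
    then obtain a c where "b = a + c" "a \<in> keys x" "c \<in> keys y"
      by blast
    then show ?thesis
      using assms by (fastforce simp: high_order_def wdeg_add)
  qed
  then show ?thesis
    using assms by (simp add: high_order_def loc_mult)
qed

lemma polys_high_order: "polys n = high_order n 0"
  using wdeg_poly_exps_nonneg[of _ n "\<lambda>_. 1"] by (auto simp: high_order_def polys_iff in_keys_iff)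

lemma ideal_gen_high_order:
  assumes "A \<subseteq> high_order n e"
  shows "ideal_gen (polys n) A \<subseteq> high_order n e"
proof (rule ideal_gen_subset[OF subgrp_high_order])
  fix c x :: "'a laurent" assume "c \<in> polys n" "x \<in> A"
  then show "c * x \<in> high_order n e"
    using assms high_order_mult[of c n 0 x e] by (auto simp: polys_high_order)
qed

lemma max_ideal_power_high_order: "max_ideal n ^ e \<subseteq> (high_order n e :: 'k::comm_ring_1 laurent set)"
proof (induction e)
  case 0
  have "(1 :: 'k laurent) \<in> polys n"
    using const_in_loc[of "1::'k" n "{}"] by (simp add: const_1)
  then show ?case
    by (auto simp: set_one polys_high_order[symmetric])
next
  case (Suc e)
  have "(Xvar j :: 'k laurent) \<in> high_order n 1" if j: "j < n" for j
  proof -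
    have "wdeg n (\<lambda>_. 1) (single j 1) = (\<Sum>i<n. if i = j then 1 else 0)"
      unfolding wdeg_def by (intro sum.cong) (auto simp: lookup_single)
    then have "wdeg n (\<lambda>_. 1) (single j 1) = 1"
      using j by simp
    then show ?thesis
      using j by (auto simp: high_order_def Xvar_def polys_iff lookup_single when_def poly_exps_single split: if_splits)
  qed
  then have "Xvar ` {..<n} \<subseteq> (high_order n 1 :: 'k laurent set)"
    by auto
  then have M: "max_ideal n \<subseteq> (high_order n 1 :: 'k laurent set)"
    unfolding max_ideal_def by (rule ideal_gen_high_order)
  show ?case
  proof
    fix x :: "'k laurent" assume "x \<in> max_ideal n ^ Suc e"
    then obtain a b where x: "x = a * b" "a \<in> max_ideal n" "b \<in> max_ideal n ^ e"
      by (auto elim!: set_times_elim)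
    then show "x \<in> high_order n (Suc e)"
      using high_order_mult[of a n 1 b e] M Suc.IH by auto
  qed
qed

text \<open>
  By the pigeonhole principle, a monomial of total degree at least \<open>n N\<close> is divisible by some
  \<open>X\<^sub>j\<close> to the power \<open>N\<close>.
\<close>

lemma high_order_annihilates:
  fixes z :: "nat set \<Rightarrow> 'k::comm_ring_1 laurent"
  assumes n: "1 \<le> n"
    and tors: "\<And>j. j < n \<Longrightarrow>
      (\<lambda>T. single (single j (int N)) 1 * z T) \<in> kboundsC n r f p"
    and x: "x \<in> high_order n (n * N)"
  shows "(\<lambda>T. x * z T) \<in> kboundsC n r f p"
proof (rule additive_in_on_singles[where p=x, OF _ subgrp_kboundsC])
  show "additive (\<lambda>x T. x * z T)"
    by (simp add: additive_def fun_eq_iff distrib_right)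
  fix b assume b: "b \<in> keys x"
  define c where "c = lookup x b"
  have pb: "b \<in> poly_exps n" and wb: "int (n * N) \<le> wdeg n (\<lambda>_. 1) b"
    using x b by (auto simp: high_order_def polys_iff in_keys_iff)
  have "\<exists>j<n. int N \<le> lookup b j"
  proof (rule ccontr)
    assume "\<not> (\<exists>j<n. int N \<le> lookup b j)"
    then have "(\<Sum>j<n. lookup b j) < (\<Sum>j<n. int N)"
      using n by (intro sum_strict_mono) (auto simp: not_le lessThan_empty_iff)
    then show False
      using wb by (simp add: wdeg_def)
  qed
  then obtain j where j: "j < n" "int N \<le> lookup b j"
    by blast
  define b' where "b' = b - single j (int N)"
  have b': "b' \<in> poly_exps n"
  proof -
    have "keys b' \<subseteq> {..<n}"
    proof
      fix i assume "i \<in> keys b'"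
      then have "i = j \<or> i \<in> keys b"
        by (auto simp: b'_def in_keys_iff lookup_minus lookup_single when_def split: if_splits)
      then show "i \<in> {..<n}"
        using j pb by (auto simp: poly_exps_def)
    qed
    moreover have "0 \<le> lookup b' i" for i
      using j pb by (auto simp: b'_def poly_exps_def lookup_minus lookup_single when_def)
    ultimately show ?thesis
      by (simp add: poly_exps_def)
  qed
  have "single b c =
      single b' c * single (single j (int N)) 1"
    by (simp add: mult_single b'_def)
  moreover have "(\<lambda>T. single b' c *
      (single (single j (int N)) 1 * z T)) \<in> kboundsC n r f p"
    using b' by (intro kboundsC_mult tors j) (auto simp: polys_iff lookup_single when_def split: if_splits)
  ultimately show "(\<lambda>T. single b c * z T) \<in> kboundsC n r f p"
    by (simp add: mult.assoc)
qed

lemma torsion_class_in_H0m: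
  fixes z :: "nat set \<Rightarrow> 'k::comm_ring_1 laurent"
  assumes n: "1 \<le> n" and z: "z \<in> koszul r p (polys n)" and cycle: "kdiff r f z = 0"
    and tors: "\<And>j. j < n \<Longrightarrow>
      (\<lambda>T. single (single j (int N)) 1 * z T) \<in> kboundsC n r f p"
  shows "z +o kboundsC n r f p \<in> H0m n r f p"
proof -
  have "z \<in> kcycles r f (polys n) {0} p"
    using z cycle by (simp add: kcycles_def koszul_0)
  then have "z +o kboundsC n r f p \<in> khomC n r f p"
    by (simp add: khomC_def khom_def quot_def)
  moreover have "induced (\<lambda>z T. a * z T) (kboundsC n r f p) (z +o kboundsC n r f p) = kboundsC n r f p"
    if a: "a \<in> ideal_gen (polys n) (max_ideal n ^ (n * N))" for a
  proof -
    have a': "a \<in> high_order n (n * N)"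
      using a ideal_gen_high_order[OF max_ideal_power_high_order] by blast
    have "induced (\<lambda>z T. a * z T) (kboundsC n r f p) (z +o kboundsC n r f p) =
        (\<lambda>T. a * z T) +o kboundsC n r f p"
    proof (rule induced_coset[OF _ _ subgrp_kboundsC subgrp_kboundsC])
      show "additive (\<lambda>(z::nat set \<Rightarrow> 'k laurent) T. a * z T)"
        by (simp add: additive_def fun_eq_iff distrib_left)
      show "(\<lambda>z T. a * z T) ` kboundsC n r f p \<subseteq> kboundsC n r f p"
        using a' by (auto simp: high_order_def intro!: kboundsC_mult)
    qed
    then show ?thesis
      using high_order_annihilates[OF n tors a'] by (simp add: coset_eq_self_iff[OF subgrp_kboundsC])
  qed
  ultimately show ?thesis
    unfolding H0m_def by blast
qed

theorem theorem8:
  fixes n r :: nat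
    and m d :: "nat \<Rightarrow> nat"
    and f :: "nat \<Rightarrow> 'k::comm_ring_1 laurent"
    and g :: "nat \<Rightarrow> nat \<Rightarrow> 'k laurent2"
  assumes "1 \<le> n" and "n \<le> r"
    and "\<And>j. j < n \<Longrightarrow> 0 < m j"
    and "\<And>i. i < r \<Longrightarrow> 0 < d i"
    and "\<And>i. i < r \<Longrightarrow> f i \<in> polys n \<inter> homog n m (int (d i))"
    and "morley_decomp n m r d f g"
    and "koszul_depth n r f = n"
  shows "tau_hat n m r d f \<in> dual_sum n m r d f \<rightarrow> H0m n r f (r - n)
    \<and> omega n m r d f g \<in> dual_sum n m r d f \<rightarrow> H0m n r f (r - n)
    \<and> (\<forall>u \<in> dual_sum n m r d f. tau_hat n m r d f u = omega n m r d f g u)"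
proof -
  note n = \<open>1 \<le> n\<close> and nr = \<open>n \<le> r\<close> and m = assms(3) and f = assms(5)
  have fp: "f i \<in> polys n" if "i < r" for i
    using f[OF that] by blast
  have g: "g i j \<in> polys2 n \<inter> homog2 n m (int (d i) - int (m j))" if "i < r" "j < n" for i j
    using assms(6) that by (simp add: morley_decomp_def)
  have g2: "g i j \<in> polys2 n" if "i < r" "j < n" for i j
    using g[OF that] by blast
  have decomp: "in_X (f i) - in_Y (f i) = (\<Sum>j<n. (in_X (Xvar j) - in_Y (Xvar j)) * g i j)" if "i < r" for i
    using assms(6) that by (simp add: morley_decomp_def)
  let ?Z = "kboundsC n r f (r - n)"
  define s where "s = (\<Sum>j<n. n - 1 - j)"
  define U where "U \<nu> u = form_coeff n m r f (delta n m r d - \<nu>) (u \<nu>)" for \<nu> u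
  define z where "z \<nu> u T = pair_Y (U \<nu> u) (kcontract r g {} n T)" for \<nu> u T
  have U: "dual_coeffs n r f (nat (delta n m r d - \<nu>) + 1) (U \<nu> u)"
    if "u \<in> dual_sum n m r d f" for \<nu> u
    unfolding U_def using that by (intro form_coeff_dual[OF m f]) (auto simp: dual_sum_def)
  have omega: "omega_part n m r d f g \<nu> (u \<nu>) = z \<nu> u +o ?Z" if "u \<in> dual_sum n m r d f" for \<nu> u
    unfolding z_def[abs_def] U_def using that
    by (intro omega_part_eq[OF nr m f g refl]) (auto simp: dual_sum_def)
  have tau: "tau n r f (dual_elt n m r d f \<nu> (u \<nu>)) = z \<nu> u +o ?Z" if u: "u \<in> dual_sum n m r d f" for \<nu> u
  proof -
    have "dual_elt n m r d f \<nu> (u \<nu>) = Hn_class n (dual_poly n (nat (delta n m r d - \<nu>) + 1) (U \<nu> u))"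
      unfolding U_def using u by (intro dual_elt_eq[OF n m f refl]) (auto simp: dual_sum_def)
    moreover have "tau0 n r f (Hn_class n (dual_poly n (nat (delta n m r d - \<nu>) + 1) (U \<nu> u))) =
        (\<lambda>T. alt s (z \<nu> u T)) +o ?Z"
      unfolding s_def z_def by (rule tau0_dual_poly[OF nr fp g2 decomp U[OF u] n])
    \<comment> \<open>The sign of the cocycle occurs twice: in the transgression and in its normalization.\<close>
    moreover have "(\<lambda>T. const (alt s 1 :: 'k) * alt s (z \<nu> u T)) = z \<nu> u"
      by (rule ext) (simp add: alt_def const_1 const_minus)
    ultimately show ?thesis
      by (simp only: tau_def tau_sign_eq[OF n nr] s_def[symmetric] khom_scale_coset)
  qed
  have eq: "tau_hat n m r d f u = omega n m r d f g u" if "u \<in> dual_sum n m r d f" for u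
    using tau[OF that] omega[OF that] by (simp add: tau_hat_def omega_def)
  moreover have "omega n m r d f g u \<in> H0m n r f (r - n)" if u: "u \<in> dual_sum n m r d f" for u
  proof -
    define I where "I = {\<nu>. u \<nu> \<noteq> 0}"
    have fin: "finite I"
      using u by (simp add: I_def dual_sum_def)
    define N where "N \<nu> = nat (delta n m r d - \<nu>) + 1" for \<nu>
    \<comment> \<open>A common exponent for the finitely many degrees \<open>\<nu>\<close>.\<close>
    define M where "M = (\<Sum>\<nu>\<in>I. N \<nu>)"
    have "(\<Sum>\<nu>\<in>I. z \<nu> u) +o ?Z \<in> H0m n r f (r - n)"
    proof (rule torsion_class_in_H0m[OF n, where N=M])
      show "(\<Sum>\<nu>\<in>I. z \<nu> u) \<in> koszul r (r - n) (polys n)"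
        unfolding z_def[abs_def]
        by (intro subgrp_sum subgrp_koszul subgrp_loc pair_Y_kcontract_koszul[OF nr fp g2 decomp U[OF u]])
      have "kdiff r f (z \<nu> u) = 0" for \<nu>
        unfolding z_def[abs_def] by (rule kdiff_pair_Y_kcontract[OF nr fp g2 decomp U[OF u]])
      then show "kdiff r f (\<Sum>\<nu>\<in>I. z \<nu> u) = 0"
        by (simp only: kdiff_sum sum.neutral_const)
      fix j assume j: "j < n"
      have "(\<lambda>T. single (single j (int M)) 1 * z \<nu> u T) \<in> ?Z" if \<nu>: "\<nu> \<in> I" for \<nu>
      proof -
        define L where "L = M - N \<nu>"
        have M: "M = L + N \<nu>"
          using member_le_sum[OF \<nu>, of N] fin by (simp add: L_def M_def)
        have "(\<lambda>T. single (single j (int (N \<nu>))) 1 * z \<nu> u T) \<in> ?Z"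
          unfolding z_def N_def
          by (intro kdiff_in_kboundsC pair_Y_kcontract_torsion[OF nr fp g2 decomp U[OF u] j])
        then have "(\<lambda>T. single (single j (int L)) 1 *
            (single (single j (int (N \<nu>))) 1 * z \<nu> u T)) \<in> ?Z"
          by (rule kboundsC_mult[rotated])
            (use j in \<open>auto simp: polys_iff lookup_single when_def poly_exps_single split: if_splits\<close>)
        then show ?thesis
          by (simp add: M mult.assoc[symmetric] mult_single single_add[symmetric])
      qed
      then have "(\<Sum>\<nu>\<in>I. (\<lambda>T. single (single j (int M)) 1 * z \<nu> u T)) \<in> ?Z"
        by (intro subgrp_sum[OF subgrp_kboundsC])
      moreover have "(\<Sum>\<nu>\<in>I. (\<lambda>T. single (single j (int M)) 1 * z \<nu> u T)) =
          (\<lambda>T. single (single j (int M)) 1 * (\<Sum>\<nu>\<in>I. z \<nu> u) T)"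
        by (rule ext) (simp add: sum_fun_apply sum_distrib_left)
      ultimately show "(\<lambda>T. single (single j (int M)) 1 * (\<Sum>\<nu>\<in>I. z \<nu> u) T) \<in> ?Z"
        by simp
    qed
    then show ?thesis
      using omega[OF u] sum_cosets[OF fin subgrp_kboundsC[where n=n and r=r and f=f and p="r - n"]]
      by (simp add: omega_def I_def)
  qed
  ultimately show ?thesis
    by auto
qed

end
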